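(* Let $(X,d)$ be a compact metric space, let $\alpha:\mathbb{Z}_+^k\to C^r(X,X)$ ($r\ge 0$) be a $C^r$ $\mathbb{Z}_+^k$-action on $X$ with generators $f_1,\dots,f_k$, let $\nu$ be a probability measure on the set of generators with $\nu_i=\nu(f_i)$, and let $f$ be the induced random $\mathbb{Z}_+^k$-action over $(\Omega,\mathcal{A},\mathbf{P}_\nu,\sigma)$, with topological entropy $h(f)$. (1) If the generators $f_i$, $1\le i\le k$, are all Lipschitz maps with Lipschitz constants $L(f_i)$ respectively, then $$h(f)\le D(X)\sum_{i=1}^k\nu_i\log L^+(f_i),$$ where $L^+(f_i)=\max\{1,L(f_i)\}$ and $D(X)$ is the ball dimension of $X$. (2) If $X$ is a finite graph and the generators $f_i$, $1\le i\le k$, are all homeomorphisms, then $h(f)=0$. (3) If $X=M$ is a closed oriented Riemannian manifold and the generators $f_i$, $1\le i\le k$, are all $C^1$ expanding maps, then $$h(f)=\sum_{i=1}^k\nu_i\log|\deg(f_i)|,$$ where $\deg(f_i)$ is the degree of $f_i$.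
   Context: $\mathbb{Z}_+=\{0,1,2,\dots\}$. $C^0(X,X)$ is the space of continuous self-maps of $X$; for $r\ge1$, $X$ is a closed (compact, boundaryless) $C^\infty$ Riemannian manifold and $C^r(X,X)$ is the space of $C^r$ self-maps. A $\mathbb{Z}_+^k$-action $\alpha$ is a monoid homomorphism into $C^r(X,X)$ under composition; its generators $f_i=\alpha(\vec e_i)$ ($\vec e_i$ the standard basis vectors) are pairwise commuting, not necessarily invertible maps. $\mathcal{G}_\alpha=\{f_1,\dots,f_k\}$ is viewed as $k$ labelled symbols, so that $\sum_i\nu_i=1$. Random action: $\Omega=\mathcal{G}_\alpha^{\mathbb{Z}_+}$ with product $\sigma$-algebra $\mathcal{A}$, left shift $\sigma$, $\mathbf{P}_\nu=\nu^{\mathbb{Z}_+}$. For $\omega=(\omega_n)$, $f_\omega=\omega_0$, $f_\omega^0=\mathrm{id}$, $f_\omega^n=f_{\sigma^{n-1}\omega}\circ\cdots\circ f_{\sigma\omega}\circ f_\omega$ for $n>0$. The random action $f$ is the system of random compositions $f_\omega^n$, $n\in\mathbb{Z}_+$. Topological entropy: let $d_\omega^n(x,y)=\max_{0\le i\le n-1}d(f_\omega^i(x),f_\omega^i(y))$, and let $r(\omega,n,\varepsilon,X)$ be the smallest cardinality of a set $F\subset X$ such that every $x\in X$ has some $y\in F$ with $d_\omega^n(x,y)\le\varepsilon$. Then $$h(f)=\lim_{\varepsilon\to0}\limsup_{n\to\infty}\frac1n\int_\Omega\log r(\omega,n,\varepsilon,X)\,d\mathbf{P}_\nu(\omega).$$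 Ball dimension: $D(X)=\limsup_{\varepsilon\to0}\frac{\log b(\varepsilon)}{|\log\varepsilon|}\in[0,\infty]$, where $b(\varepsilon)$ is the minimum cardinality of a covering of $X$ by $\varepsilon$-balls (convention $0\cdot\infty=0$). Expanding: in (3), a $C^1$ map $g:M\to M$ is expanding if there is $\kappa>1$ with $\|Dg(x)v\|\ge\kappa\|v\|$ for all $x\in M$, $v\in T_xM$, in the given Riemannian metric. $M$ in (3) is taken connected so that the degree is the usual one. *)

theory Defs
  imports "HOL-Probability.Probability"
begin

section \<open>Random actions and their entropy\<close>

text \<open>The space is a whole type \<open>'a\<close> of class \<open>metric_space\<close>. A \<open>\<int>\<^sub>+\<^sup>k\<close>-action is indexed by
  \<open>nat ^ 'k\<close>, with \<open>k = CARD('k)\<close>. The generators are labelled by \<open>'k\<close>, so a sequence \<open>\<omega>\<close> of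
  generators is a sequence of labels.\<close>

definition generator :: "(nat ^ 'k \<Rightarrow> 'a \<Rightarrow> 'a) \<Rightarrow> 'k \<Rightarrow> 'a \<Rightarrow> 'a" where
  "generator \<alpha> i = \<alpha> (axis i 1)"

definition monoid_action :: "(nat ^ 'k \<Rightarrow> 'a \<Rightarrow> 'a) \<Rightarrow> bool" where
  "monoid_action \<alpha> \<longleftrightarrow> \<alpha> 0 = id \<and> (\<forall>a b. \<alpha> (a + b) = \<alpha> a \<circ> \<alpha> b)"

definition path_measure :: "'k pmf \<Rightarrow> (nat \<Rightarrow> 'k) measure" where
  "path_measure \<nu> = (\<Pi>\<^sub>M n\<in>(UNIV :: nat set). measure_pmf \<nu>)"

text \<open>\<open>random_iter f \<omega> n = f (\<omega> (n-1)) \<circ> \<dots> \<circ> f (\<omega> 0)\<close>: the generator attached to the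
  \<open>n\<close>-fold shift of \<open>\<omega>\<close> is the one labelled \<open>\<omega> n\<close>.\<close>

primrec random_iter :: "('k \<Rightarrow> 'a \<Rightarrow> 'a) \<Rightarrow> (nat \<Rightarrow> 'k) \<Rightarrow> nat \<Rightarrow> 'a \<Rightarrow> 'a" where
  "random_iter f \<omega> 0 = id"
| "random_iter f \<omega> (Suc n) = f (\<omega> n) \<circ> random_iter f \<omega> n"

text \<open>Only meaningful for \<open>n \<ge> 1\<close>; the term \<open>n = 0\<close> is irrelevant in the definition of entropy.\<close>

definition bowen_dist ::
    "('k \<Rightarrow> 'a \<Rightarrow> 'a) \<Rightarrow> (nat \<Rightarrow> 'k) \<Rightarrow> nat \<Rightarrow> 'a::metric_space \<Rightarrow> 'a \<Rightarrow> real" where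
  "bowen_dist f \<omega> n x y = Max ((\<lambda>i. dist (random_iter f \<omega> i x) (random_iter f \<omega> i y)) ` {..<n})"

definition spanning_number ::
    "('k \<Rightarrow> 'a::metric_space \<Rightarrow> 'a) \<Rightarrow> (nat \<Rightarrow> 'k) \<Rightarrow> nat \<Rightarrow> real \<Rightarrow> nat" where
  "spanning_number f \<omega> n \<epsilon> =
     (LEAST m. \<exists>F. finite F \<and> card F = m \<and> (\<forall>x. \<exists>y\<in>F. bowen_dist f \<omega> n x y \<le> \<epsilon>))"

definition random_entropy :: "'k pmf \<Rightarrow> ('k \<Rightarrow> 'a::metric_space \<Rightarrow> 'a) \<Rightarrow> ereal" where
  "random_entropy \<nu> f =
     Lim (at_right 0) (\<lambda>\<epsilon>::real. limsup (\<lambda>n.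
       ereal (1 / real n * (\<integral>\<omega>. ln (real (spanning_number f \<omega> n \<epsilon>)) \<partial>path_measure \<nu>))))"

section \<open>Ball dimension\<close>

definition ball_cover_number :: "'a::metric_space set \<Rightarrow> real \<Rightarrow> nat" where
  "ball_cover_number X \<epsilon> =
     (LEAST m. \<exists>F. F \<subseteq> X \<and> finite F \<and> card F = m \<and> X \<subseteq> (\<Union>x\<in>F. ball x \<epsilon>))"

definition ball_dimension :: "'a::metric_space set \<Rightarrow> ereal" where
  "ball_dimension X =
     Limsup (at_right 0) (\<lambda>\<epsilon>::real. ereal (ln (real (ball_cover_number X \<epsilon>)) / \<bar>ln \<epsilon>\<bar>))"

section \<open>Finite graphs\<close>

text \<open>\<open>V\<close> are the vertices and \<open>\<Gamma>\<close> the edges, each given by a parametrization on \<open>[0,1]\<close> which is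
  injective except that its two endpoints may coincide (a loop).\<close>

definition finite_graph :: "'a::topological_space set \<Rightarrow> bool" where
  "finite_graph X \<longleftrightarrow> (\<exists>V \<Gamma>. finite V \<and> finite \<Gamma> \<and>
     X = V \<union> (\<Union>\<gamma>\<in>\<Gamma>. path_image \<gamma>) \<and>
     (\<forall>\<gamma>\<in>\<Gamma>. simple_path \<gamma> \<and> pathstart \<gamma> \<in> V \<and> pathfinish \<gamma> \<in> V \<and> \<gamma> ` {0<..<1} \<inter> V = {}) \<and>
     (\<forall>\<gamma>\<in>\<Gamma>. \<forall>\<delta>\<in>\<Gamma>. \<gamma> \<noteq> \<delta> \<longrightarrow> path_image \<gamma> \<inter> path_image \<delta> \<subseteq> V))"

section \<open>Closed Riemannian manifolds\<close>

text \<open>Maps of class \<open>C\<^sup>k\<close> on an open set \<open>S\<close>.\<close>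

primrec Ck_on :: "nat \<Rightarrow> ('v::real_normed_vector \<Rightarrow> 'w::real_normed_vector) \<Rightarrow> 'v set \<Rightarrow> bool" where
  "Ck_on 0 f S \<longleftrightarrow> continuous_on S f"
| "Ck_on (Suc k) f S \<longleftrightarrow>
     (\<forall>x\<in>S. f differentiable (at x)) \<and> (\<forall>v. Ck_on k (\<lambda>x. frechet_derivative f (at x) v) S)"

text \<open>A chart is a pair of an open domain and a coordinate map on it.\<close>

type_synonym ('a, 'n) chart = "'a set \<times> ('a \<Rightarrow> real ^ 'n)"

definition local_rep ::
    "('a, 'n) chart \<Rightarrow> ('a, 'n) chart \<Rightarrow> ('a \<Rightarrow> 'a) \<Rightarrow> real ^ 'n \<Rightarrow> real ^ 'n" where
  "local_rep c c' f = snd c' \<circ> f \<circ> inv_into (fst c) (snd c)"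

definition local_deriv ::
    "('a, 'n::finite) chart \<Rightarrow> ('a, 'n) chart \<Rightarrow> ('a \<Rightarrow> 'a) \<Rightarrow> 'a \<Rightarrow> real ^ 'n \<Rightarrow> real ^ 'n" where
  "local_deriv c c' f x = frechet_derivative (local_rep c c' f) (at (snd c x))"

definition smooth_atlas :: "('a::topological_space, 'n::finite) chart set \<Rightarrow> bool" where
  "smooth_atlas A \<longleftrightarrow>
     (\<Union>c\<in>A. fst c) = UNIV \<and>
     (\<forall>(U, \<phi>)\<in>A. open U \<and> open (\<phi> ` U) \<and> homeomorphism U (\<phi> ` U) \<phi> (inv_into U \<phi>)) \<and>
     (\<forall>c\<in>A. \<forall>c'\<in>A. \<forall>k. Ck_on k (local_rep c c' id) (snd c ` (fst c \<inter> fst c')))"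

definition oriented_atlas :: "('a::topological_space, 'n::finite) chart set \<Rightarrow> bool" where
  "oriented_atlas A \<longleftrightarrow> smooth_atlas A \<and>
     (\<forall>c\<in>A. \<forall>c'\<in>A. \<forall>x\<in>fst c \<inter> fst c'. det (matrix (local_deriv c c' id x)) > 0)"

definition Cr_map ::
    "('a::topological_space, 'n::finite) chart set \<Rightarrow> nat \<Rightarrow> ('a \<Rightarrow> 'a) \<Rightarrow> bool" where
  "Cr_map A r f \<longleftrightarrow> continuous_on UNIV f \<and>
     (\<forall>c\<in>A. \<forall>c'\<in>A. Ck_on r (local_rep c c' f) (snd c ` (fst c \<inter> f -` fst c')))"

text \<open>Tangent vectors at \<open>x\<close> are written in coordinates of a chart \<open>c\<close> around \<open>x\<close>; \<open>g c x\<close> is the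
  inner product on the tangent space at \<open>x\<close> in these coordinates.\<close>

type_synonym ('a, 'n) metric_tensor =
  "('a, 'n) chart \<Rightarrow> 'a \<Rightarrow> real ^ 'n \<Rightarrow> real ^ 'n \<Rightarrow> real"

definition riemannian_metric ::
    "('a::topological_space, 'n::finite) chart set \<Rightarrow> ('a, 'n) metric_tensor \<Rightarrow> bool" where
  "riemannian_metric A g \<longleftrightarrow>
     (\<forall>c\<in>A. \<forall>x\<in>fst c. bilinear (g c x) \<and> (\<forall>u v. g c x u v = g c x v u) \<and>
        (\<forall>v. v \<noteq> 0 \<longrightarrow> g c x v v > 0)) \<and>
     (\<forall>c\<in>A. \<forall>u v k. Ck_on k (\<lambda>p. g c (inv_into (fst c) (snd c) p) u v) (snd c ` fst c)) \<and>
     (\<forall>c\<in>A. \<forall>c'\<in>A. \<forall>x\<in>fst c \<inter> fst c'. \<forall>u v.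
        g c x u v = g c' x (local_deriv c c' id x u) (local_deriv c c' id x v))"

definition tangent_norm ::
    "('a, 'n::finite) metric_tensor \<Rightarrow> ('a, 'n) chart \<Rightarrow> 'a \<Rightarrow> real ^ 'n \<Rightarrow> real" where
  "tangent_norm g c x v = sqrt (g c x v v)"

text \<open>\<open>\<gamma> : [0,1] \<rightarrow> M\<close> is a piecewise \<open>C\<^sup>1\<close> curve with speed \<open>s\<close> (off the finite set \<open>S\<close>) and
  length \<open>l\<close>. As in the library's notion of piecewise \<open>C\<^sup>1\<close> function, one-sided derivatives need
  not exist at the break points; integrability of the speed is then part of having a length.\<close>

definition has_length ::
    "('a::topological_space, 'n::finite) chart set \<Rightarrow> ('a, 'n) metric_tensor \<Rightarrow>
     (real \<Rightarrow> 'a) \<Rightarrow> real \<Rightarrow> bool" where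
  "has_length A g \<gamma> l \<longleftrightarrow> path \<gamma> \<and>
     (\<exists>S s. finite S \<and> (s has_integral l) {0..1} \<and>
       (\<forall>c\<in>A. (snd c \<circ> \<gamma>) C1_differentiable_on {t \<in> {0..1} - S. \<gamma> t \<in> fst c} \<and>
         (\<forall>t\<in>{0..1} - S. \<gamma> t \<in> fst c \<longrightarrow>
            s t = tangent_norm g c (\<gamma> t) (vector_derivative (snd c \<circ> \<gamma>) (at t)))))"

definition curve_lengths ::
    "('a::topological_space, 'n::finite) chart set \<Rightarrow> ('a, 'n) metric_tensor \<Rightarrow> 'a \<Rightarrow> 'a \<Rightarrow> real set" where
  "curve_lengths A g x y = {l. \<exists>\<gamma>. pathstart \<gamma> = x \<and> pathfinish \<gamma> = y \<and> has_length A g \<gamma> l}"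

text \<open>The metric of the type is the Riemannian distance. Between distinct components, where that
  distance is infinite, \<open>dist\<close> is only required to induce the topology.\<close>

definition closed_riemannian_manifold ::
    "('a::metric_space, 'n::finite) chart set \<Rightarrow> ('a, 'n) metric_tensor \<Rightarrow> bool" where
  "closed_riemannian_manifold A g \<longleftrightarrow>
     compact (UNIV :: 'a set) \<and> smooth_atlas A \<and> riemannian_metric A g \<and>
     (\<forall>x y. curve_lengths A g x y \<noteq> {} \<longrightarrow> dist x y = Inf (curve_lengths A g x y))"

definition expanding ::
    "('a, 'n::finite) chart set \<Rightarrow> ('a, 'n) metric_tensor \<Rightarrow> ('a \<Rightarrow> 'a) \<Rightarrow> bool" where
  "expanding A g f \<longleftrightarrow> (\<exists>\<kappa>>1. \<forall>c\<in>A. \<forall>c'\<in>A. \<forall>x\<in>fst c \<inter> f -` fst c'. \<forall>v.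
     tangent_norm g c' (f x) (local_deriv c c' f x v) \<ge> \<kappa> * tangent_norm g c x v)"

section \<open>Degree\<close>

text \<open>The degree of a \<open>C\<^sup>1\<close> self-map of a closed connected oriented manifold: the number of preimages
  of a regular value, counted with the sign of the Jacobian determinant in oriented charts. The sign
  does not depend on the charts, and the count does not depend on the regular value.\<close>

definition local_sign ::
    "('a, 'n::finite) chart set \<Rightarrow> ('a \<Rightarrow> 'a) \<Rightarrow> 'a \<Rightarrow> real" where
  "local_sign A f x = (THE s. \<forall>c\<in>A. \<forall>c'\<in>A. x \<in> fst c \<and> f x \<in> fst c' \<longrightarrow>
     s = sgn (det (matrix (local_deriv c c' f x))))"

definition regular_value ::
    "('a, 'n::finite) chart set \<Rightarrow> ('a \<Rightarrow> 'a) \<Rightarrow> 'a \<Rightarrow> bool" where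
  "regular_value A f y \<longleftrightarrow> (\<forall>x\<in>f -` {y}. \<forall>c\<in>A. \<forall>c'\<in>A. x \<in> fst c \<and> f x \<in> fst c' \<longrightarrow>
     surj (local_deriv c c' f x))"

definition mapping_degree ::
    "('a, 'n::finite) chart set \<Rightarrow> ('a \<Rightarrow> 'a) \<Rightarrow> int" where
  "mapping_degree A f = (THE m. \<forall>y. regular_value A f y \<longrightarrow> real_of_int m = (\<Sum>x\<in>f -` {y}. local_sign A f x))"

section \<open>Actions of class \<open>C\<^sup>r\<close>\<close>

text \<open>For \<open>r = 0\<close> the manifold data \<open>A\<close> and \<open>g\<close> play no role.\<close>

definition Cr_action ::
    "('a::metric_space, 'n::finite) chart set \<Rightarrow> ('a, 'n) metric_tensor \<Rightarrow> nat \<Rightarrow>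
     (nat ^ 'k \<Rightarrow> 'a \<Rightarrow> 'a) \<Rightarrow> bool" where
  "Cr_action A g r \<alpha> \<longleftrightarrow> monoid_action \<alpha> \<and>
     (if r = 0 then \<forall>a. continuous_on UNIV (\<alpha> a)
      else closed_riemannian_manifold A g \<and> (\<forall>a. Cr_map A r (\<alpha> a)))"

end

theory Submission
  imports Defs
begin

text \<open>The spanning numbers along \<open>\<omega>\<close> depend on finitely many coordinates only, so a bound
  \<open>ln r(\<omega>, n, \<epsilon>) \<le> o(n) + (\<Sum>j<n. a (\<omega> j))\<close>, or the reverse one, integrates to a bound of the entropy by
  \<open>\<Sum>i. \<nu>\<^sub>i a\<^sub>i\<close>. For Lipschitz generators such a bound comes from covering by balls of radius
  \<open>\<epsilon> / (L\<^sup>+(f\<^bsub>\<omega> 0\<^esub>) \<dots> L\<^sup>+(f\<^bsub>\<omega> (n-1)\<^esub>))\<close>. On a finite graph, take a finite set \<open>E\<close> whose complement has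
  components of diameter at most \<open>\<epsilon>\<close>; removing the preimages of \<open>E\<close> under the first \<open>n\<close> iterates leaves
  \<open>O(n)\<close> components, and the points of such a component stay \<open>\<epsilon>\<close>-close, so \<open>r(\<omega>, n, \<epsilon>) = O(n)\<close>.

  An expanding map is a local diffeomorphism whose inverse branches do not increase distances,
  because short curves lift to curves that are not longer. Hence all fibres have the same number
  \<open>N\<^sub>i\<close> of points, which is \<open>\<bar>deg f\<^sub>i\<bar>\<close> as all local signs agree. Pulling back a fixed \<open>\<epsilon>\<close>-dense set
  gives a spanning set of cardinality \<open>C(\<epsilon>) N\<^bsub>\<omega> 0\<^esub> \<dots> N\<^bsub>\<omega> (n-1)\<^esub>\<close>, and by uniform local injectivity the
  preimages of a single point are separated.\<close>

section \<open>Spanning numbers\<close>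

text \<open>On a graph the linear growth rests on injectivity: the preimage of \<open>E\<close>
  under any iterate has no more points than \<open>E\<close>, in whatever order the generators
  occur. For Lipschitz maps, \<open>D\<close> enters because the logarithm of the covering number at
  radius \<open>\<delta>\<close> is at most \<open>D * \<bar>ln \<delta>\<bar>\<close> for small
  \<open>\<delta>\<close> and any \<open>D\<close> above the ball dimension. The obstacle in the
  expanding case is that the distance is only an infimum of lengths of piecewise C1 curves, and that
  having a length includes integrability of the speed. A lift is a priori just continuous: its
  velocity comes from solving a linear equation in coordinates, the continuity of the velocity from
  Cramer's rule, and integrability of the speed from domination by the speed of the curve below. A
  shortest curve need not exist, so all sufficiently short curves are lifted by one local inverse,
  which fixes the endpoint before the infimum is taken. As inverse branches do not increase
  distances, a single radius serves at every step of a pullback, and no constants accumulate with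
  \<open>n\<close>.\<close>

lemma bowen_dist_le_iff:
  assumes "n > 0"
  shows "bowen_dist f \<omega> n x y \<le> \<epsilon> \<longleftrightarrow>
    (\<forall>i<n. dist (random_iter f \<omega> i x) (random_iter f \<omega> i y) \<le> \<epsilon>)"
  unfolding bowen_dist_def using assms by (subst Max_le_iff) auto

lemma random_iter_cong:
  "(\<And>j. j < n \<Longrightarrow> \<omega> j = \<omega>' j) \<Longrightarrow> random_iter f \<omega> n = random_iter f \<omega>' n"
  by (induction n) auto

lemma bowen_dist_cong:
  assumes "\<And>j. j < n \<Longrightarrow> \<omega> j = \<omega>' j"
  shows "bowen_dist f \<omega> n = bowen_dist f \<omega>' n"
proof -
  have "random_iter f \<omega> i = random_iter f \<omega>' i" if "i < n" for i
    using assms that by (intro random_iter_cong) auto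
  then show ?thesis
    unfolding bowen_dist_def by (intro ext arg_cong[where f=Max] image_cong) auto
qed

lemma spanning_number_cong:
  assumes "\<And>j. j < n \<Longrightarrow> \<omega> j = \<omega>' j"
  shows "spanning_number f \<omega> n \<epsilon> = spanning_number f \<omega>' n \<epsilon>"
proof -
  have "bowen_dist f \<omega> n = bowen_dist f \<omega>' n" by (rule bowen_dist_cong) (rule assms)
  then show ?thesis unfolding spanning_number_def by simp
qed

lemma continuous_on_random_iter:
  assumes "\<forall>i. continuous_on UNIV (f i)"
  shows "continuous_on UNIV (random_iter f \<omega> n)"
proof (induction n)
  case (Suc n)
  then show ?case
    unfolding random_iter.simps
    by (rule continuous_on_compose) (rule continuous_on_subset[OF spec[OF assms]], simp)
qed (auto simp: id_def)

lemma inj_random_iter: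
  assumes "\<And>i. inj (f i)"
  shows "inj (random_iter f \<omega> n)"
proof (induction n)
  case (Suc n)
  then show ?case unfolding random_iter.simps by (rule inj_compose[OF assms])
qed simp

lemma spanning_number_le:
  assumes "finite F" "\<And>x. \<exists>y\<in>F. bowen_dist f \<omega> n x y \<le> \<epsilon>"
  shows "spanning_number f \<omega> n \<epsilon> \<le> card F"
  unfolding spanning_number_def by (rule Least_le, rule exI[of _ F]) (use assms in simp)

text \<open>The \<open>LEAST\<close> in \<open>spanning_number\<close> says something only if a
  finite spanning set exists. The first \<open>n\<close> iterates are uniformly continuous, so a
  sufficiently fine finite net of the compact space is one.\<close>

lemma exists_finite_spanning:
  fixes f :: "'k \<Rightarrow> 'a::metric_space \<Rightarrow> 'a"
  assumes "compact (UNIV :: 'a set)" and cont: "\<forall>i. continuous_on UNIV (f i)"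
    and "n > 0" "\<epsilon> > 0"
  shows "\<exists>F. finite F \<and> (\<forall>x. \<exists>y\<in>F. bowen_dist f \<omega> n x y \<le> \<epsilon>)"
proof -
  have "\<exists>d>0. \<forall>x y. dist x y < d \<longrightarrow> dist (random_iter f \<omega> i x) (random_iter f \<omega> i y) < \<epsilon>" for i
    using compact_uniformly_continuous[OF continuous_on_random_iter[of f \<omega> i, OF cont] assms(1)]
      \<open>\<epsilon> > 0\<close> unfolding uniformly_continuous_on_def by (simp add: dist_commute)
  then obtain d where d: "\<And>i. d i > 0"
    "\<And>i x y. dist x y < d i \<Longrightarrow> dist (random_iter f \<omega> i x) (random_iter f \<omega> i y) < \<epsilon>"
    by metis
  define e where "e = Min (d ` {..<n})"
  have e: "e > 0" "\<And>i. i < n \<Longrightarrow> e \<le> d i"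
    using d(1) \<open>n > 0\<close> unfolding e_def by (subst Min_gr_iff) auto
  obtain F where F: "finite F" "(UNIV :: 'a set) \<subseteq> (\<Union>x\<in>F. ball x e)"
    using assms(1) e(1) unfolding compact_eq_totally_bounded by blast
  have "\<exists>y\<in>F. bowen_dist f \<omega> n x y \<le> \<epsilon>" for x
  proof -
    obtain y where "y \<in> F" "dist y x < e" using F(2) by (force simp: subset_eq)
    then have "\<forall>i<n. dist (random_iter f \<omega> i x) (random_iter f \<omega> i y) \<le> \<epsilon>"
      using d(2)[of x y] e(2) by (smt (verit) dist_commute)
    then show ?thesis using \<open>y \<in> F\<close> bowen_dist_le_iff[OF \<open>n > 0\<close>] by blast
  qed
  then show ?thesis using F(1) by (intro exI[of _ F]) simp
qed

lemma spanning_number_witness: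
  fixes f :: "'k \<Rightarrow> 'a::metric_space \<Rightarrow> 'a"
  assumes "compact (UNIV :: 'a set)" and "\<forall>i. continuous_on UNIV (f i)" and "n > 0" "\<epsilon> > 0"
  obtains F where "finite F" "card F = spanning_number f \<omega> n \<epsilon>"
    "\<And>x. \<exists>y\<in>F. bowen_dist f \<omega> n x y \<le> \<epsilon>"
proof -
  let ?P = "\<lambda>m. \<exists>F. finite F \<and> card F = m \<and> (\<forall>x. \<exists>y\<in>F. bowen_dist f \<omega> n x y \<le> \<epsilon>)"
  obtain F where "finite F \<and> (\<forall>x. \<exists>y\<in>F. bowen_dist f \<omega> n x y \<le> \<epsilon>)"
    using exists_finite_spanning[OF assms] ..
  then have "?P (card F)" by (intro exI[of _ F]) simp
  then have "?P (spanning_number f \<omega> n \<epsilon>)"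
    unfolding spanning_number_def by (rule LeastI)
  then show ?thesis using that by (elim exE conjE) simp
qed

lemma spanning_number_pos:
  fixes f :: "'k \<Rightarrow> 'a::metric_space \<Rightarrow> 'a"
  assumes "compact (UNIV :: 'a set)" and "\<forall>i. continuous_on UNIV (f i)" and "n > 0" "\<epsilon> > 0"
  shows "spanning_number f \<omega> n \<epsilon> \<ge> 1"
proof -
  obtain F where "finite F" "card F = spanning_number f \<omega> n \<epsilon>"
    "\<And>x. \<exists>y\<in>F. bowen_dist f \<omega> n x y \<le> \<epsilon>"
    using spanning_number_witness[where \<omega>=\<omega>, OF assms] by blast
  moreover from this have "F \<noteq> {}" by auto
  ultimately show ?thesis by (metis One_nat_def Suc_leI card_gt_0_iff)
qed

lemma spanning_number_antimono:
  fixes f :: "'k \<Rightarrow> 'a::metric_space \<Rightarrow> 'a"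
  assumes "compact (UNIV :: 'a set)" and "\<forall>i. continuous_on UNIV (f i)" and "n > 0" "\<epsilon> > 0"
    and "\<epsilon> \<le> \<delta>"
  shows "spanning_number f \<omega> n \<delta> \<le> spanning_number f \<omega> n \<epsilon>"
proof -
  obtain F where "finite F" "card F = spanning_number f \<omega> n \<epsilon>"
    "\<And>x. \<exists>y\<in>F. bowen_dist f \<omega> n x y \<le> \<epsilon>"
    using spanning_number_witness[where \<omega>=\<omega>, OF assms(1-4)] by blast
  moreover from this have "\<exists>y\<in>F. bowen_dist f \<omega> n x y \<le> \<delta>" for x
    using \<open>\<epsilon> \<le> \<delta>\<close> by (meson order_trans)
  ultimately show ?thesis using spanning_number_le[of F f \<omega> n \<delta>] by simp
qed

text \<open>Two points of \<open>E\<close> served by the same centre would stay within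
  \<open>2 * \<epsilon>\<close> of each other up to time \<open>n\<close>; so assigning centres is
  injective on \<open>E\<close>.\<close>

lemma spanning_number_ge_separated:
  fixes f :: "'k \<Rightarrow> 'a::metric_space \<Rightarrow> 'a"
  assumes "compact (UNIV :: 'a set)" and "\<forall>i. continuous_on UNIV (f i)" and "n > 0" "\<epsilon> > 0"
    and "finite E"
    and sep: "\<And>x y. x \<in> E \<Longrightarrow> y \<in> E \<Longrightarrow> x \<noteq> y \<Longrightarrow>
      \<exists>i<n. dist (random_iter f \<omega> i x) (random_iter f \<omega> i y) > 2 * \<epsilon>"
  shows "card E \<le> spanning_number f \<omega> n \<epsilon>"
proof -
  obtain F where F: "finite F" "card F = spanning_number f \<omega> n \<epsilon>"
    "\<And>x. \<exists>y\<in>F. bowen_dist f \<omega> n x y \<le> \<epsilon>"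
    using spanning_number_witness[where \<omega>=\<omega>, OF assms(1-4)] by blast
  then obtain c where c: "\<And>x. c x \<in> F" "\<And>x. bowen_dist f \<omega> n x (c x) \<le> \<epsilon>" by metis
  have "inj_on c E"
  proof (rule inj_onI, rule ccontr)
    fix x y assume xy: "x \<in> E" "y \<in> E" "c x = c y" "x \<noteq> y"
    then obtain i where i: "i < n" "dist (random_iter f \<omega> i x) (random_iter f \<omega> i y) > 2 * \<epsilon>"
      using sep by blast
    have "dist (random_iter f \<omega> i x) (random_iter f \<omega> i (c x)) \<le> \<epsilon>"
      "dist (random_iter f \<omega> i y) (random_iter f \<omega> i (c x)) \<le> \<epsilon>"
      using c(2)[of x] c(2)[of y] i(1) xy(3) unfolding bowen_dist_le_iff[OF \<open>n > 0\<close>] by simp_all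
    then show False using i(2) dist_triangle2[of "random_iter f \<omega> i x" "random_iter f \<omega> i y"
      "random_iter f \<omega> i (c x)"] by linarith
  qed
  then show ?thesis using F(1,2) c(1) by (metis card_inj_on_le image_subsetI)
qed

section \<open>Integration over the path space\<close>

lemma prob_space_path_measure: "prob_space (path_measure \<nu>)"
  unfolding path_measure_def by (intro prob_space_PiM prob_space_measure_pmf)

lemma space_path_measure: "space (path_measure \<nu>) = UNIV"
  unfolding path_measure_def by (simp add: space_PiM)

lemma coordinate_measurable: "(\<lambda>\<omega>. \<omega> j) \<in> measurable (path_measure \<nu>) (measure_pmf \<nu>)"
  unfolding path_measure_def by (rule measurable_component_singleton) simp

lemma integral_coordinate:
  fixes a :: "'k::finite \<Rightarrow> real"
  shows "(\<integral>\<omega>. a (\<omega> j) \<partial>path_measure \<nu>) = (\<Sum>i\<in>UNIV. pmf \<nu> i * a i)"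
    and "integrable (path_measure \<nu>) (\<lambda>\<omega>. a (\<omega> j))"
proof -
  have d: "distr (path_measure \<nu>) (measure_pmf \<nu>) (\<lambda>\<omega>. \<omega> j) = measure_pmf \<nu>"
    unfolding path_measure_def
    by (rule distr_PiM_component[of UNIV "\<lambda>_. measure_pmf \<nu>" j]) (auto intro: prob_space_measure_pmf)
  have "(\<integral>\<omega>. a (\<omega> j) \<partial>path_measure \<nu>) = (\<integral>i. a i \<partial>distr (path_measure \<nu>) (measure_pmf \<nu>) (\<lambda>\<omega>. \<omega> j))"
    by (rule integral_distr[symmetric, OF coordinate_measurable]) simp
  also have "\<dots> = (\<Sum>i\<in>UNIV. pmf \<nu> i * a i)"
    unfolding d by (subst integral_measure_pmf[of UNIV]) auto
  finally show "(\<integral>\<omega>. a (\<omega> j) \<partial>path_measure \<nu>) = (\<Sum>i\<in>UNIV. pmf \<nu> i * a i)" .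
  have "integrable (distr (path_measure \<nu>) (measure_pmf \<nu>) (\<lambda>\<omega>. \<omega> j)) a"
    unfolding d by (rule integrable_measure_pmf_finite) simp
  then show "integrable (path_measure \<nu>) (\<lambda>\<omega>. a (\<omega> j))"
    by (subst (asm) integrable_distr_eq[OF coordinate_measurable]) auto
qed

lemma AE_path_in_support: "AE \<omega> in path_measure \<nu>. \<forall>j. \<omega> j \<in> set_pmf \<nu>"
  unfolding AE_all_countable path_measure_def
  by (intro allI AE_PiM_component)
    (auto intro: prob_space_measure_pmf simp: AE_measure_pmf_iff)

text \<open>There are finitely many labels, hence finitely many words of length \<open>n\<close>,
  and \<open>h\<close> is a finite linear combination of indicators of cylinder sets. No
  measurability of spanning numbers has to be proved separately.\<close>

lemma integrable_finitely_many_coordinates: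
  fixes h :: "(nat \<Rightarrow> 'k::finite) \<Rightarrow> real"
  assumes h: "\<And>\<omega> \<omega>'. (\<And>j. j < n \<Longrightarrow> \<omega> j = \<omega>' j) \<Longrightarrow> h \<omega> = h \<omega>'"
  shows "integrable (path_measure \<nu>) h"
proof -
  let ?L = "{l :: 'k list. length l = n}"
  let ?c = "\<lambda>l. {\<omega>. \<forall>j<n. \<omega> j = l ! j}"
  have fin: "finite ?L" using finite_lists_length_eq[of "UNIV :: 'k set" n] by simp
  have m: "?c l \<in> sets (path_measure \<nu>)" for l :: "'k list"
  proof -
    have "{\<omega> \<in> space (path_measure \<nu>). \<omega> j = l ! j} \<in> sets (path_measure \<nu>)" for j
      using measurable_sets[OF coordinate_measurable[of j \<nu>], of "{l ! j}"]
      by (simp add: vimage_def Int_def conj_commute)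
    then have "{\<omega> \<in> space (path_measure \<nu>). \<forall>j\<in>{..<n}. \<omega> j = l ! j} \<in> sets (path_measure \<nu>)"
      by (intro sets.sets_Collect_finite_All) auto
    then show ?thesis by (simp add: space_path_measure Ball_def)
  qed
  have "h = (\<lambda>\<omega>. \<Sum>l\<in>?L. indicator (?c l) \<omega> * h (\<lambda>j. l ! j))"
  proof
    fix \<omega>
    have 1: "indicator (?c l) \<omega> = (if l = map \<omega> [0..<n] then 1 else 0 :: real)" if "l \<in> ?L" for l
      using that by (auto simp: indicator_def list_eq_iff_nth_eq)
    have "(\<Sum>l\<in>?L. indicator (?c l) \<omega> * h (\<lambda>j. l ! j)) =
      (\<Sum>l\<in>?L. if l = map \<omega> [0..<n] then h (\<lambda>j. l ! j) else 0)"
      by (intro sum.cong refl) (simp add: 1)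
    also have "\<dots> = h (\<lambda>j. map \<omega> [0..<n] ! j)" using fin by (simp add: sum.delta)
    also have "\<dots> = h \<omega>" by (rule h) simp
    finally show "h \<omega> = (\<Sum>l\<in>?L. indicator (?c l) \<omega> * h (\<lambda>j. l ! j))" ..
  qed
  moreover interpret prob_space "path_measure \<nu>" by (rule prob_space_path_measure)
  have "integrable (path_measure \<nu>) (\<lambda>\<omega>. \<Sum>l\<in>?L. indicator (?c l) \<omega> * h (\<lambda>j. l ! j))"
    using m by (intro Bochner_Integration.integrable_sum integrable_mult_left
      integrable_real_indicator) (auto simp: emeasure_eq_measure)
  ultimately show ?thesis by simp
qed

section \<open>Entropy as a supremum, and bounds for it\<close>

definition entropy_at_scale ::
    "'k pmf \<Rightarrow> ('k \<Rightarrow> 'a::metric_space \<Rightarrow> 'a) \<Rightarrow> real \<Rightarrow> ereal" where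
  "entropy_at_scale \<nu> f \<epsilon> = limsup (\<lambda>n.
       ereal (1 / real n * (\<integral>\<omega>. ln (real (spanning_number f \<omega> n \<epsilon>)) \<partial>path_measure \<nu>)))"

lemma integrable_ln_spanning_number:
  fixes f :: "'k::finite \<Rightarrow> 'a::metric_space \<Rightarrow> 'a"
  shows "integrable (path_measure \<nu>) (\<lambda>\<omega>. ln (real (spanning_number f \<omega> n \<epsilon>)))"
  by (rule integrable_finitely_many_coordinates[of n]) (metis spanning_number_cong)

lemma entropy_at_scale_antimono:
  fixes f :: "'k::finite \<Rightarrow> 'a::metric_space \<Rightarrow> 'a"
  assumes "compact (UNIV :: 'a set)" and "\<forall>i. continuous_on UNIV (f i)" and "\<epsilon> > 0" "\<epsilon> \<le> \<delta>"
  shows "entropy_at_scale \<nu> f \<delta> \<le> entropy_at_scale \<nu> f \<epsilon>"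
  unfolding entropy_at_scale_def
proof (rule Limsup_mono, rule eventually_sequentiallyI[of 1])
  fix n :: nat assume n: "1 \<le> n"
  have "ln (real (spanning_number f \<omega> n \<delta>)) \<le> ln (real (spanning_number f \<omega> n \<epsilon>))" for \<omega>
    using spanning_number_antimono[of f n \<epsilon> \<delta> \<omega>] spanning_number_pos[of f n \<delta> \<omega>] assms n
    by (subst ln_le_cancel_iff) auto
  then show "ereal (1 / real n * (\<integral>\<omega>. ln (real (spanning_number f \<omega> n \<delta>)) \<partial>path_measure \<nu>))
    \<le> ereal (1 / real n * (\<integral>\<omega>. ln (real (spanning_number f \<omega> n \<epsilon>)) \<partial>path_measure \<nu>))"
    unfolding ereal_less_eq
    by (intro mult_left_mono integral_mono integrable_ln_spanning_number) auto
qed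

text \<open>\<open>Lim\<close> is a definite description and has a usable value only once
  convergence is known. As the scale decreases the entropy at that scale increases, so its supremum
  is the limit.\<close>

lemma tendsto_entropy_at_scale:
  fixes f :: "'k::finite \<Rightarrow> 'a::metric_space \<Rightarrow> 'a"
  assumes "compact (UNIV :: 'a set)" and "\<forall>i. continuous_on UNIV (f i)"
  shows "(entropy_at_scale \<nu> f \<longlongrightarrow> random_entropy \<nu> f) (at_right 0)"
proof -
  let ?F = "entropy_at_scale \<nu> f"
  have *: "(?F \<longlongrightarrow> (SUP \<epsilon>\<in>{0<..}. ?F \<epsilon>)) (at_right 0)"
  proof (rule order_tendstoI)
    fix a assume "a < (SUP \<epsilon>\<in>{0<..}. ?F \<epsilon>)"
    then obtain \<epsilon> where e: "\<epsilon> > 0" "a < ?F \<epsilon>" by (auto simp: less_SUP_iff)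
    have "eventually (\<lambda>x. x \<in> {0<..<\<epsilon>}) (at_right 0)"
      using eventually_at_right_real e(1) by blast
    then show "eventually (\<lambda>x. a < ?F x) (at_right 0)"
    proof eventually_elim
      case (elim x)
      then show ?case
        using entropy_at_scale_antimono[OF assms, of x \<epsilon> \<nu>] e(2) by auto
    qed
  next
    fix a assume a: "(SUP \<epsilon>\<in>{0<..}. ?F \<epsilon>) < a"
    show "eventually (\<lambda>x. ?F x < a) (at_right 0)"
      unfolding eventually_at_filter
      by (rule always_eventually) (metis SUP_upper a greaterThan_iff order_le_less_trans)
  qed
  have "random_entropy \<nu> f = Lim (at_right 0) ?F"
    unfolding random_entropy_def entropy_at_scale_def ..
  also have "\<dots> = (SUP \<epsilon>\<in>{0<..}. ?F \<epsilon>)" by (rule tendsto_Lim[OF _ *]) simp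
  finally show ?thesis using * by simp
qed

text \<open>A bound holding only along paths in the support of \<open>\<nu>\<close> suffices. This matters when the ball
  dimension is infinite and the weighted sum vanishes: labels of weight zero may then carry
  Lipschitz constants larger than \<open>1\<close>.\<close>

lemma random_entropy_le:
  fixes f :: "'k::finite \<Rightarrow> 'a::metric_space \<Rightarrow> 'a"
  assumes "compact (UNIV :: 'a set)" and "\<forall>i. continuous_on UNIV (f i)"
    and bound: "\<And>\<epsilon>. 0 < \<epsilon> \<Longrightarrow> \<epsilon> < \<epsilon>0 \<Longrightarrow> \<exists>C. (\<lambda>n. C n / real n) \<longlonglongrightarrow> 0 \<and>
      (\<forall>n>0. \<forall>\<omega>. (\<forall>j. \<omega> j \<in> set_pmf \<nu>) \<longrightarrow>
        ln (real (spanning_number f \<omega> n \<epsilon>)) \<le> C n + (\<Sum>j<n. a (\<omega> j)))"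
    and "\<epsilon>0 > 0"
  shows "random_entropy \<nu> f \<le> ereal (\<Sum>i\<in>UNIV. pmf \<nu> i * a i)"
proof (rule tendsto_upperbound[OF tendsto_entropy_at_scale[OF assms(1,2)]])
  let ?S = "\<Sum>i\<in>UNIV. pmf \<nu> i * a i"
  have *: "entropy_at_scale \<nu> f \<epsilon> \<le> ereal ?S" if eps: "0 < \<epsilon>" "\<epsilon> < \<epsilon>0" for \<epsilon>
  proof -
    obtain C where C: "(\<lambda>n. C n / real n) \<longlonglongrightarrow> 0"
      "\<And>n \<omega>. n > 0 \<Longrightarrow> (\<forall>j. \<omega> j \<in> set_pmf \<nu>) \<Longrightarrow>
        ln (real (spanning_number f \<omega> n \<epsilon>)) \<le> C n + (\<Sum>j<n. a (\<omega> j))"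
      using bound[OF eps] by blast
    interpret prob_space "path_measure \<nu>" by (rule prob_space_path_measure)
    have le: "1 / real n * (\<integral>\<omega>. ln (real (spanning_number f \<omega> n \<epsilon>)) \<partial>path_measure \<nu>)
      \<le> C n / real n + ?S" if "n > 0" for n
    proof -
      have "(\<integral>\<omega>. ln (real (spanning_number f \<omega> n \<epsilon>)) \<partial>path_measure \<nu>)
        \<le> (\<integral>\<omega>. C n + (\<Sum>j<n. a (\<omega> j)) \<partial>path_measure \<nu>)"
      proof (rule integral_mono_AE)
        show "AE \<omega> in path_measure \<nu>. ln (real (spanning_number f \<omega> n \<epsilon>)) \<le> C n + (\<Sum>j<n. a (\<omega> j))"
          using AE_path_in_support[of \<nu>] by eventually_elim (use C(2) that in blast)
      qed (auto intro!: integrable_ln_spanning_number integral_coordinate Bochner_Integration.integrable_add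
          Bochner_Integration.integrable_sum)
      also have "\<dots> = C n + real n * ?S"
        by (subst Bochner_Integration.integral_add)
          (auto simp: integral_coordinate prob_space intro!: integral_coordinate Bochner_Integration.integrable_sum)
      finally show ?thesis using that by (simp add: field_simps)
    qed
    have "entropy_at_scale \<nu> f \<epsilon> \<le> limsup (\<lambda>n. ereal (C n / real n + ?S))"
      unfolding entropy_at_scale_def
      by (rule Limsup_mono, rule eventually_sequentiallyI[of 1]) (use le in auto)
    also have "(\<lambda>n. ereal (C n / real n + ?S)) \<longlonglongrightarrow> ereal (0 + ?S)"
      by (intro tendsto_intros C(1))
    then have "limsup (\<lambda>n. ereal (C n / real n + ?S)) = ereal ?S"
      using lim_imp_Limsup[of sequentially "\<lambda>n. ereal (C n / real n + ?S)"] by simp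
    finally show ?thesis .
  qed
  show "\<forall>\<^sub>F \<epsilon> in at_right 0. entropy_at_scale \<nu> f \<epsilon> \<le> ereal ?S"
    using eventually_at_right_real[OF \<open>\<epsilon>0 > 0\<close>] by eventually_elim (use * in auto)
qed simp

lemma random_entropy_ge:
  fixes f :: "'k::finite \<Rightarrow> 'a::metric_space \<Rightarrow> 'a"
  assumes "compact (UNIV :: 'a set)" and "\<forall>i. continuous_on UNIV (f i)"
    and bound: "\<And>\<epsilon> n \<omega>. 0 < \<epsilon> \<Longrightarrow> \<epsilon> < \<epsilon>0 \<Longrightarrow> n > 0 \<Longrightarrow>
        (\<Sum>j<n. a (\<omega> j)) \<le> ln (real (spanning_number f \<omega> n \<epsilon>))"
    and "\<epsilon>0 > 0"
  shows "ereal (\<Sum>i\<in>UNIV. pmf \<nu> i * a i) \<le> random_entropy \<nu> f"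
proof (rule tendsto_lowerbound[OF tendsto_entropy_at_scale[OF assms(1,2)]])
  let ?S = "\<Sum>i\<in>UNIV. pmf \<nu> i * a i"
  have *: "ereal ?S \<le> entropy_at_scale \<nu> f \<epsilon>" if eps: "0 < \<epsilon>" "\<epsilon> < \<epsilon>0" for \<epsilon>
  proof -
    have le: "?S \<le> 1 / real n * (\<integral>\<omega>. ln (real (spanning_number f \<omega> n \<epsilon>)) \<partial>path_measure \<nu>)"
      if "n > 0" for n
    proof -
      have "real n * ?S = (\<integral>\<omega>. (\<Sum>j<n. a (\<omega> j)) \<partial>path_measure \<nu>)"
        by (subst Bochner_Integration.integral_sum) (auto simp: integral_coordinate)
      also have "\<dots> \<le> (\<integral>\<omega>. ln (real (spanning_number f \<omega> n \<epsilon>)) \<partial>path_measure \<nu>)"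
        by (rule integral_mono)
          (use bound[OF eps that] in \<open>auto intro!: integrable_ln_spanning_number integral_coordinate
          Bochner_Integration.integrable_sum\<close>)
      finally show ?thesis using that by (simp add: field_simps)
    qed
    have "ereal ?S = limsup (\<lambda>n. ereal ?S)" by (simp add: Limsup_const)
    also have "\<dots> \<le> entropy_at_scale \<nu> f \<epsilon>"
      unfolding entropy_at_scale_def
      by (rule Limsup_mono, rule eventually_sequentiallyI[of 1]) (use le in auto)
    finally show ?thesis .
  qed
  show "\<forall>\<^sub>F \<epsilon> in at_right 0. ereal ?S \<le> entropy_at_scale \<nu> f \<epsilon>"
    using eventually_at_right_real[OF \<open>\<epsilon>0 > 0\<close>] by eventually_elim (use * in auto)
qed simp

section \<open>Lipschitz generators\<close>

lemma ball_cover_number_witness: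
  assumes "compact (UNIV :: 'a::metric_space set)" "\<epsilon> > 0"
  obtains F :: "'a::metric_space set" where "finite F" "card F = ball_cover_number (UNIV :: 'a set) \<epsilon>"
    "UNIV \<subseteq> (\<Union>x\<in>F. ball x \<epsilon>)"
proof -
  let ?P = "\<lambda>m. \<exists>F \<subseteq> (UNIV :: 'a set). finite F \<and> card F = m \<and> UNIV \<subseteq> (\<Union>x\<in>F. ball x \<epsilon>)"
  obtain F :: "'a set" where "finite F" "UNIV \<subseteq> (\<Union>x\<in>F. ball x \<epsilon>)"
    using assms unfolding compact_eq_totally_bounded by blast
  then have "?P (card F)" by (intro exI[of _ F]) simp
  then have "?P (ball_cover_number (UNIV :: 'a set) \<epsilon>)"
    unfolding ball_cover_number_def by (rule LeastI)
  then show ?thesis using that by (elim exE conjE) simp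
qed

lemma ball_cover_number_pos:
  assumes "compact (UNIV :: 'a::metric_space set)" "\<epsilon> > 0"
  shows "ball_cover_number (UNIV :: 'a set) \<epsilon> \<ge> 1"
proof -
  obtain F :: "'a set" where "finite F" "card F = ball_cover_number (UNIV :: 'a set) \<epsilon>"
    "UNIV \<subseteq> (\<Union>x\<in>F. ball x \<epsilon>)"
    using ball_cover_number_witness[OF assms] by blast
  moreover from this have "F \<noteq> {}" by auto
  ultimately show ?thesis by (metis One_nat_def Suc_leI card_gt_0_iff)
qed

text \<open>Excludes negative infinity, so that a ball dimension other than
  \<open>\<infinity>\<close> is a nonnegative real.\<close>

lemma ball_dimension_nonneg:
  assumes "compact (UNIV :: 'a::metric_space set)"
  shows "ball_dimension (UNIV :: 'a set) \<ge> 0"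
proof -
  have "(0::ereal) = Limsup (at_right (0::real)) (\<lambda>_. 0)" by (simp add: Limsup_const)
  also have "\<dots> \<le> ball_dimension (UNIV :: 'a set)"
    unfolding ball_dimension_def
  proof (rule Limsup_mono)
    show "\<forall>\<^sub>F \<epsilon>::real in at_right 0. 0 \<le> ereal (ln (real (ball_cover_number (UNIV :: 'a set) \<epsilon>)) / \<bar>ln \<epsilon>\<bar>)"
      using eventually_at_right_real[OF zero_less_one]
    proof eventually_elim
      case (elim \<epsilon>)
      then have "0 \<le> ln (real (ball_cover_number (UNIV :: 'a set) \<epsilon>)) / \<bar>ln \<epsilon>\<bar>"
        using ball_cover_number_pos[OF assms, of \<epsilon>] by (intro divide_nonneg_nonneg) auto
      then show ?case by simp
    qed
  qed
  finally show ?thesis .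
qed

text \<open>The product of the constants is written as the exponential of the sum that is integrated
  later. Truncation at \<open>1\<close> makes this sum nondecreasing in \<open>n\<close>, so the
  factor at time \<open>n\<close> also controls all earlier times.\<close>

lemma dist_random_iter_lipschitz:
  fixes f :: "'k \<Rightarrow> 'a::metric_space \<Rightarrow> 'a"
  assumes L: "\<And>i. (L i)-lipschitz_on UNIV (f i)"
  shows "dist (random_iter f \<omega> n x) (random_iter f \<omega> n y)
    \<le> exp (\<Sum>j<n. ln (max 1 (L (\<omega> j)))) * dist x y"
proof (induction n)
  case (Suc n)
  have "dist (random_iter f \<omega> (Suc n) x) (random_iter f \<omega> (Suc n) y)
    \<le> L (\<omega> n) * dist (random_iter f \<omega> n x) (random_iter f \<omega> n y)"
    using lipschitz_onD[OF L[of "\<omega> n"]] by simp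
  also have "\<dots> \<le> max 1 (L (\<omega> n)) * dist (random_iter f \<omega> n x) (random_iter f \<omega> n y)"
    by (intro mult_right_mono) auto
  also have "\<dots> \<le> max 1 (L (\<omega> n)) * (exp (\<Sum>j<n. ln (max 1 (L (\<omega> j)))) * dist x y)"
    by (intro mult_left_mono Suc) auto
  also have "\<dots> = exp (\<Sum>j<Suc n. ln (max 1 (L (\<omega> j)))) * dist x y"
    by (simp add: exp_add)
  finally show ?case .
qed simp

lemma spanning_number_le_ball_cover_number:
  fixes f :: "'k \<Rightarrow> 'a::metric_space \<Rightarrow> 'a"
  assumes "compact (UNIV :: 'a set)" and L: "\<And>i. (L i)-lipschitz_on UNIV (f i)"
    and "n > 0" "\<epsilon> > 0"
  shows "spanning_number f \<omega> n \<epsilon>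
    \<le> ball_cover_number (UNIV :: 'a set) (\<epsilon> * exp (- (\<Sum>j<n. ln (max 1 (L (\<omega> j))))))"
proof -
  define s where "s m = (\<Sum>j<m. ln (max 1 (L (\<omega> j))))" for m
  have s_mono: "s i \<le> s n" if "i < n" for i
    unfolding s_def by (rule sum_mono2) (use that in auto)
  obtain F :: "'a set" where F: "finite F"
    "card F = ball_cover_number (UNIV :: 'a set) (\<epsilon> * exp (- s n))"
    "UNIV \<subseteq> (\<Union>x\<in>F. ball x (\<epsilon> * exp (- s n)))"
    using ball_cover_number_witness[OF assms(1), of "\<epsilon> * exp (- s n)"] \<open>\<epsilon> > 0\<close> by auto
  have "\<exists>y\<in>F. bowen_dist f \<omega> n x y \<le> \<epsilon>" for x
  proof -
    obtain y where y: "y \<in> F" "dist y x < \<epsilon> * exp (- s n)"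
      using F(3) by (force simp: subset_eq)
    have "dist (random_iter f \<omega> i x) (random_iter f \<omega> i y) \<le> \<epsilon>" if "i < n" for i
    proof -
      have "dist (random_iter f \<omega> i x) (random_iter f \<omega> i y) \<le> exp (s i) * dist x y"
        using dist_random_iter_lipschitz[of L f \<omega> i x y] L unfolding s_def by blast
      also have "\<dots> \<le> exp (s n) * (\<epsilon> * exp (- s n))"
        using y(2) s_mono[OF that] by (intro mult_mono) (auto simp: dist_commute)
      also have "\<dots> = \<epsilon>" by (simp add: exp_minus)
      finally show ?thesis .
    qed
    then show ?thesis using y(1) bowen_dist_le_iff[OF \<open>n > 0\<close>, of f \<omega> x y \<epsilon>] by blast
  qed
  then show ?thesis using spanning_number_le[OF F(1), of f \<omega> n \<epsilon>] F(2) unfolding s_def by simp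
qed

text \<open>For a finite dimension \<open>d\<close>, the estimate is made for every real
  \<open>D > d\<close> and then \<open>D\<close> tends to \<open>d\<close>. For an infinite
  dimension only a vanishing weighted sum needs an argument, the product then being
  \<open>0\<close>.\<close>

proposition random_entropy_lipschitz_le:
  fixes f :: "'k::finite \<Rightarrow> 'a::metric_space \<Rightarrow> 'a"
  assumes compact: "compact (UNIV :: 'a set)" and L: "\<And>i. (L i)-lipschitz_on UNIV (f i)"
  shows "random_entropy \<nu> f
    \<le> ball_dimension (UNIV :: 'a set) * ereal (\<Sum>i\<in>UNIV. pmf \<nu> i * ln (max 1 (L i)))"
proof -
  define a where "a i = ln (max 1 (L i))" for i
  define S where "S = (\<Sum>i\<in>UNIV. pmf \<nu> i * a i)"
  define b where "b = ball_cover_number (UNIV :: 'a set)"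
  have a: "a i \<ge> 0" for i by (simp add: a_def)
  have S: "S \<ge> 0" unfolding S_def by (intro sum_nonneg mult_nonneg_nonneg a) auto
  have cont: "\<forall>i. continuous_on UNIV (f i)"
    using L lipschitz_on_continuous_on by blast
  have ln_le: "ln (real (spanning_number f \<omega> n \<epsilon>)) \<le> ln (real (b (\<epsilon> * exp (- (\<Sum>j<n. a (\<omega> j))))))"
    if "n > 0" "\<epsilon> > 0" for n \<omega> \<epsilon>
  proof -
    have "1 \<le> spanning_number f \<omega> n \<epsilon>" using spanning_number_pos[OF compact cont that] .
    moreover have "spanning_number f \<omega> n \<epsilon> \<le> b (\<epsilon> * exp (- (\<Sum>j<n. a (\<omega> j))))"
      unfolding a_def b_def by (rule spanning_number_le_ball_cover_number[OF compact L that])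
    ultimately show ?thesis by (subst ln_le_cancel_iff) linarith+
  qed
  show ?thesis
  proof (cases "ball_dimension (UNIV :: 'a set) = \<infinity>")
    case True
    show ?thesis
    proof (cases "S = 0")
      case S0: True
      \<comment> \<open>A vanishing sum of nonnegative terms: every label in the support has
        \<open>a i = 0\<close>. Along paths in the support the radius of the cover therefore never
        shrinks, and the covering number at the fixed radius \<open>\<epsilon>\<close>
        suffices.\<close>
      have zero: "pmf \<nu> i * a i = 0" for i
        using sum_nonneg_0[of UNIV "\<lambda>i. pmf \<nu> i * a i" i] S0 a unfolding S_def by simp
      have "random_entropy \<nu> f \<le> ereal (\<Sum>i\<in>UNIV. pmf \<nu> i * 0)"
      proof (rule random_entropy_le[OF compact cont _ zero_less_one])
        fix \<epsilon> :: real assume \<epsilon>: "0 < \<epsilon>"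
        have "ln (real (spanning_number f \<omega> n \<epsilon>)) \<le> ln (real (b \<epsilon>)) + (\<Sum>j<n. 0)"
          if "n > 0" "\<forall>j. \<omega> j \<in> set_pmf \<nu>" for n \<omega>
        proof -
          have "a (\<omega> j) = 0" for j using zero[of "\<omega> j"] that(2) by (auto simp: set_pmf_iff)
          then show ?thesis using ln_le[OF that(1) \<epsilon>, of \<omega>] by simp
        qed
        moreover have "(\<lambda>n. ln (real (b \<epsilon>)) / real n) \<longlonglongrightarrow> 0" by (rule lim_const_over_n)
        ultimately show "\<exists>C. (\<lambda>n. C n / real n) \<longlonglongrightarrow> 0 \<and>
            (\<forall>n>0. \<forall>\<omega>. (\<forall>j. \<omega> j \<in> set_pmf \<nu>) \<longrightarrow>
              ln (real (spanning_number f \<omega> n \<epsilon>)) \<le> C n + (\<Sum>j<n. 0))"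
          by (intro exI[of _ "\<lambda>_. ln (real (b \<epsilon>))"]) blast
      qed
      then show ?thesis using True S0 by (simp add: S_def a_def zero_ereal_def)
    next
      case False
      then show ?thesis using True S by (simp add: S_def a_def)
    qed
  next
    case False
    then obtain d where d: "ball_dimension (UNIV :: 'a set) = ereal d" "d \<ge> 0"
      using ball_dimension_nonneg[OF compact] by (cases "ball_dimension (UNIV :: 'a set)") auto
    have *: "random_entropy \<nu> f \<le> ereal (D * S)" if D: "D > d" for D
    proof -
      have "\<forall>\<^sub>F \<delta>::real in at_right 0. ereal (ln (real (b \<delta>)) / \<bar>ln \<delta>\<bar>) < ereal D"
        unfolding b_def by (rule Limsup_lessD) (use d D in \<open>simp add: ball_dimension_def[symmetric]\<close>)
      then obtain \<delta>0 where \<delta>0: "\<delta>0 > 0"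
        "\<And>\<delta>. 0 < \<delta> \<Longrightarrow> \<delta> < \<delta>0 \<Longrightarrow> ln (real (b \<delta>)) / \<bar>ln \<delta>\<bar> < D"
        unfolding eventually_at_right_field by auto
      have "random_entropy \<nu> f \<le> ereal (\<Sum>i\<in>UNIV. pmf \<nu> i * (D * a i))"
      proof (rule random_entropy_le[OF compact cont])
        \<comment> \<open>Below \<open>\<delta>0\<close> the bound by \<open>D\<close> applies;
          below \<open>1\<close> the logarithm of the radius is negative, so its absolute value
          splits as \<open>- ln \<epsilon>\<close> plus the sum along the path.\<close>
        show "min \<delta>0 1 > 0" using \<delta>0(1) by simp
        fix \<epsilon> :: real assume \<epsilon>: "0 < \<epsilon>" "\<epsilon> < min \<delta>0 1"
        have "ln (real (spanning_number f \<omega> n \<epsilon>)) \<le> D * (- ln \<epsilon>) + (\<Sum>j<n. D * a (\<omega> j))"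
          if "n > 0" for n \<omega>
        proof -
          define s where "s = (\<Sum>j<n. a (\<omega> j))"
          define \<delta> where "\<delta> = \<epsilon> * exp (- s)"
          have "s \<ge> 0" unfolding s_def by (intro sum_nonneg a)
          then have "\<delta> \<le> \<epsilon>" using \<epsilon> unfolding \<delta>_def by (simp add: mult_le_cancel_left1)
          then have \<delta>: "\<delta> < \<delta>0" "\<delta> < 1" using \<epsilon> by linarith+
          have "\<delta> > 0" using \<epsilon> by (simp add: \<delta>_def)
          have ln\<delta>: "ln \<delta> = ln \<epsilon> - s" using \<epsilon> by (simp add: \<delta>_def ln_mult)
          have "ln \<delta> < 0" using \<delta> \<open>\<delta> > 0\<close> by simp
          then have "\<bar>ln \<delta>\<bar> > 0" by simp
          then have "ln (real (b \<delta>)) \<le> D * \<bar>ln \<delta>\<bar>"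
            using \<delta>0(2)[OF \<open>\<delta> > 0\<close> \<delta>(1)] by (simp only: pos_divide_less_eq less_imp_le)
          also have "\<dots> = D * (- ln \<epsilon>) + D * s" using \<open>ln \<delta> < 0\<close> unfolding ln\<delta> by (simp add: algebra_simps)
          finally show ?thesis
            using ln_le[OF that \<epsilon>(1), of \<omega>] unfolding \<delta>_def s_def sum_distrib_left by linarith
        qed
        moreover have "(\<lambda>n. D * (- ln \<epsilon>) / real n) \<longlonglongrightarrow> 0" by (rule lim_const_over_n)
        ultimately show "\<exists>C. (\<lambda>n. C n / real n) \<longlonglongrightarrow> 0 \<and>
            (\<forall>n>0. \<forall>\<omega>. (\<forall>j. \<omega> j \<in> set_pmf \<nu>) \<longrightarrow>
              ln (real (spanning_number f \<omega> n \<epsilon>)) \<le> C n + (\<Sum>j<n. D * a (\<omega> j)))"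
          by (intro exI[of _ "\<lambda>_. D * (- ln \<epsilon>)"]) blast
      qed
      also have "(\<Sum>i\<in>UNIV. pmf \<nu> i * (D * a i)) = D * S"
        unfolding S_def sum_distrib_left by (intro sum.cong) auto
      finally show ?thesis .
    qed
    \<comment> \<open>The limsup gives the covering estimate for each \<open>D > d\<close> but not
      for \<open>d\<close> itself, so the limit is taken in the final bound.\<close>
    have "random_entropy \<nu> f \<le> ereal (d * S)"
    proof (rule tendsto_lowerbound)
      show "((\<lambda>D. ereal (D * S)) \<longlongrightarrow> ereal (d * S)) (at_right d)"
        by (intro tendsto_intros)
      show "\<forall>\<^sub>F D in at_right d. random_entropy \<nu> f \<le> ereal (D * S)"
        using eventually_at_right_less[of d] by eventually_elim (rule *)
    qed simp
    then show ?thesis by (simp add: d(1) S_def a_def)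
  qed
qed

section \<open>Constant-to-one maps with nonexpanding local inverse branches\<close>

lemma card_random_iter_vimage:
  assumes "\<And>i y. finite (f i -` {y})" "\<And>i y. card (f i -` {y}) = N i"
  shows "finite (random_iter f \<omega> n -` {y}) \<and> card (random_iter f \<omega> n -` {y}) = (\<Prod>j<n. N (\<omega> j))"
proof (induction n arbitrary: y)
  case 0
  have "random_iter f \<omega> 0 -` {y} = {y}" by auto
  then show ?case by (metis card.empty card_insert_disjoint empty_iff finite.emptyI finite_insert
    lessThan_0 One_nat_def prod.empty)
next
  case (Suc n)
  have eq: "random_iter f \<omega> (Suc n) -` {y} = (\<Union>z\<in>f (\<omega> n) -` {y}. random_iter f \<omega> n -` {z})"
    by auto
  have "card (random_iter f \<omega> (Suc n) -` {y}) = (\<Sum>z\<in>f (\<omega> n) -` {y}. card (random_iter f \<omega> n -` {z}))"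
    unfolding eq by (rule card_UN_disjoint) (use Suc assms in auto)
  also have "\<dots> = (\<Prod>j<Suc n. N (\<omega> j))" by (simp add: Suc assms)
  finally show ?case unfolding eq using Suc assms by auto
qed

text \<open>The last map is inverted first. Its branch does not increase distances, so the new
  target \<open>z\<close> is again within \<open>\<delta>\<close> of the previous iterate and the
  same \<open>\<delta>\<close> works at every step; the distances along the way are bounded by the
  final one.\<close>

lemma random_iter_pull_back:
  fixes f :: "'k \<Rightarrow> 'a::metric_space \<Rightarrow> 'a"
  assumes "\<And>i x q. dist (f i x) q < \<delta> \<Longrightarrow> \<exists>y. f i y = q \<and> dist x y \<le> dist (f i x) q"
    and "dist (random_iter f \<omega> n x) q < \<delta>"
  shows "\<exists>y. random_iter f \<omega> n y = q \<and>
    (\<forall>i\<le>n. dist (random_iter f \<omega> i x) (random_iter f \<omega> i y) \<le> dist (random_iter f \<omega> n x) q)"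
  using assms(2)
proof (induction n arbitrary: q)
  case (Suc n)
  obtain z where z: "f (\<omega> n) z = q"
    "dist (random_iter f \<omega> n x) z \<le> dist (random_iter f \<omega> (Suc n) x) q"
    using assms(1)[of "\<omega> n" "random_iter f \<omega> n x" q] Suc.prems by auto
  then obtain y where y: "random_iter f \<omega> n y = z"
    "\<forall>i\<le>n. dist (random_iter f \<omega> i x) (random_iter f \<omega> i y) \<le> dist (random_iter f \<omega> n x) z"
    using Suc.IH[of z] Suc.prems by auto
  show ?case
  proof (intro exI[of _ y] conjI allI impI)
    show q: "random_iter f \<omega> (Suc n) y = q" using y(1) z(1) by simp
    fix i assume "i \<le> Suc n"
    then consider "i \<le> n" | "i = Suc n" by linarith
    then show "dist (random_iter f \<omega> i x) (random_iter f \<omega> i y) \<le> dist (random_iter f \<omega> (Suc n) x) q"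
    proof cases
      case 1
      then show ?thesis using y(2) z(2) by (meson order_trans)
    next
      case 2
      then show ?thesis using q by simp
    qed
  qed
qed auto

text \<open>The spanning number lies between the product of the fibre cardinalities and a constant
  multiple of it, the constant depending on the scale but not on \<open>n\<close>; the two bounds
  agree after division by \<open>n\<close>.\<close>

proposition random_entropy_constant_to_one:
  fixes f :: "'k::finite \<Rightarrow> 'a::metric_space \<Rightarrow> 'a"
  assumes compact: "compact (UNIV :: 'a set)" and cont: "\<forall>i. continuous_on UNIV (f i)"
    and N: "\<And>i y. finite (f i -` {y})" "\<And>i y. card (f i -` {y}) = N i" "\<And>i. N i > 0"
    and sep: "\<And>i x y. f i x = f i y \<Longrightarrow> x \<noteq> y \<Longrightarrow> \<rho> \<le> dist x y" and "\<rho> > 0"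
    and pull: "\<And>i x q. dist (f i x) q < \<delta> \<Longrightarrow> \<exists>y. f i y = q \<and> dist x y \<le> dist (f i x) q" and "\<delta> > 0"
  shows "random_entropy \<nu> f = ereal (\<Sum>i\<in>UNIV. pmf \<nu> i * ln (real (N i)))"
proof (rule antisym)
  note cardN = card_random_iter_vimage[of f N, OF N(1,2)]
  have prod_pos: "(\<Prod>j<n. N (\<omega> j)) > 0" for \<omega> :: "nat \<Rightarrow> 'k" and n using N(3) by (simp add: prod_pos)
  have ln_prod: "ln (real (\<Prod>j<n. N (\<omega> j))) = (\<Sum>j<n. ln (real (N (\<omega> j))))"
    for \<omega> :: "nat \<Rightarrow> 'k" and n
    by (induction n) (use prod_pos N(3) in \<open>auto simp: ln_mult simp flip: of_nat_prod\<close>)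
  show "random_entropy \<nu> f \<le> ereal (\<Sum>i\<in>UNIV. pmf \<nu> i * ln (real (N i)))"
  proof (rule random_entropy_le[OF compact cont _ zero_less_one])
    fix \<epsilon> :: real assume \<epsilon>: "0 < \<epsilon>"
    \<comment> \<open>At most \<open>\<delta>\<close>, so that the points of the net can be pulled
      back; at most \<open>\<epsilon>\<close>, so that the pulled-back orbit shadows the given one
      well enough.\<close>
    define e where "e = min \<epsilon> \<delta>"
    have e: "e > 0" using \<epsilon> \<open>\<delta> > 0\<close> by (simp add: e_def)
    obtain F :: "'a set" where F: "finite F" "UNIV \<subseteq> (\<Union>x\<in>F. ball x e)"
      using compact e unfolding compact_eq_totally_bounded by blast
    then have F0: "card F > 0" by (auto simp: card_gt_0_iff)
    have "ln (real (spanning_number f \<omega> n \<epsilon>)) \<le> ln (real (card F)) + (\<Sum>j<n. ln (real (N (\<omega> j))))"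
      if n: "n > 0" for n \<omega>
    proof -
      define Y where "Y = (\<Union>q\<in>F. random_iter f \<omega> n -` {q})"
      have "finite Y" unfolding Y_def using F(1) cardN by auto
      have "card Y \<le> (\<Sum>q\<in>F. card (random_iter f \<omega> n -` {q}))"
        unfolding Y_def by (rule card_UN_le[OF F(1)])
      also have "\<dots> = card F * (\<Prod>j<n. N (\<omega> j))" by (simp add: cardN)
      finally have cardY: "card Y \<le> card F * (\<Prod>j<n. N (\<omega> j))" .
      have "\<exists>y\<in>Y. bowen_dist f \<omega> n x y \<le> \<epsilon>" for x
      proof -
        obtain q where q: "q \<in> F" "dist (random_iter f \<omega> n x) q < e"
          using F(2) by (force simp: subset_eq dist_commute)
        then obtain y where y: "random_iter f \<omega> n y = q"
          "\<forall>i\<le>n. dist (random_iter f \<omega> i x) (random_iter f \<omega> i y) \<le> dist (random_iter f \<omega> n x) q"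
          using random_iter_pull_back[of f \<delta> \<omega> n x q] pull unfolding e_def by auto
        have "y \<in> Y" using y(1) q(1) by (auto simp: Y_def)
        moreover have "\<forall>i<n. dist (random_iter f \<omega> i x) (random_iter f \<omega> i y) \<le> \<epsilon>"
          using y(2) q(2) unfolding e_def by (smt (verit) less_imp_le)
        ultimately show ?thesis using bowen_dist_le_iff[OF n, of f \<omega> x y \<epsilon>] by blast
      qed
      then have "spanning_number f \<omega> n \<epsilon> \<le> card F * (\<Prod>j<n. N (\<omega> j))"
        using spanning_number_le[OF \<open>finite Y\<close>] cardY order_trans by blast
      moreover have "1 \<le> spanning_number f \<omega> n \<epsilon>" using spanning_number_pos[OF compact cont n \<epsilon>] .
      ultimately have "ln (real (spanning_number f \<omega> n \<epsilon>)) \<le> ln (real (card F * (\<Prod>j<n. N (\<omega> j))))"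
        by (subst ln_le_cancel_iff) linarith+
      also have "\<dots> = ln (real (card F)) + ln (real (\<Prod>j<n. N (\<omega> j)))"
        unfolding of_nat_mult by (rule ln_mult_pos) (use F0 prod_pos in \<open>simp_all del: of_nat_prod\<close>)
      finally show ?thesis unfolding ln_prod .
    qed
    moreover have "(\<lambda>n. ln (real (card F)) / real n) \<longlonglongrightarrow> 0" by (rule lim_const_over_n)
    ultimately show "\<exists>C. (\<lambda>n. C n / real n) \<longlonglongrightarrow> 0 \<and>
        (\<forall>n>0. \<forall>\<omega>. (\<forall>j. \<omega> j \<in> set_pmf \<nu>) \<longrightarrow>
          ln (real (spanning_number f \<omega> n \<epsilon>)) \<le> C n + (\<Sum>j<n. ln (real (N (\<omega> j)))))"
      by (intro exI[of _ "\<lambda>_. ln (real (card F))"]) blast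
  qed
  show "ereal (\<Sum>i\<in>UNIV. pmf \<nu> i * ln (real (N i))) \<le> random_entropy \<nu> f"
  proof (rule random_entropy_ge[OF compact cont])
    show "\<rho> / 2 > 0" using \<open>\<rho> > 0\<close> by simp
    fix \<epsilon> :: real and n :: nat and \<omega> :: "nat \<Rightarrow> 'k"
    assume \<epsilon>: "0 < \<epsilon>" "\<epsilon> < \<rho> / 2" and n: "n > 0"
    \<comment> \<open>Just before two distinct orbits merge, their points are distinct and lie in
      one fibre of a generator, hence are at least \<open>\<rho>\<close> apart.\<close>
    have sep_iter: "\<exists>i<m. dist (random_iter f \<omega> i x) (random_iter f \<omega> i y) \<ge> \<rho>"
      if "random_iter f \<omega> m x = random_iter f \<omega> m y" "x \<noteq> y" for m x y
      using that(1)
    proof (induction m)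
      case (Suc m)
      show ?case
      proof (cases "random_iter f \<omega> m x = random_iter f \<omega> m y")
        case True
        then show ?thesis using Suc.IH less_SucI by blast
      next
        case False
        then show ?thesis using sep[of "\<omega> m"] Suc.prems by (intro exI[of _ m]) auto
      qed
    qed (use that(2) in auto)

    \<comment> \<open>\<open>undefined\<close> merely names some point of the space; all fibres of
      the iterate have the same cardinality. The condition \<open>\<epsilon> < \<rho> / 2\<close>
      turns separation by \<open>\<rho>\<close> into separation by more than
      \<open>2 * \<epsilon>\<close>.\<close>
    have "card (random_iter f \<omega> n -` {undefined}) \<le> spanning_number f \<omega> n \<epsilon>"
    proof (rule spanning_number_ge_separated[OF compact cont n \<epsilon>(1)])
      fix x y assume "x \<in> random_iter f \<omega> n -` {undefined}" "y \<in> random_iter f \<omega> n -` {undefined}" "x \<noteq> y"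
      then have "\<exists>i<n. dist (random_iter f \<omega> i x) (random_iter f \<omega> i y) \<ge> \<rho>"
        by (intro sep_iter) auto
      then show "\<exists>i<n. 2 * \<epsilon> < dist (random_iter f \<omega> i x) (random_iter f \<omega> i y)"
        using \<epsilon>(2) by (metis field_sum_of_halves less_divide_eq_numeral1(1) mult.commute order_less_le_trans)
    qed (simp add: cardN)
    then have le: "(\<Prod>j<n. N (\<omega> j)) \<le> spanning_number f \<omega> n \<epsilon>" by (simp only: cardN)
    have "ln (real (\<Prod>j<n. N (\<omega> j))) \<le> ln (real (spanning_number f \<omega> n \<epsilon>))"
      using le prod_pos[where n=n and \<omega>=\<omega>] by (subst ln_le_cancel_iff) linarith+
    then show "(\<Sum>j<n. ln (real (N (\<omega> j)))) \<le> ln (real (spanning_number f \<omega> n \<epsilon>))"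
      unfolding ln_prod .
  qed
qed

section \<open>Homeomorphisms of finite graphs\<close>

text \<open>By finiteness the union of the other pieces is closed too; together with
  \<open>K i\<close> it would split \<open>C\<close> into two closed parts unless one of them misses
  \<open>C\<close>.\<close>

lemma connected_subset_of_closed_piece:
  fixes C :: "'a::topological_space set"
  assumes "connected C" "finite I" "\<And>i. i \<in> I \<Longrightarrow> closed (K i)" "C \<subseteq> (\<Union>i\<in>I. K i)"
    and disj: "\<And>i j. i \<in> I \<Longrightarrow> j \<in> I \<Longrightarrow> i \<noteq> j \<Longrightarrow> K i \<inter> K j \<inter> C = {}"
    and "i \<in> I" "x \<in> C" "x \<in> K i"
  shows "C \<subseteq> K i"
proof -
  let ?Q = "\<Union>j\<in>I - {i}. K j"
  have "closed ?Q" using assms(2,3) by auto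
  moreover have "closed (K i)" using assms by auto
  moreover have "C \<subseteq> K i \<union> ?Q" using assms(4) by blast
  moreover have "K i \<inter> ?Q \<inter> C = {}" using disj \<open>i \<in> I\<close> by blast
  ultimately have "K i \<inter> C = {} \<or> ?Q \<inter> C = {}"
    using connected_closedD[OF \<open>connected C\<close>] by blast
  then show ?thesis using \<open>C \<subseteq> K i \<union> ?Q\<close> assms(7,8) by blast
qed

text \<open>Uniform continuity allows each edge to be cut into equal parameter intervals whose
  images have diameter at most \<open>\<epsilon>\<close>. With \<open>E\<close> the vertices and the
  cut points, distinct closed pieces meet only inside \<open>E\<close>, so a connected set avoiding
  \<open>E\<close> lies in one piece.\<close>

lemma finite_graph_small_pieces:
  fixes V :: "'a::metric_space set"
  assumes "finite V" "finite \<Gamma>" and UNIV: "UNIV = V \<union> (\<Union>\<gamma>\<in>\<Gamma>. path_image \<gamma>)"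
    and edge: "\<And>\<gamma>. \<gamma> \<in> \<Gamma> \<Longrightarrow> simple_path \<gamma> \<and> pathstart \<gamma> \<in> V \<and> pathfinish \<gamma> \<in> V"
    and inter: "\<And>\<gamma> \<delta>. \<gamma> \<in> \<Gamma> \<Longrightarrow> \<delta> \<in> \<Gamma> \<Longrightarrow> \<gamma> \<noteq> \<delta> \<Longrightarrow> path_image \<gamma> \<inter> path_image \<delta> \<subseteq> V"
    and "\<epsilon> > 0"
  shows "\<exists>E. finite E \<and> V \<subseteq> E \<and>
    (\<forall>C x y. connected C \<longrightarrow> C \<inter> E = {} \<longrightarrow> x \<in> C \<longrightarrow> y \<in> C \<longrightarrow> dist x y \<le> \<epsilon>)"
proof -
  have "\<exists>N>0. \<forall>s\<in>{0..1}. \<forall>t\<in>{0..1}. \<bar>s - t\<bar> \<le> 1 / real N \<longrightarrow> dist (\<gamma> s) (\<gamma> t) \<le> \<epsilon>"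
    if "\<gamma> \<in> \<Gamma>" for \<gamma>
  proof -
    have "continuous_on {0..1} \<gamma>" using edge[OF that] by (simp add: simple_path_def path_def)
    then have "uniformly_continuous_on {0..1} \<gamma>" by (rule compact_uniformly_continuous) simp
    then obtain d where d: "d > 0"
      "\<And>s t. s \<in> {0..1} \<Longrightarrow> t \<in> {0..1} \<Longrightarrow> dist t s < d \<Longrightarrow> dist (\<gamma> t) (\<gamma> s) < \<epsilon>"
      using \<open>\<epsilon> > 0\<close> unfolding uniformly_continuous_on_def by metis
    obtain N where N: "N > 0" "1 / real N < d" using nat_approx_posE[OF d(1)]
      by (metis inverse_eq_divide of_nat_Suc zero_less_Suc)
    show ?thesis
    proof (intro exI[of _ N] conjI ballI impI N(1))
      fix s t :: real assume "s \<in> {0..1}" "t \<in> {0..1}" "\<bar>s - t\<bar> \<le> 1 / real N"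
      then show "dist (\<gamma> s) (\<gamma> t) \<le> \<epsilon>" using d(2)[of t s] N(2) by (simp add: dist_real_def)
    qed
  qed
  then obtain N where N: "\<And>\<gamma>. \<gamma> \<in> \<Gamma> \<Longrightarrow> N \<gamma> > 0"
    "\<And>\<gamma> s t. \<gamma> \<in> \<Gamma> \<Longrightarrow> s \<in> {0..1} \<Longrightarrow> t \<in> {0..1} \<Longrightarrow> \<bar>s - t\<bar> \<le> 1 / real (N \<gamma>) \<Longrightarrow> dist (\<gamma> s) (\<gamma> t) \<le> \<epsilon>"
    by metis
  define J where "J = (\<lambda>(\<gamma>, k). {real k / real (N \<gamma>)..real (Suc k) / real (N \<gamma>)})"
  define K where "K = (\<lambda>(\<gamma>, k). \<gamma> ` J (\<gamma>, k))"
  define I where "I = (SIGMA \<gamma>:\<Gamma>. {..<N \<gamma>})"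
  define E where "E = V \<union> (\<Union>\<gamma>\<in>\<Gamma>. (\<lambda>k. \<gamma> (real k / real (N \<gamma>))) ` {..N \<gamma>})"
  have J: "J (\<gamma>, k) \<subseteq> {0..1}" if "\<gamma> \<in> \<Gamma>" "k < N \<gamma>" for \<gamma> k
    using N(1)[OF that(1)] that(2) unfolding J_def by (auto simp: field_simps intro: order_trans)
  have finI: "finite I" unfolding I_def using \<open>finite \<Gamma>\<close> by auto
  have closedK: "closed (K i)" if i: "i \<in> I" for i
  proof -
    obtain \<gamma> k where ik: "i = (\<gamma>, k)" "\<gamma> \<in> \<Gamma>" "k < N \<gamma>" using i by (auto simp: I_def)
    have "continuous_on {0..1} \<gamma>" using edge[OF ik(2)] by (simp add: simple_path_def path_def)
    then have "continuous_on (J (\<gamma>, k)) \<gamma>" by (rule continuous_on_subset) (rule J[OF ik(2,3)])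
    moreover have "compact (J (\<gamma>, k))" by (simp add: J_def)
    ultimately show ?thesis unfolding ik(1) K_def by (simp add: compact_continuous_image compact_imp_closed)
  qed
  have cover: "UNIV \<subseteq> V \<union> (\<Union>i\<in>I. K i)"
  proof
    fix x :: 'a
    consider "x \<in> V" | \<gamma> t where "\<gamma> \<in> \<Gamma>" "t \<in> {0..1}" "x = \<gamma> t"
      using UNIV unfolding path_image_def by blast
    then show "x \<in> V \<union> (\<Union>i\<in>I. K i)"
    proof cases
      case (2 \<gamma> t)
      show ?thesis
      \<comment> \<open>For \<open>t = 1\<close> the index below would be \<open>N \<gamma>\<close>,
        one too many; but this point is a vertex.\<close>
      proof (cases "t = 1")
        case True
        then show ?thesis using edge[OF 2(1)] 2(3) by (auto simp: pathfinish_def)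
      next
        case False
        define k where "k = nat \<lfloor>t * real (N \<gamma>)\<rfloor>"
        have n: "real (N \<gamma>) > 0" using N(1)[OF 2(1)] by simp
        have k: "real k \<le> t * real (N \<gamma>)" "t * real (N \<gamma>) < real k + 1"
          using 2(2) n unfolding k_def by auto
        have "t * real (N \<gamma>) < real (N \<gamma>)" using False 2(2) n by simp
        then have "k < N \<gamma>" using k(1) by linarith
        moreover have "t \<in> J (\<gamma>, k)" unfolding J_def using k n by (auto simp: field_simps)
        ultimately have "(\<gamma>, k) \<in> I" "x \<in> K (\<gamma>, k)" using 2 unfolding I_def K_def by auto
        then show ?thesis by blast
      qed
    qed simp
  qed
  have same_edge: "K (\<gamma>, k) \<inter> K (\<gamma>, l) \<subseteq> E" if "\<gamma> \<in> \<Gamma>" "k < l" "l < N \<gamma>" for \<gamma> k l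
  proof
    fix x assume "x \<in> K (\<gamma>, k) \<inter> K (\<gamma>, l)"
    then obtain s t where st: "s \<in> J (\<gamma>, k)" "t \<in> J (\<gamma>, l)" "x = \<gamma> s" "x = \<gamma> t"
      unfolding K_def by auto
    have 01: "s \<in> {0..1}" "t \<in> {0..1}" using st J[of \<gamma> k] J[of \<gamma> l] that by auto
    \<comment> \<open>Equal images force equal parameters, except at the two ends of a loop, which
      are vertices. Equal parameters in two different intervals can only be the common end, a cut
      point.\<close>
    have "loop_free \<gamma>" using edge[OF that(1)] by (simp add: simple_path_def)
    then consider "s = t" | "s = 0" "t = 1" | "s = 1" "t = 0"
      using 01 st(3,4) unfolding loop_free_def by metis
    then show "x \<in> E"
    proof cases
      case 1
      have n: "real (N \<gamma>) > 0" using N(1)[OF that(1)] by simp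
      have "real (Suc k) / real (N \<gamma>) \<le> real l / real (N \<gamma>)" using that(2) n by (intro divide_right_mono) auto
      then have "t = real l / real (N \<gamma>)" using st(1,2) 1 unfolding J_def by simp
      then have "x = \<gamma> (real l / real (N \<gamma>))" using st(4) by simp
      moreover have "l \<in> {..N \<gamma>}" using that by simp
      ultimately show ?thesis using that(1) unfolding E_def by blast
    qed (use edge[OF that(1)] st in \<open>auto simp: E_def pathstart_def pathfinish_def\<close>)
  qed
  have disj: "K i \<inter> K j \<subseteq> E" if i: "i \<in> I" and j: "j \<in> I" and "i \<noteq> j" for i j
  proof -
    obtain \<gamma> k where ik: "i = (\<gamma>, k)" "\<gamma> \<in> \<Gamma>" "k < N \<gamma>" using i by (auto simp: I_def)
    obtain \<delta> l where jl: "j = (\<delta>, l)" "\<delta> \<in> \<Gamma>" "l < N \<delta>" using j by (auto simp: I_def)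
    show ?thesis
    proof (cases "\<gamma> = \<delta>")
      case True
      then consider "k < l" | "l < k" using \<open>i \<noteq> j\<close> ik(1) jl(1) by fastforce
      then show ?thesis using same_edge ik jl True by cases blast+
    next
      case False
      have "K i \<subseteq> path_image \<gamma>" "K j \<subseteq> path_image \<delta>"
        using J[OF ik(2,3)] J[OF jl(2,3)] unfolding ik(1) jl(1) K_def path_image_def by auto
      then show ?thesis using inter[OF ik(2) jl(2) False] unfolding E_def by blast
    qed
  qed
  show ?thesis
  proof (intro exI[of _ E] conjI allI impI)
    show "finite E" unfolding E_def using assms(1,2) by auto
    show "V \<subseteq> E" unfolding E_def by auto
    fix C x y assume C: "connected C" "C \<inter> E = {}" "x \<in> C" "y \<in> C"
    have "C \<subseteq> (\<Union>i\<in>I. K i)" using cover C(2) unfolding E_def by blast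
    then obtain i where i: "i \<in> I" "x \<in> K i" using C(3) by blast
    have "C \<subseteq> K i"
      by (rule connected_subset_of_closed_piece[of C I K, OF C(1) finI closedK _ _ i(1) C(3) i(2)])
        (use \<open>C \<subseteq> (\<Union>i\<in>I. K i)\<close> disj C(2) in blast)+
    moreover obtain \<gamma> k where ik: "i = (\<gamma>, k)" "\<gamma> \<in> \<Gamma>" "k < N \<gamma>" using i(1) by (auto simp: I_def)
    ultimately obtain s t where st: "s \<in> J (\<gamma>, k)" "t \<in> J (\<gamma>, k)" "x = \<gamma> s" "y = \<gamma> t"
      using C(3,4) i(2) unfolding K_def by auto
    have "\<bar>s - t\<bar> \<le> real (Suc k) / real (N \<gamma>) - real k / real (N \<gamma>)"
      using st(1,2) unfolding J_def by auto
    also have "\<dots> = 1 / real (N \<gamma>)" by (simp add: diff_divide_distrib[symmetric])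
    finally show "dist x y \<le> \<epsilon>" unfolding st(3,4) using J[OF ik(2,3)] st(1,2) by (intro N(2)[OF ik(2)]) auto
  qed
qed

text \<open>Two points off \<open>Z\<close> on the same edge, with equally many points of \<open>Z\<close> before them, are joined by an
  arc that avoids \<open>Z\<close>. So the complement of \<open>Z\<close> falls into at most \<open>card \<Gamma> * (card Z + 1)\<close> classes of
  mutually connected points.\<close>

lemma finite_graph_complement_representatives:
  fixes V :: "'a::metric_space set"
  assumes "finite \<Gamma>" and UNIV: "UNIV = V \<union> (\<Union>\<gamma>\<in>\<Gamma>. path_image \<gamma>)"
    and edge: "\<And>\<gamma>. \<gamma> \<in> \<Gamma> \<Longrightarrow> simple_path \<gamma> \<and> pathstart \<gamma> \<in> V \<and> pathfinish \<gamma> \<in> V"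
    and "finite Z" "V \<subseteq> Z"
  shows "\<exists>R. finite R \<and> card R \<le> card \<Gamma> * (card Z + 1) \<and>
    (\<forall>x. x \<notin> Z \<longrightarrow> (\<exists>y\<in>R. \<exists>C. connected C \<and> C \<inter> Z = {} \<and> x \<in> C \<and> y \<in> C))"
proof -
  have "\<exists>p. x \<notin> Z \<longrightarrow> fst p \<in> \<Gamma> \<and> snd p \<in> {0<..<1} \<and> x = fst p (snd p)" for x
  proof (cases "x \<in> Z")
    case False
    have "x \<in> V \<union> (\<Union>\<gamma>\<in>\<Gamma>. path_image \<gamma>)" unfolding UNIV[symmetric] by simp
    moreover have "x \<notin> V" using False \<open>V \<subseteq> Z\<close> by blast
    ultimately obtain \<gamma> t where \<gamma>: "\<gamma> \<in> \<Gamma>" "t \<in> {0..1}" "x = \<gamma> t"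
      unfolding path_image_def by blast
    have "\<gamma> 0 \<in> V" "\<gamma> 1 \<in> V" using edge[OF \<gamma>(1)] by (simp_all add: pathstart_def pathfinish_def)
    then have "t \<noteq> 0" "t \<noteq> 1" using \<gamma>(3) \<open>x \<notin> V\<close> by metis+
    then show ?thesis using \<gamma> by (intro exI[of _ "(\<gamma>, t)"]) auto
  qed simp
  then have "\<forall>x. \<exists>p. x \<notin> Z \<longrightarrow> fst p \<in> \<Gamma> \<and> snd p \<in> {0<..<1} \<and> x = fst p (snd p)" ..
  from choice[OF this] obtain p
    where p: "\<forall>x. x \<notin> Z \<longrightarrow> fst (p x) \<in> \<Gamma> \<and> snd (p x) \<in> {0<..<1} \<and> x = fst (p x) (snd (p x))" ..
  define e where "e x = fst (p x)" for x
  define t where "t x = snd (p x)" for x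
  have et: "\<And>x. x \<notin> Z \<Longrightarrow> e x \<in> \<Gamma>" "\<And>x. x \<notin> Z \<Longrightarrow> t x \<in> {0<..<1}"
    "\<And>x. x \<notin> Z \<Longrightarrow> e x (t x) = x" using p by (simp_all add: e_def t_def)
  define T where "T \<gamma> = {s \<in> {0<..<1::real}. \<gamma> s \<in> Z}" for \<gamma>
  \<comment> \<open>\<open>T\<close> collects the parameters at which an edge meets
    \<open>Z\<close>. The edge and the number of such parameters before \<open>x\<close> determine
    the gap between cuts in which \<open>x\<close> lies.\<close>
  define key where "key x = (e x, card {s \<in> T (e x). s < t x})" for x
  have T: "finite (T \<gamma>) \<and> card (T \<gamma>) \<le> card Z" if "\<gamma> \<in> \<Gamma>" for \<gamma>
  proof -
    have "inj_on \<gamma> (T \<gamma>)"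
    proof (rule inj_onI)
      fix s t assume "s \<in> T \<gamma>" "t \<in> T \<gamma>" "\<gamma> s = \<gamma> t"
      moreover have "loop_free \<gamma>" using edge[OF that] by (simp add: simple_path_def)
      ultimately show "s = t" unfolding T_def loop_free_def by fastforce
    qed
    moreover have "\<gamma> ` T \<gamma> \<subseteq> Z" by (auto simp: T_def)
    ultimately show ?thesis
      using inj_on_finite[of \<gamma> "T \<gamma>" Z] card_inj_on_le[of \<gamma> "T \<gamma>" Z] \<open>finite Z\<close> by blast
  qed
  have key_in: "key x \<in> \<Gamma> \<times> {..card Z}" if "x \<notin> Z" for x
  proof -
    have "card {s \<in> T (e x). s < t x} \<le> card (T (e x))"
      using T[OF et(1)[OF that]] by (intro card_mono) auto
    then show ?thesis using T[OF et(1)[OF that]] et(1)[OF that] unfolding key_def by auto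
  qed
  have arc: "\<exists>C. connected C \<and> C \<inter> Z = {} \<and> x \<in> C \<and> y \<in> C"
    if x: "x \<notin> Z" and y: "y \<notin> Z" and k: "key x = key y" and le: "t x \<le> t y" for x y
  proof (intro exI conjI)
    let ?\<gamma> = "e x"
    have e: "e y = ?\<gamma>" using k by (simp add: key_def)
    \<comment> \<open>These finite sets are nested, so equal cardinality makes them equal: no cut
      lies between the two parameters.\<close>
    have eq: "{s \<in> T ?\<gamma>. s < t x} = {s \<in> T ?\<gamma>. s < t y}"
    proof (rule card_subset_eq)
      show "finite {s \<in> T ?\<gamma>. s < t y}" using T[OF et(1)[OF x]] by auto
      show "{s \<in> T ?\<gamma>. s < t x} \<subseteq> {s \<in> T ?\<gamma>. s < t y}" using le by auto
      show "card {s \<in> T ?\<gamma>. s < t x} = card {s \<in> T ?\<gamma>. s < t y}" using k e by (simp add: key_def)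
    qed
    have "e x (t y) = y" using et(3)[OF y] e by simp
    then have ty: "t y \<notin> T ?\<gamma>" using y by (simp add: T_def)
    have "s \<notin> T ?\<gamma>" if s: "s \<in> {t x..t y}" for s
    proof
      assume "s \<in> T ?\<gamma>"
      moreover from this have "s < t y" using ty s by (cases "s = t y") auto
      ultimately have "s \<in> {s \<in> T ?\<gamma>. s < t x}" unfolding eq by simp
      then show False using s by simp
    qed
    then show "?\<gamma> ` {t x..t y} \<inter> Z = {}"
      using et(2)[OF x] et(2)[OF y] unfolding T_def by fastforce
    have "continuous_on {0..1} ?\<gamma>" using edge[OF et(1)[OF x]] by (simp add: simple_path_def path_def)
    then have "continuous_on {t x..t y} ?\<gamma>"
      by (rule continuous_on_subset) (use et(2)[OF x] et(2)[OF y] in auto)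
    then show "connected (?\<gamma> ` {t x..t y})" by (rule connected_continuous_image) simp
    show "x \<in> ?\<gamma> ` {t x..t y}" using et(3)[OF x] le by (intro image_eqI[of _ _ "t x"]) auto
    show "y \<in> ?\<gamma> ` {t x..t y}" using et(3)[OF y] le e by (intro image_eqI[of _ _ "t y"]) auto
  qed
  \<comment> \<open>For a key that no point has, the choice is arbitrary; this does no harm, as only
    an upper bound on the number of representatives is wanted.\<close>
  define rep where "rep \<kappa> = (SOME y. y \<notin> Z \<and> key y = \<kappa>)" for \<kappa>
  show ?thesis
  proof (intro exI[of _ "rep ` (\<Gamma> \<times> {..card Z})"] conjI allI impI)
    show "finite (rep ` (\<Gamma> \<times> {..card Z}))" using \<open>finite \<Gamma>\<close> by simp
    have "card (rep ` (\<Gamma> \<times> {..card Z})) \<le> card (\<Gamma> \<times> {..card Z})"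
      by (rule card_image_le) (use \<open>finite \<Gamma>\<close> in simp)
    then show "card (rep ` (\<Gamma> \<times> {..card Z})) \<le> card \<Gamma> * (card Z + 1)"
      by (simp add: card_cartesian_product)
    fix x assume x: "x \<notin> Z"
    have r: "rep (key x) \<notin> Z \<and> key (rep (key x)) = key x"
      unfolding rep_def by (rule someI[of _ x]) (simp add: x)
    have "\<exists>C. connected C \<and> C \<inter> Z = {} \<and> x \<in> C \<and> rep (key x) \<in> C"
    proof (cases "t x \<le> t (rep (key x))")
      case True
      then show ?thesis using arc[of x "rep (key x)"] x r by simp
    next
      case False
      then have "\<exists>C. connected C \<and> C \<inter> Z = {} \<and> rep (key x) \<in> C \<and> x \<in> C"
        using arc[of "rep (key x)" x] x r by simp
      then obtain C where "connected C \<and> C \<inter> Z = {} \<and> rep (key x) \<in> C \<and> x \<in> C" ..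
      then show ?thesis by (intro exI[of _ C]) simp
    qed
    then show "\<exists>y\<in>rep ` (\<Gamma> \<times> {..card Z}). \<exists>C. connected C \<and> C \<inter> Z = {} \<and> x \<in> C \<and> y \<in> C"
      by (rule bexI) (rule imageI[OF key_in[OF x]])
  qed
qed

text \<open>Injectivity bounds every preimage of \<open>E\<close> by \<open>card E\<close>, so the
  first \<open>n\<close> iterates produce at most \<open>n * card E\<close> cuts and the spanning
  numbers grow at most linearly. Their logarithm divided by \<open>n\<close> tends to
  \<open>0\<close>.\<close>

proposition random_entropy_finite_graph:
  fixes f :: "'k::finite \<Rightarrow> 'a::metric_space \<Rightarrow> 'a"
  assumes compact: "compact (UNIV :: 'a set)" and graph: "finite_graph (UNIV :: 'a set)"
    and cont: "\<forall>i. continuous_on UNIV (f i)" and inj: "\<And>i. inj (f i)"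
  shows "random_entropy \<nu> f = 0"
proof (rule antisym)
  have "ereal (\<Sum>i\<in>UNIV. pmf \<nu> i * 0) \<le> random_entropy \<nu> f"
  proof (rule random_entropy_ge[OF compact cont _ zero_less_one])
    fix \<epsilon> :: real and n :: nat and \<omega> :: "nat \<Rightarrow> 'k"
    assume "0 < \<epsilon>" "0 < n"
    then have "1 \<le> spanning_number f \<omega> n \<epsilon>" using spanning_number_pos[OF compact cont] by blast
    then show "(\<Sum>j<n. 0) \<le> ln (real (spanning_number f \<omega> n \<epsilon>))" by simp
  qed
  then show "0 \<le> random_entropy \<nu> f" by (simp add: zero_ereal_def)
  obtain V \<Gamma> where V\<Gamma>: "finite V \<and> finite \<Gamma> \<and> (UNIV :: 'a set) = V \<union> (\<Union>\<gamma>\<in>\<Gamma>. path_image \<gamma>) \<and>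
     (\<forall>\<gamma>\<in>\<Gamma>. simple_path \<gamma> \<and> pathstart \<gamma> \<in> V \<and> pathfinish \<gamma> \<in> V \<and> \<gamma> ` {0<..<1} \<inter> V = {}) \<and>
     (\<forall>\<gamma>\<in>\<Gamma>. \<forall>\<delta>\<in>\<Gamma>. \<gamma> \<noteq> \<delta> \<longrightarrow> path_image \<gamma> \<inter> path_image \<delta> \<subseteq> V)"
    using graph unfolding finite_graph_def by (elim exE) (rule that)
  then have "finite V" and fin\<Gamma>: "finite \<Gamma>"
    and UNIV: "(UNIV :: 'a set) = V \<union> (\<Union>\<gamma>\<in>\<Gamma>. path_image \<gamma>)"
    by simp_all
  have edge: "simple_path \<gamma> \<and> pathstart \<gamma> \<in> V \<and> pathfinish \<gamma> \<in> V" if "\<gamma> \<in> \<Gamma>" for \<gamma>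
    using V\<Gamma> that by simp
  have inter: "path_image \<gamma> \<inter> path_image \<delta> \<subseteq> V"
    if "\<gamma> \<in> \<Gamma>" "\<delta> \<in> \<Gamma>" "\<gamma> \<noteq> \<delta>" for \<gamma> \<delta>
    using V\<Gamma> that by simp
  have "random_entropy \<nu> f \<le> ereal (\<Sum>i\<in>UNIV. pmf \<nu> i * 0)"
  proof (rule random_entropy_le[OF compact cont _ zero_less_one])
    fix \<epsilon> :: real assume \<epsilon>: "0 < \<epsilon>"
    obtain E where E': "finite E \<and> V \<subseteq> E \<and>
        (\<forall>C x y. connected C \<longrightarrow> C \<inter> E = {} \<longrightarrow> x \<in> C \<longrightarrow> y \<in> C \<longrightarrow> dist x y \<le> \<epsilon>)"
      using finite_graph_small_pieces[OF \<open>finite V\<close> fin\<Gamma> UNIV edge inter \<epsilon>] ..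
    have E: "finite E" "V \<subseteq> E"
      "\<And>C x y. connected C \<Longrightarrow> C \<inter> E = {} \<Longrightarrow> x \<in> C \<Longrightarrow> y \<in> C \<Longrightarrow> dist x y \<le> \<epsilon>"
      using E' by simp_all
    \<comment> \<open>The first term counts the cuts per unit of time, the second the
      representatives of the gaps; the final \<open>1\<close> makes \<open>M\<close> positive, so
      that \<open>ln\<close> of the product splits.\<close>
    define M where "M = card E + card \<Gamma> * (card E + 1) + 1"
    have spanning_le: "spanning_number f \<omega> n \<epsilon> \<le> M * n" if n: "n > 0" for \<omega> n
    proof -
      define Z where "Z = (\<Union>i<n. random_iter f \<omega> i -` E)"
      have iv: "finite (random_iter f \<omega> i -` E)" "card (random_iter f \<omega> i -` E) \<le> card E" for i
        using finite_vimageI[OF E(1)] card_vimage_inj_on_le[of "random_iter f \<omega> i" UNIV E]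
          inj_random_iter[of f \<omega> i, OF inj] E(1) by auto
      have "finite Z" unfolding Z_def using iv by auto
      have "card Z \<le> (\<Sum>i<n. card (random_iter f \<omega> i -` E))"
        unfolding Z_def by (rule card_UN_le) simp
      also have "\<dots> \<le> (\<Sum>i<n. card E)" by (intro sum_mono iv)
      finally have cardZ: "card Z \<le> n * card E" by simp
      have "E \<subseteq> Z" unfolding Z_def using n by force
      then have "V \<subseteq> Z" using E(2) by simp
      obtain R where R': "finite R \<and> card R \<le> card \<Gamma> * (card Z + 1) \<and>
          (\<forall>x. x \<notin> Z \<longrightarrow> (\<exists>y\<in>R. \<exists>C. connected C \<and> C \<inter> Z = {} \<and> x \<in> C \<and> y \<in> C))"
        using finite_graph_complement_representatives[OF fin\<Gamma> UNIV edge \<open>finite Z\<close> \<open>V \<subseteq> Z\<close>] ..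
      have R: "finite R" "card R \<le> card \<Gamma> * (card Z + 1)"
        "\<And>x. x \<notin> Z \<Longrightarrow> \<exists>y\<in>R. \<exists>C. connected C \<and> C \<inter> Z = {} \<and> x \<in> C \<and> y \<in> C"
        using R' by simp_all
      \<comment> \<open>A point of \<open>Z\<close> serves itself. Any other point is joined to its
        representative by a connected set whose images up to time \<open>n - 1\<close> all avoid
        \<open>E\<close>, hence are small.\<close>
      have "\<exists>y\<in>Z \<union> R. bowen_dist f \<omega> n x y \<le> \<epsilon>" for x
      proof (cases "x \<in> Z")
        case True
        then show ?thesis using bowen_dist_le_iff[OF n, of f \<omega> x x \<epsilon>] \<epsilon> by auto
      next
        case False
        then obtain y C where C: "y \<in> R" "connected C" "C \<inter> Z = {}" "x \<in> C" "y \<in> C"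
          using R(3) by blast
        have "dist (random_iter f \<omega> i x) (random_iter f \<omega> i y) \<le> \<epsilon>" if "i < n" for i
        proof (rule E(3))
          show "connected (random_iter f \<omega> i ` C)"
            by (rule connected_continuous_image[OF continuous_on_subset[OF continuous_on_random_iter[OF cont]]])
              (use C(2) in auto)
          show "random_iter f \<omega> i ` C \<inter> E = {}" using C(3) that unfolding Z_def by blast
        qed (use C in auto)
        then show ?thesis using C(1) bowen_dist_le_iff[OF n, of f \<omega> x y \<epsilon>] by blast
      qed
      then have "spanning_number f \<omega> n \<epsilon> \<le> card (Z \<union> R)"
        by (intro spanning_number_le) (simp_all add: \<open>finite Z\<close> R(1))
      also have "\<dots> \<le> n * card E + card \<Gamma> * (n * card E + n)"
      proof -
        have "card \<Gamma> * (card Z + 1) \<le> card \<Gamma> * (n * card E + n)"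
          using cardZ n by (intro mult_le_mono2) linarith
        then show ?thesis using card_Un_le[of Z R] R(2) cardZ by linarith
      qed
      also have "\<dots> \<le> M * n" by (simp add: M_def algebra_simps)
      finally show ?thesis .
    qed
    have "ln (real (spanning_number f \<omega> n \<epsilon>)) \<le> (ln (real M) + ln (real n)) + (\<Sum>j<n. 0)"
      if n: "n > 0" for \<omega> n
    proof -
      have "1 \<le> spanning_number f \<omega> n \<epsilon>" "spanning_number f \<omega> n \<epsilon> \<le> M * n"
        using spanning_number_pos[OF compact cont n \<epsilon>] spanning_le[OF n] by auto
      then have "ln (real (spanning_number f \<omega> n \<epsilon>)) \<le> ln (real (M * n))"
        by (subst ln_le_cancel_iff) linarith+
      also have "\<dots> = ln (real M) + ln (real n)"
        unfolding of_nat_mult by (rule ln_mult_pos) (use n in \<open>simp_all add: M_def add_pos_nonneg\<close>)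
      finally show ?thesis by simp
    qed
    moreover have "(\<lambda>n. (ln (real M) + ln (real n)) / real n) \<longlonglongrightarrow> 0"
    proof -
      have "(\<lambda>n. ln (real M) / real n + ln (real n) / real n) \<longlonglongrightarrow> 0 + 0"
        by (intro tendsto_add lim_const_over_n lim_ln_over_n)
      then show ?thesis by (simp add: add_divide_distrib)
    qed
    ultimately show "\<exists>C. (\<lambda>n. C n / real n) \<longlonglongrightarrow> 0 \<and>
        (\<forall>n>0. \<forall>\<omega>. (\<forall>j. \<omega> j \<in> set_pmf \<nu>) \<longrightarrow>
          ln (real (spanning_number f \<omega> n \<epsilon>)) \<le> C n + (\<Sum>j<n. 0))"
      by (intro exI[of _ "\<lambda>n. ln (real M) + ln (real n)"]) blast
  qed
  then show "random_entropy \<nu> f \<le> 0" by (simp add: zero_ereal_def)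
qed

section \<open>Curves in a manifold\<close>

lemma linear_axis_expansion:
  fixes T :: "real ^ 'n::finite \<Rightarrow> 'b::real_vector"
  assumes "linear T"
  shows "T v = (\<Sum>j\<in>UNIV. v $ j *\<^sub>R T (axis j 1))"
proof -
  have "T v = T (\<Sum>j\<in>UNIV. v $ j *\<^sub>R axis j 1)"
    using basis_expansion[of v] by (simp add: scalar_mult_eq_scaleR)
  also have "\<dots> = (\<Sum>j\<in>UNIV. v $ j *\<^sub>R T (axis j 1))"
    using assms by (simp add: linear_sum linear_scale)
  finally show ?thesis .
qed

text \<open>In finite dimension, continuity of \<open>T r v\<close> for each fixed \<open>v\<close>
  is enough: \<open>D r\<close> is expanded in the standard basis.\<close>

lemma continuous_on_linear_family:
  fixes T :: "'c::topological_space \<Rightarrow> real ^ 'n::finite \<Rightarrow> 'b::real_normed_vector"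
  assumes "\<And>r. r \<in> U \<Longrightarrow> linear (T r)" "\<And>v. continuous_on U (\<lambda>r. T r v)" "continuous_on U D"
  shows "continuous_on U (\<lambda>r. T r (D r))"
proof -
  have "continuous_on U (\<lambda>r. \<Sum>j\<in>UNIV. D r $ j *\<^sub>R T r (axis j 1))"
    by (intro continuous_intros assms)
  then show ?thesis
    by (rule continuous_on_eq) (use linear_axis_expansion assms(1) in metis)
qed

lemma continuous_on_det_matrix:
  fixes M :: "'c::topological_space \<Rightarrow> real ^ 'n ^ 'n::finite"
  assumes "\<And>i j. continuous_on U (\<lambda>r. M r $ i $ j)"
  shows "continuous_on U (\<lambda>r. det (M r))"
  unfolding det_def by (intro continuous_intros assms)

text \<open>Cramer's rule writes the solution as a quotient of determinants in continuous entries.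
  This gives the continuity of the velocity of a lifted curve.\<close>

lemma continuous_on_linear_solution:
  fixes T :: "'c::topological_space \<Rightarrow> real ^ 'n::finite \<Rightarrow> real ^ 'n"
  assumes lin: "\<And>r. r \<in> U \<Longrightarrow> linear (T r)" and inj: "\<And>r. r \<in> U \<Longrightarrow> inj (T r)"
    and T: "\<And>v. continuous_on U (\<lambda>r. T r v)" and b: "continuous_on U b"
    and sol: "\<And>r. r \<in> U \<Longrightarrow> T r (D r) = b r"
  shows "continuous_on U D"
proof -
  let ?M = "\<lambda>r. matrix (T r)"
  have M: "continuous_on U (\<lambda>r. ?M r $ i $ j)" for i j
    unfolding matrix_def by (simp, intro continuous_intros T)
  have det0: "det (?M r) \<noteq> 0" if "r \<in> U" for r
    using det_nz_iff_inj[OF lin[OF that]] inj[OF that] by simp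
  have eq: "D r = (\<chi> k. det (\<chi> i j. if j = k then b r $ i else ?M r $ i $ j) / det (?M r))"
    if "r \<in> U" for r
    using cramer[OF det0[OF that], of "D r" "b r"] sol[OF that] lin[OF that]
    by (simp add: matrix_works)
  have "continuous_on U (\<lambda>r. \<chi> k. det (\<chi> i j. if j = k then b r $ i else ?M r $ i $ j) / det (?M r))"
  proof (intro continuous_on_vec_lambda continuous_on_divide continuous_on_det_matrix M ballI det0)
    fix k i j
    show "continuous_on U (\<lambda>r. (\<chi> i j. if j = k then b r $ i else ?M r $ i $ j) $ i $ j)"
    proof (cases "j = k")
      case True
      then show ?thesis by simp (intro continuous_intros b)
    next
      case False
      then show ?thesis using M[of i j] by simp
    qed
  qed
  then show ?thesis by (rule continuous_on_eq) (simp add: eq)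
qed

text \<open>Only continuity of \<open>a\<close> is assumed. The derivative of \<open>F\<close> at
  \<open>a t\<close> and its linear inverse \<open>G\<close> first give a linear bound on the
  increment of \<open>a\<close>, and this bound then makes the error of the candidate derivative
  \<open>G w\<close> small.\<close>

lemma has_vector_derivative_lift:
  fixes F :: "real ^ 'n::finite \<Rightarrow> real ^ 'n"
  assumes F: "(F has_derivative D) (at (a t))" and "inj D" and a: "isCont a t"
    and Fa: "((F \<circ> a) has_vector_derivative w) (at t)"
  shows "\<exists>v. (a has_vector_derivative v) (at t) \<and> D v = w"
proof -
  have lin: "linear D" using F by (rule has_derivative_linear)
  then obtain G where G: "linear G" "\<And>v. G (D v) = v" "\<And>v. D (G v) = v"
    using linear_injective_isomorphism[OF lin \<open>inj D\<close>] by blast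
  obtain K where K: "K > 0" "\<And>x. norm (G x) \<le> K * norm x"
    using linear_bounded_pos[OF G(1)] by (metis)
  have "(a has_derivative (\<lambda>h. h *\<^sub>R G w)) (at t)"
    unfolding has_derivative_at_alt
  proof (intro conjI allI impI)
    show "bounded_linear (\<lambda>h. h *\<^sub>R G w)" by (rule bounded_linear_scaleR_left)
    fix e :: real assume e: "e > 0"
    \<comment> \<open>\<open>2 * K * (norm w + 1)\<close> will be the Lipschitz-type bound for
      \<open>a\<close> near \<open>t\<close>. Below, \<open>\<eta>\<close> is chosen with
      \<open>K * \<eta> \<le> 1 / 2\<close>, to absorb \<open>u\<close>, and with
      \<open>K * \<eta> * M \<le> e\<close>, to get the final error.\<close>
    define M where "M = 2 * K * (norm w + 1) + 1"
    have M: "M > 0" using K(1) unfolding M_def by (intro add_nonneg_pos mult_nonneg_nonneg) auto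
    define \<eta> where "\<eta> = min (min 1 (1 / (2 * K))) (e / (K * M))"
    have \<eta>: "\<eta> > 0" "\<eta> \<le> 1" "K * \<eta> \<le> 1 / 2" "K * \<eta> * M \<le> e"
    proof -
      show "\<eta> > 0" "\<eta> \<le> 1" using e M K(1) by (auto simp: \<eta>_def)
      have "K * \<eta> \<le> K * (1 / (2 * K))" using K(1) unfolding \<eta>_def by (intro mult_left_mono) auto
      then show "K * \<eta> \<le> 1 / 2" using K(1) by simp
      have "K * \<eta> * M \<le> K * (e / (K * M)) * M"
        using K(1) M unfolding \<eta>_def by (intro mult_left_mono mult_right_mono) auto
      then show "K * \<eta> * M \<le> e" using K(1) M by simp
    qed
    obtain d1 where d1: "d1 > 0"
      "\<And>y. norm (y - a t) < d1 \<Longrightarrow> norm (F y - F (a t) - D (y - a t)) \<le> \<eta> * norm (y - a t)"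
      using F \<eta>(1) unfolding has_derivative_at_alt by metis
    obtain d2 where d2: "d2 > 0" "\<And>s. dist s t < d2 \<Longrightarrow> dist (a s) (a t) < d1"
      using a d1(1) unfolding continuous_at_eps_delta by metis
    have "((F \<circ> a) has_derivative (\<lambda>h. h *\<^sub>R w)) (at t)"
      using Fa unfolding has_vector_derivative_def .
    then obtain d3 where d3: "d3 > 0"
      "\<And>s. norm (s - t) < d3 \<Longrightarrow> norm ((F \<circ> a) s - (F \<circ> a) t - (s - t) *\<^sub>R w) \<le> \<eta> * norm (s - t)"
      using \<eta>(1) unfolding has_derivative_at_alt by metis
    show "\<exists>d>0. \<forall>s. norm (s - t) < d \<longrightarrow> norm (a s - a t - (s - t) *\<^sub>R G w) \<le> e * norm (s - t)"
    proof (intro exI[of _ "min d2 d3"] conjI allI impI)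
      show "min d2 d3 > 0" using d2(1) d3(1) by simp
      fix s assume s: "norm (s - t) < min d2 d3"
      define u where "u = norm (a s - a t)"
      define R where "R = F (a s) - F (a t) - D (a s - a t)"
      define Q where "Q = F (a s) - F (a t) - (s - t) *\<^sub>R w"
      have R: "norm R \<le> \<eta> * u"
        unfolding R_def u_def using d2(2)[of s] s by (intro d1(2)) (simp add: dist_norm)
      have Q: "norm Q \<le> \<eta> * norm (s - t)" unfolding Q_def using d3(2)[of s] s by simp
      have "D (a s - a t - (s - t) *\<^sub>R G w) = Q - R"
        unfolding Q_def R_def using lin G(3) by (simp add: linear_diff linear_scale)
      then have eq: "a s - a t - (s - t) *\<^sub>R G w = G (Q - R)" using G(2) by metis
      have 1: "norm (a s - a t - (s - t) *\<^sub>R G w) \<le> K * (\<eta> * norm (s - t) + \<eta> * u)"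
      proof -
        have "norm (G (Q - R)) \<le> K * norm (Q - R)" by (rule K(2))
        also have "\<dots> \<le> K * (\<eta> * norm (s - t) + \<eta> * u)"
          using norm_triangle_ineq4[of Q R] Q R K(1) by (intro mult_left_mono) auto
        finally show ?thesis unfolding eq .
      qed
      have "u \<le> norm ((s - t) *\<^sub>R G w) + norm (a s - a t - (s - t) *\<^sub>R G w)"
        unfolding u_def using norm_triangle_ineq[of "(s - t) *\<^sub>R G w" "a s - a t - (s - t) *\<^sub>R G w"] by simp
      also have "\<dots> \<le> norm (s - t) * (K * norm w) + K * (\<eta> * norm (s - t) + \<eta> * u)"
        using 1 K(2)[of w] by (auto intro!: add_mono mult_left_mono)
      also have "\<dots> = norm (s - t) * (K * norm w) + K * \<eta> * norm (s - t) + K * \<eta> * u"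
        by (simp add: algebra_simps)
      \<comment> \<open>The increment \<open>u\<close> reappears with factor at most one half and
        can be moved to the left.\<close>
      also have "\<dots> \<le> norm (s - t) * (K * norm w) + K * norm (s - t) + 1 / 2 * u"
        using \<eta> K(1) by (intro add_mono mult_right_mono) (auto simp: u_def mult_le_cancel_left1)
      finally have u: "u \<le> 2 * K * (norm w + 1) * norm (s - t)" by (simp add: algebra_simps)
      have "K * (\<eta> * norm (s - t) + \<eta> * u) \<le> K * (\<eta> * norm (s - t) + \<eta> * (2 * K * (norm w + 1) * norm (s - t)))"
        using u \<eta>(1) K(1) by (intro mult_left_mono add_left_mono) auto
      also have "\<dots> = K * \<eta> * M * norm (s - t)" unfolding M_def by (simp add: algebra_simps)
      also have "\<dots> \<le> e * norm (s - t)" using \<eta>(4) by (intro mult_right_mono) auto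
      finally show "norm (a s - a t - (s - t) *\<^sub>R G w) \<le> e * norm (s - t)" using 1 by linarith
    qed
  qed
  then show ?thesis using G(3)[of w] unfolding has_vector_derivative_def by blast
qed

section \<open>Charts, local derivatives and the metric tensor\<close>

locale riemannian_atlas =
  fixes A :: "('a::metric_space, 'n::finite) chart set"
    and g :: "('a, 'n) metric_tensor"
  assumes atlas: "smooth_atlas A" and metric: "riemannian_metric A g"
begin

lemma chart_cover: "\<exists>c\<in>A. x \<in> fst c"
  using atlas unfolding smooth_atlas_def by blast

lemma open_chart: "c \<in> A \<Longrightarrow> open (fst c)"
  using atlas unfolding smooth_atlas_def by fastforce

lemma open_chart_image: "c \<in> A \<Longrightarrow> open (snd c ` fst c)"
  using atlas unfolding smooth_atlas_def by fastforce

lemma chart_homeomorphism: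
  "c \<in> A \<Longrightarrow> homeomorphism (fst c) (snd c ` fst c) (snd c) (inv_into (fst c) (snd c))"
  using atlas unfolding smooth_atlas_def by fastforce

lemma continuous_on_chart: "c \<in> A \<Longrightarrow> continuous_on (fst c) (snd c)"
  using chart_homeomorphism by (rule homeomorphism_cont1)

lemma chart_inverse: "c \<in> A \<Longrightarrow> x \<in> fst c \<Longrightarrow> inv_into (fst c) (snd c) (snd c x) = x"
  using chart_homeomorphism homeomorphism_apply1 by metis

lemma inj_on_chart: "c \<in> A \<Longrightarrow> inj_on (snd c) (fst c)"
  using chart_inverse by (rule inj_on_inverseI)

lemma open_image_chart:
  assumes "c \<in> A" "open W" "W \<subseteq> fst c"
  shows "open (snd c ` W)"
proof -
  have "openin (top_of_set (fst c)) W"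
    using assms open_chart by (simp add: openin_open_eq)
  then have "openin (top_of_set (snd c ` fst c)) (snd c ` W)"
    by (rule homeomorphism_imp_open_map[OF chart_homeomorphism[OF assms(1)]])
  then show ?thesis using open_chart_image[OF assms(1)] by (simp add: openin_open_eq)
qed

lemma local_rep_chart: "c \<in> A \<Longrightarrow> x \<in> fst c \<Longrightarrow> local_rep c c' f (snd c x) = snd c' (f x)"
  unfolding local_rep_def by (simp add: chart_inverse)

text \<open>Transition maps are the local representatives of \<open>id\<close>, so all facts about
  local derivatives of C1 maps apply to changes of chart.\<close>

lemma Cr_map_id: "Cr_map A r id"
  using atlas unfolding smooth_atlas_def Cr_map_def by (simp add: continuous_on_id')

lemma open_chart_domain:
  "Cr_map A r f \<Longrightarrow> c \<in> A \<Longrightarrow> c' \<in> A \<Longrightarrow> open (fst c \<inter> f -` fst c')"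
  unfolding Cr_map_def using open_chart open_vimage by blast

lemma local_rep_has_derivative:
  assumes "Cr_map A 1 f" "c \<in> A" "c' \<in> A" "x \<in> fst c" "f x \<in> fst c'"
  shows "(local_rep c c' f has_derivative local_deriv c c' f x) (at (snd c x))"
proof -
  have "local_rep c c' f differentiable (at (snd c x))"
    using assms unfolding Cr_map_def by auto
  then show ?thesis unfolding local_deriv_def using frechet_derivative_works by blast
qed

lemma linear_local_deriv:
  assumes "Cr_map A 1 f" "c \<in> A" "c' \<in> A" "x \<in> fst c" "f x \<in> fst c'"
  shows "linear (local_deriv c c' f x)"
  using local_rep_has_derivative[OF assms] by (rule has_derivative_linear)

lemma continuous_on_local_deriv:
  assumes "Cr_map A 1 f" "c \<in> A" "c' \<in> A"
  shows "continuous_on (fst c \<inter> f -` fst c') (\<lambda>x. local_deriv c c' f x v)"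
proof -
  have "continuous_on (snd c ` (fst c \<inter> f -` fst c')) (\<lambda>p. frechet_derivative (local_rep c c' f) (at p) v)"
    using assms unfolding Cr_map_def by auto
  moreover have "continuous_on (fst c \<inter> f -` fst c') (snd c)"
    by (rule continuous_on_subset[OF continuous_on_chart[OF assms(2)]]) auto
  ultimately have "continuous_on (fst c \<inter> f -` fst c')
      ((\<lambda>p. frechet_derivative (local_rep c c' f) (at p) v) \<circ> snd c)"
    by (intro continuous_on_compose)
  then show ?thesis by (simp add: local_deriv_def comp_def)
qed

lemma curve_derivative_image:
  assumes f: "Cr_map A 1 f" "c \<in> A" "c' \<in> A" "\<gamma> t \<in> fst c" "f (\<gamma> t) \<in> fst c'"
    and "isCont \<gamma> t" and "((snd c \<circ> \<gamma>) has_vector_derivative v) (at t)"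
  shows "((snd c' \<circ> (f \<circ> \<gamma>)) has_vector_derivative local_deriv c c' f (\<gamma> t) v) (at t)"
proof -
  have lin: "linear (local_deriv c c' f (\<gamma> t))" by (rule linear_local_deriv[OF f])
  have "((local_rep c c' f \<circ> (snd c \<circ> \<gamma>)) has_derivative
      (local_deriv c c' f (\<gamma> t) \<circ> (\<lambda>h. h *\<^sub>R v))) (at t)"
    using assms(7) local_rep_has_derivative[OF f] unfolding has_vector_derivative_def
    by (intro diff_chain_at) auto
  moreover have "local_deriv c c' f (\<gamma> t) \<circ> (\<lambda>h. h *\<^sub>R v) = (\<lambda>h. h *\<^sub>R local_deriv c c' f (\<gamma> t) v)"
    using lin by (auto simp: linear_scale)
  moreover have "eventually (\<lambda>s. \<gamma> s \<in> fst c) (at t)"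
    using \<open>isCont \<gamma> t\<close> f(2,4) open_chart unfolding isCont_def by (blast intro: topological_tendstoD)
  then have "eventually (\<lambda>s. (local_rep c c' f \<circ> (snd c \<circ> \<gamma>)) s = (snd c' \<circ> (f \<circ> \<gamma>)) s) (at t)"
    by eventually_elim (simp add: local_rep_chart[OF f(2)])
  ultimately show ?thesis unfolding has_vector_derivative_def
    using has_derivative_transform_eventually[of "local_rep c c' f \<circ> (snd c \<circ> \<gamma>)" _ t UNIV "snd c' \<circ> (f \<circ> \<gamma>)"]
      local_rep_chart[OF f(2,4)] by simp
qed

text \<open>Gives the velocity of a lifted curve from that of the curve below, without prior
  knowledge that the lift is differentiable.\<close>

lemma curve_derivative_lift:
  assumes f: "Cr_map A 1 f" "c \<in> A" "c' \<in> A" "\<gamma> t \<in> fst c" "f (\<gamma> t) \<in> fst c'"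
    and inj: "inj (local_deriv c c' f (\<gamma> t))"
    and "isCont \<gamma> t" and w: "((snd c' \<circ> (f \<circ> \<gamma>)) has_vector_derivative w) (at t)"
  shows "\<exists>v. ((snd c \<circ> \<gamma>) has_vector_derivative v) (at t) \<and> local_deriv c c' f (\<gamma> t) v = w"
proof (rule has_vector_derivative_lift)
  show "(local_rep c c' f has_derivative local_deriv c c' f (\<gamma> t)) (at ((snd c \<circ> \<gamma>) t))"
    using local_rep_has_derivative[OF f] by simp
  have "isCont (snd c) (\<gamma> t)"
    using continuous_on_chart[OF f(2)] open_chart[OF f(2)] f(4) by (simp add: continuous_on_eq_continuous_at)
  then show "isCont (snd c \<circ> \<gamma>) t" using \<open>isCont \<gamma> t\<close> by (intro continuous_at_compose) auto
  have "eventually (\<lambda>s. \<gamma> s \<in> fst c) (at t)"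
    using \<open>isCont \<gamma> t\<close> f(2,4) open_chart unfolding isCont_def by (blast intro: topological_tendstoD)
  then have "eventually (\<lambda>s. (snd c' \<circ> (f \<circ> \<gamma>)) s = (local_rep c c' f \<circ> (snd c \<circ> \<gamma>)) s) (at t)"
    by eventually_elim (simp add: local_rep_chart[OF f(2)])
  then show "(local_rep c c' f \<circ> (snd c \<circ> \<gamma>) has_vector_derivative w) (at t)"
    using w has_derivative_transform_eventually[of "snd c' \<circ> (f \<circ> \<gamma>)" _ t UNIV "local_rep c c' f \<circ> (snd c \<circ> \<gamma>)"]
      local_rep_chart[OF f(2,4)] unfolding has_vector_derivative_def by simp
qed (rule inj)

lemma bilinear_metric: "c \<in> A \<Longrightarrow> x \<in> fst c \<Longrightarrow> bilinear (g c x)"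
  using metric unfolding riemannian_metric_def by blast

lemma metric_pos: "c \<in> A \<Longrightarrow> x \<in> fst c \<Longrightarrow> v \<noteq> 0 \<Longrightarrow> g c x v v > 0"
  using metric unfolding riemannian_metric_def by blast

lemma metric_nonneg:
  assumes "c \<in> A" "x \<in> fst c"
  shows "g c x v v \<ge> 0"
proof (cases "v = 0")
  case True
  then show ?thesis using bilinear_lzero[OF bilinear_metric[OF assms]] by simp
next
  case False
  then show ?thesis using metric_pos[OF assms] by (simp add: less_imp_le)
qed

lemma tangent_norm_nonneg: "c \<in> A \<Longrightarrow> x \<in> fst c \<Longrightarrow> tangent_norm g c x v \<ge> 0"
  unfolding tangent_norm_def by (simp add: metric_nonneg)

lemma tangent_norm_pos: "c \<in> A \<Longrightarrow> x \<in> fst c \<Longrightarrow> v \<noteq> 0 \<Longrightarrow> tangent_norm g c x v > 0"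
  unfolding tangent_norm_def by (simp add: metric_pos)

lemma tangent_norm_scaleR:
  assumes "c \<in> A" "x \<in> fst c"
  shows "tangent_norm g c x (a *\<^sub>R v) = \<bar>a\<bar> * tangent_norm g c x v"
  using bilinear_metric[OF assms] unfolding tangent_norm_def
  by (simp add: bilinear_lmul bilinear_rmul real_sqrt_mult)

lemma metric_chart_change:
  "c \<in> A \<Longrightarrow> c' \<in> A \<Longrightarrow> x \<in> fst c \<Longrightarrow> x \<in> fst c' \<Longrightarrow>
    g c x u v = g c' x (local_deriv c c' id x u) (local_deriv c c' id x v)"
  using metric unfolding riemannian_metric_def by blast

lemma tangent_norm_chart_change:
  "c \<in> A \<Longrightarrow> c' \<in> A \<Longrightarrow> x \<in> fst c \<Longrightarrow> x \<in> fst c' \<Longrightarrow>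
    tangent_norm g c' x (local_deriv c c' id x v) = tangent_norm g c x v"
  unfolding tangent_norm_def by (rule arg_cong[where f = sqrt], rule metric_chart_change[symmetric])

lemma continuous_on_tangent_norm:
  assumes c: "c \<in> A" and \<gamma>: "continuous_on U \<gamma>" "\<gamma> ` U \<subseteq> fst c" and D: "continuous_on U D"
  shows "continuous_on U (\<lambda>r. tangent_norm g c (\<gamma> r) (D r))"
proof -
  have g: "continuous_on U (\<lambda>r. g c (\<gamma> r) u v)" for u v
  proof -
    have "Ck_on 0 (\<lambda>p. g c (inv_into (fst c) (snd c) p) u v) (snd c ` fst c)"
      using metric c unfolding riemannian_metric_def by blast
    then have "continuous_on (snd c ` fst c) (\<lambda>p. g c (inv_into (fst c) (snd c) p) u v)" by simp
    then have "continuous_on (fst c) ((\<lambda>p. g c (inv_into (fst c) (snd c) p) u v) \<circ> snd c)"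
      by (rule continuous_on_compose[OF continuous_on_chart[OF c]])
    then have "continuous_on (fst c) (\<lambda>x. g c x u v)"
      by (rule continuous_on_eq) (simp add: chart_inverse[OF c])
    then show ?thesis using \<gamma> by (rule continuous_on_compose2)
  qed
  have "continuous_on U (\<lambda>r. g c (\<gamma> r) (D r) v)" for v
    by (rule continuous_on_linear_family[OF _ g D])
      (use bilinear_metric[OF c] \<gamma>(2) in \<open>auto simp: bilinear_def\<close>)
  then have "continuous_on U (\<lambda>r. g c (\<gamma> r) (D r) (D r))"
    by (rule continuous_on_linear_family[where T = "\<lambda>r. g c (\<gamma> r) (D r)", OF _ _ D, rotated])
      (use bilinear_metric[OF c] \<gamma>(2) in \<open>auto simp: bilinear_def\<close>)
  then show ?thesis unfolding tangent_norm_def by (intro continuous_intros)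
qed

end

section \<open>C1 pieces of curves and comparison of lengths\<close>

text \<open>A local certificate of class C1 with the velocity as explicit data, on an open parameter
  set mapped into one chart. Curves can then be compared near each parameter, away from the break
  points. Staying inside the open unit interval makes two-sided derivatives depend on the path
  alone.\<close>

definition C1_piece ::
    "(real \<Rightarrow> 'a::topological_space) \<Rightarrow> ('a, 'n::finite) chart \<Rightarrow> real set \<Rightarrow> (real \<Rightarrow> real ^ 'n) \<Rightarrow> bool" where
  "C1_piece \<gamma> c U D \<longleftrightarrow> open U \<and> U \<subseteq> {0<..<1} \<and> \<gamma> ` U \<subseteq> fst c \<and>
     (\<forall>r\<in>U. ((snd c \<circ> \<gamma>) has_vector_derivative D r) (at r)) \<and> continuous_on U D"

lemma isCont_path: "path \<gamma> \<Longrightarrow> t \<in> {0<..<1} \<Longrightarrow> isCont \<gamma> t"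
  unfolding path_def using continuous_on_interior[of "{0..1::real}" \<gamma> t] by simp

lemma continuous_on_path_interior: "path \<gamma> \<Longrightarrow> U \<subseteq> {0<..<1} \<Longrightarrow> continuous_on U \<gamma>"
  by (rule continuous_at_imp_continuous_on) (auto intro: isCont_path)

lemma open_path_vimage:
  assumes "path \<gamma>" "open U" "U \<subseteq> {0<..<1}" "open W"
  shows "open {r \<in> U. \<gamma> r \<in> W}"
proof -
  have "open (U \<inter> \<gamma> -` W)"
    by (rule continuous_open_preimage[OF continuous_on_path_interior[OF assms(1,3)] assms(2,4)])
  also have "U \<inter> \<gamma> -` W = {r \<in> U. \<gamma> r \<in> W}" by auto
  finally show ?thesis .
qed

lemma negligible_open_unit_interval_minus_finite:
  assumes "finite (S :: real set)"
  shows "negligible ({0..1} - ({0<..<1} - S))" "negligible (({0<..<1} - S) - {0..1})"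
proof -
  have "{0..1} - ({0<..<1} - S) \<subseteq> insert 0 (insert 1 S)" by auto
  then show "negligible ({0..1} - ({0<..<1} - S))"
    using assms by (meson finite_insert negligible_finite negligible_subset)
  have "({0<..<1} - S) - {0..1::real} = {}" by auto
  then show "negligible (({0<..<1} - S) - {0..1})" by simp
qed

context riemannian_atlas
begin

text \<open>The chain rule transforms the velocity by the derivative of the transition map, and the
  metric is invariant under exactly this transformation, so the speed does not see the
  chart.\<close>

lemma C1_piece_chart_change:
  assumes "path \<gamma>" and c: "c \<in> A" "c' \<in> A" and p: "C1_piece \<gamma> c U D"
  defines "U' \<equiv> {r \<in> U. \<gamma> r \<in> fst c'}"
  shows "C1_piece \<gamma> c' U' (\<lambda>r. local_deriv c c' id (\<gamma> r) (D r))"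
    and "\<And>r. r \<in> U' \<Longrightarrow>
      tangent_norm g c' (\<gamma> r) (local_deriv c c' id (\<gamma> r) (D r)) = tangent_norm g c (\<gamma> r) (D r)"
proof -
  note id1 = Cr_map_id[of 1]
  have U: "open U" "U \<subseteq> {0<..<1}" "\<gamma> ` U \<subseteq> fst c"
    and D: "\<And>r. r \<in> U \<Longrightarrow> ((snd c \<circ> \<gamma>) has_vector_derivative D r) (at r)" "continuous_on U D"
    using p unfolding C1_piece_def by blast+
  have U': "U' \<subseteq> U" "\<And>r. r \<in> U' \<Longrightarrow> \<gamma> r \<in> fst c" "\<And>r. r \<in> U' \<Longrightarrow> \<gamma> r \<in> fst c'"
    using U(3) unfolding U'_def by auto
  show "C1_piece \<gamma> c' U' (\<lambda>r. local_deriv c c' id (\<gamma> r) (D r))"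
    unfolding C1_piece_def
  proof (intro conjI ballI)
    show "open U'" unfolding U'_def by (rule open_path_vimage[OF \<open>path \<gamma>\<close> U(1,2) open_chart[OF c(2)]])
    show "U' \<subseteq> {0<..<1}" using U' U(2) by blast
    show "\<gamma> ` U' \<subseteq> fst c'" using U' by blast
    fix r assume r: "r \<in> U'"
    have "((snd c' \<circ> (id \<circ> \<gamma>)) has_vector_derivative local_deriv c c' id (\<gamma> r) (D r)) (at r)"
    proof (rule curve_derivative_image[OF id1 c])
      show "\<gamma> r \<in> fst c" "id (\<gamma> r) \<in> fst c'" using U'(2,3)[OF r] by simp_all
      show "isCont \<gamma> r" by (rule isCont_path[OF \<open>path \<gamma>\<close>]) (use r U' U(2) in blast)
      show "((snd c \<circ> \<gamma>) has_vector_derivative D r) (at r)" by (rule D(1)) (use r U' in blast)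
    qed
    then show "((snd c' \<circ> \<gamma>) has_vector_derivative local_deriv c c' id (\<gamma> r) (D r)) (at r)"
      by simp
  next
    show "continuous_on U' (\<lambda>r. local_deriv c c' id (\<gamma> r) (D r))"
    proof (rule continuous_on_linear_family[where T = "\<lambda>r. local_deriv c c' id (\<gamma> r)"])
      show "linear (local_deriv c c' id (\<gamma> r))" if "r \<in> U'" for r
        by (rule linear_local_deriv[OF id1 c]) (use U' that in auto)
      show "continuous_on U' (\<lambda>r. local_deriv c c' id (\<gamma> r) v)" for v
      proof (rule continuous_on_compose2[OF continuous_on_local_deriv[OF id1 c]])
        show "continuous_on U' \<gamma>" using U' U(2) by (intro continuous_on_path_interior[OF \<open>path \<gamma>\<close>]) blast
      qed (use U' in auto)
      show "continuous_on U' D" using D(2) U'(1) by (rule continuous_on_subset)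
    qed
  qed
  show "tangent_norm g c' (\<gamma> r) (local_deriv c c' id (\<gamma> r) (D r)) = tangent_norm g c (\<gamma> r) (D r)"
    if "r \<in> U'" for r by (rule tangent_norm_chart_change[OF c]) (use U' that in auto)
qed

lemma C1_pieces_of_has_length:
  assumes "has_length A g \<gamma> l"
  obtains S s where "finite S" "(s has_integral l) {0..1}" "\<And>t. s t \<ge> 0"
    "\<And>t c. t \<in> {0<..<1} - S \<Longrightarrow> c \<in> A \<Longrightarrow> \<gamma> t \<in> fst c \<Longrightarrow>
      \<exists>U D. t \<in> U \<and> C1_piece \<gamma> c U D \<and> (\<forall>r\<in>U. s r = tangent_norm g c (\<gamma> r) (D r))"
proof -
  have path: "path \<gamma>" using assms unfolding has_length_def by blast
  obtain S s where Ss: "finite S \<and> (s has_integral l) {0..1} \<and>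
       (\<forall>c\<in>A. (snd c \<circ> \<gamma>) C1_differentiable_on {t \<in> {0..1} - S. \<gamma> t \<in> fst c} \<and>
         (\<forall>t\<in>{0..1} - S. \<gamma> t \<in> fst c \<longrightarrow>
            s t = tangent_norm g c (\<gamma> t) (vector_derivative (snd c \<circ> \<gamma>) (at t))))"
    using assms[unfolded has_length_def, THEN conjunct2] by (elim exE) (rule that)
  have S: "finite S" "(s has_integral l) {0..1}"
    "\<And>c. c \<in> A \<Longrightarrow> (snd c \<circ> \<gamma>) C1_differentiable_on {t \<in> {0..1} - S. \<gamma> t \<in> fst c}"
    "\<And>c t. c \<in> A \<Longrightarrow> t \<in> {0..1} - S \<Longrightarrow> \<gamma> t \<in> fst c \<Longrightarrow>
       s t = tangent_norm g c (\<gamma> t) (vector_derivative (snd c \<circ> \<gamma>) (at t))"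
    using Ss by blast+
  define T where "T = {0<..<1::real} - S"
  \<comment> \<open>At the end and break points the speed is unconstrained and may be negative.
    Resetting it to \<open>0\<close> on this finite set keeps the integral and makes it nonnegative
    everywhere.\<close>
  define s' where "s' t = (if t \<in> T then s t else 0)" for t
  have "(s' has_integral l) {0..1}"
    by (rule has_integral_spike_finite[of "insert 0 (insert 1 S)" _ _ s]) (use S in \<open>auto simp: s'_def T_def\<close>)
  moreover have "s' t \<ge> 0" for t
  proof (cases "t \<in> T")
    case True
    then obtain c where "c \<in> A" "\<gamma> t \<in> fst c" using chart_cover by blast
    then show ?thesis using True S(4)[of c t] by (auto simp: s'_def T_def tangent_norm_nonneg)
  qed (simp add: s'_def)
  moreover have "\<exists>U D. t \<in> U \<and> C1_piece \<gamma> c U D \<and> (\<forall>r\<in>U. s' r = tangent_norm g c (\<gamma> r) (D r))"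
    if t: "t \<in> T" and c: "c \<in> A" "\<gamma> t \<in> fst c" for t c
  proof (intro exI conjI ballI)
    let ?U = "{r \<in> T. \<gamma> r \<in> fst c}" and ?D = "\<lambda>r. vector_derivative (snd c \<circ> \<gamma>) (at r)"
    show "t \<in> ?U" using t c by simp
    have sub: "?U \<subseteq> {t \<in> {0..1} - S. \<gamma> t \<in> fst c}" by (auto simp: T_def)
    have "(snd c \<circ> \<gamma>) C1_differentiable_on ?U" using S(3)[OF c(1)] sub by (rule C1_differentiable_on_subset)
    then have "\<forall>r\<in>?U. (snd c \<circ> \<gamma>) differentiable at r" "continuous_on ?U ?D"
      unfolding C1_differentiable_on_eq by blast+
    moreover have "open ?U"
      by (rule open_path_vimage[OF path]) (use S(1) open_chart[OF c(1)] in
        \<open>auto simp: T_def intro!: open_Diff finite_imp_closed\<close>)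
    ultimately show "C1_piece \<gamma> c ?U ?D"
      unfolding C1_piece_def by (auto simp: vector_derivative_works T_def)
    fix r assume "r \<in> ?U"
    then show "s' r = tangent_norm g c (\<gamma> r) (?D r)"
      using S(4)[OF c(1), of r] by (auto simp: s'_def T_def)
  qed
  ultimately show ?thesis using that[of S s'] S(1) unfolding T_def by blast
qed

text \<open>The speed is continuous off a finite set, hence measurable, and being dominated by the
  integrable \<open>h\<close> it is integrable. So a local bound on the speed proves both that a
  length exists and that it is at most \<open>I\<close>.\<close>

lemma has_length_le:
  assumes path: "path \<gamma>" and S: "finite S" and h: "(h has_integral I) {0..1}"
    and pieces: "\<And>t. t \<in> {0<..<1} - S \<Longrightarrow> \<exists>c\<in>A. \<exists>U D. t \<in> U \<and> C1_piece \<gamma> c U D \<and>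
      (\<forall>r\<in>U. tangent_norm g c (\<gamma> r) (D r) \<le> h r)"
  shows "\<exists>l\<le>I. has_length A g \<gamma> l"
proof -
  define T where "T = {0<..<1::real} - S"
  define vd where "vd c r = vector_derivative (snd c \<circ> \<gamma>) (at r)" for c :: "('a, 'n) chart" and r
  have "open T" unfolding T_def using S by (intro open_Diff finite_imp_closed) auto
  have piece: "\<exists>U. t \<in> U \<and> C1_piece \<gamma> c U (vd c) \<and> (\<forall>r\<in>U. tangent_norm g c (\<gamma> r) (vd c r) \<le> h r)"
    if t: "t \<in> T" and c: "c \<in> A" "\<gamma> t \<in> fst c" for t c
  proof -
    obtain c0 U0 D0 where 0: "c0 \<in> A" "t \<in> U0" "C1_piece \<gamma> c0 U0 D0"
      "\<And>r. r \<in> U0 \<Longrightarrow> tangent_norm g c0 (\<gamma> r) (D0 r) \<le> h r"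
      using pieces t unfolding T_def by blast
    let ?U = "{r \<in> U0. \<gamma> r \<in> fst c}" and ?D = "\<lambda>r. local_deriv c0 c id (\<gamma> r) (D0 r)"
    note p = C1_piece_chart_change[OF path 0(1) c(1) 0(3)]
    have vd: "vd c r = ?D r" if "r \<in> ?U" for r
      using p(1) that unfolding vd_def C1_piece_def by (blast intro: vector_derivative_at)
    have "C1_piece \<gamma> c ?U (vd c)"
      using p(1) vd unfolding C1_piece_def by (metis (no_types, lifting) continuous_on_eq)
    moreover have "tangent_norm g c (\<gamma> r) (vd c r) \<le> h r" if "r \<in> ?U" for r
      unfolding vd[OF that] p(2)[OF that] using 0(4) that by blast
    ultimately show ?thesis using 0(2) c(2) by (intro exI[of _ ?U]) blast
  qed
  \<comment> \<open>One chart is chosen per parameter to define the speed globally;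
    \<open>s_eq\<close> then shows that the choice has no influence off the break points, which is
    also why the speed is continuous there.\<close>
  define cc where "cc t = (SOME c. c \<in> A \<and> \<gamma> t \<in> fst c)" for t
  have cc: "cc t \<in> A \<and> \<gamma> t \<in> fst (cc t)" for t
    unfolding cc_def by (rule someI_ex) (use chart_cover in blast)
  define s where "s t = tangent_norm g (cc t) (\<gamma> t) (vd (cc t) t)" for t
  have s_eq: "s t = tangent_norm g c (\<gamma> t) (vd c t)" if t: "t \<in> T" and c: "c \<in> A" "\<gamma> t \<in> fst c" for t c
  proof -
    obtain U where U: "t \<in> U" "C1_piece \<gamma> (cc t) U (vd (cc t))" using piece[OF t] cc by blast
    note p = C1_piece_chart_change[OF path _ c(1) U(2)]
    have "vd c t = local_deriv (cc t) c id (\<gamma> t) (vd (cc t) t)"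
      using p(1) cc U(1) c(2) unfolding vd_def C1_piece_def by (blast intro: vector_derivative_at)
    then show ?thesis using p(2)[of t] cc U(1) c(2) unfolding s_def by simp
  qed
  have "isCont s t" if t: "t \<in> T" for t
  proof -
    obtain U where U: "t \<in> U" "C1_piece \<gamma> (cc t) U (vd (cc t))" using piece[OF t] cc by blast
    have U': "open U" "U \<subseteq> {0<..<1}" "\<gamma> ` U \<subseteq> fst (cc t)" "continuous_on U (vd (cc t))"
      using U(2) unfolding C1_piece_def by blast+
    have "continuous_on U (\<lambda>r. tangent_norm g (cc t) (\<gamma> r) (vd (cc t) r))"
      using cc continuous_on_path_interior[OF path U'(2)] U'(3,4) by (intro continuous_on_tangent_norm) auto
    then have "continuous_on (U \<inter> T) (\<lambda>r. tangent_norm g (cc t) (\<gamma> r) (vd (cc t) r))"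
      by (rule continuous_on_subset) simp
    then have "continuous_on (U \<inter> T) s"
    proof (rule continuous_on_eq)
      fix r assume "r \<in> U \<inter> T"
      then show "tangent_norm g (cc t) (\<gamma> r) (vd (cc t) r) = s r"
        using s_eq[of r "cc t"] cc[of t] U'(3) by (simp add: image_subset_iff)
    qed
    moreover have "open (U \<inter> T)" using U'(1) \<open>open T\<close> by auto
    ultimately show ?thesis using U(1) t by (simp add: continuous_on_eq_continuous_at)
  qed
  then have contT: "continuous_on T s" by (simp add: continuous_at_imp_continuous_on)
  note neg = negligible_open_unit_interval_minus_finite[OF S, folded T_def]
  have negl: "negligible {x \<in> {0..1} - T. P x}" "negligible {x \<in> T - {0..1}. P x}" for P :: "real \<Rightarrow> bool"
    by (rule negligible_subset[OF neg(1)], blast) (rule negligible_subset[OF neg(2)], blast)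
  have h': "h integrable_on {0..1}" "integral {0..1} h = I" using h by (auto simp: has_integral_integrable_integral)
  have hT: "h integrable_on T" using h'(1) by (rule integrable_spike_set) (rule negl)+
  have le: "s t \<le> h t" if t: "t \<in> T" for t
  proof -
    obtain U where "t \<in> U" "\<forall>r\<in>U. tangent_norm g (cc t) (\<gamma> r) (vd (cc t) r) \<le> h r"
      using piece[OF t] cc[of t] by blast
    then show ?thesis unfolding s_def by simp
  qed
  have sT: "s integrable_on T"
  proof (rule measurable_bounded_by_integrable_imp_integrable[OF _ hT])
    show "s \<in> borel_measurable (lebesgue_on T)"
      using contT \<open>open T\<close> by (intro continuous_imp_measurable_on_sets_lebesgue) auto
    show "T \<in> sets lebesgue" using \<open>open T\<close> by auto
    show "norm (s t) \<le> h t" if "t \<in> T" for t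
      using le[OF that] cc[of t] tangent_norm_nonneg unfolding s_def by simp
  qed
  have s01: "s integrable_on {0..1}" using sT by (rule integrable_spike_set) (rule negl)+
  have "integral {0..1} s = integral T s" by (rule integral_spike_set) (rule negl)+
  also have "\<dots> \<le> integral T h" by (rule integral_le[OF sT hT le])
  also have "\<dots> = integral {0..1} h" by (rule integral_spike_set) (rule negl)+
  finally have "integral {0..1} s \<le> I" using h'(2) by simp
  moreover have "has_length A g \<gamma> (integral {0..1} s)"
    unfolding has_length_def
  proof (intro conjI exI ballI impI path)
    \<comment> \<open>The ends join the break points, since derivatives there would also involve
      values of \<open>\<gamma>\<close> outside the unit interval.\<close>
    show "finite (insert 0 (insert 1 S))" using S by simp
    have T': "{0..1} - insert 0 (insert 1 S) = T" by (auto simp: T_def)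
    show "(s has_integral integral {0..1} s) {0..1}" using s01 by (rule integrable_integral)
    fix c assume c: "c \<in> A"
    have p: "(snd c \<circ> \<gamma>) differentiable at t \<and> isCont (vd c) t"
      if t: "t \<in> T" "\<gamma> t \<in> fst c" for t
    proof -
      obtain U where U: "t \<in> U" "C1_piece \<gamma> c U (vd c)" using piece[OF t(1) c t(2)] by blast
      then show ?thesis unfolding C1_piece_def vd_def
        by (auto simp: vector_derivative_works continuous_on_eq_continuous_at)
    qed
    then show "(snd c \<circ> \<gamma>) C1_differentiable_on {t \<in> {0..1} - insert 0 (insert 1 S). \<gamma> t \<in> fst c}"
      unfolding T' C1_differentiable_on_eq vd_def by (auto intro!: continuous_at_imp_continuous_on)
    fix t assume "t \<in> {0..1} - insert 0 (insert 1 S)" "\<gamma> t \<in> fst c"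
    then show "s t = tangent_norm g c (\<gamma> t) (vector_derivative (snd c \<circ> \<gamma>) (at t))"
      using s_eq[of t c] c unfolding T' vd_def by simp
  qed
  ultimately show ?thesis by blast
qed

lemma has_length_nonneg: "has_length A g \<gamma> l \<Longrightarrow> l \<ge> 0"
  by (erule C1_pieces_of_has_length) (blast intro: has_integral_nonneg)

text \<open>Reparametrization multiplies the speed by \<open>\<tau>\<close>, so by substitution the
  integral becomes that of the old speed over \<open>{0..\<tau>}\<close>. This serves to bound the
  distance from the start to an intermediate point.\<close>

lemma has_length_initial_piece:
  assumes "has_length A g \<gamma> l" and \<tau>: "0 < \<tau>" "\<tau> \<le> 1"
  shows "\<exists>l'\<le>l. has_length A g (\<lambda>u. \<gamma> (\<tau> * u)) l'"
proof -
  have path: "path \<gamma>" using assms unfolding has_length_def by blast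
  obtain S s where S: "finite S" "(s has_integral l) {0..1}" "\<And>t. s t \<ge> 0"
    and pc: "\<And>t c. t \<in> {0<..<1} - S \<Longrightarrow> c \<in> A \<Longrightarrow> \<gamma> t \<in> fst c \<Longrightarrow>
      \<exists>U D. t \<in> U \<and> C1_piece \<gamma> c U D \<and> (\<forall>r\<in>U. s r = tangent_norm g c (\<gamma> r) (D r))"
    using C1_pieces_of_has_length[OF assms(1)] by blast
  have "s integrable_on {0..1}" using S(2) by blast
  then have "s integrable_on {0..\<tau>}" by (rule integrable_on_subinterval) (use \<tau> in auto)
  then obtain j where j: "(s has_integral j) {0..\<tau>}" by blast
  have "j \<le> l" by (rule has_integral_subset_le[OF _ j S(2)]) (use \<tau> S(3) in auto)
  have "((\<lambda>u. \<tau> * s (\<tau> * u)) has_integral j) {0..1}"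
  proof -
    have "((\<lambda>u. s (\<tau> *\<^sub>R u + 0)) has_integral (j /\<^sub>R \<tau> ^ DIM(real))) (cbox ((0 - 0) /\<^sub>R \<tau>) ((\<tau> - 0) /\<^sub>R \<tau>))"
      by (rule has_integral_affinity') (use j \<tau> in auto)
    then have "((\<lambda>u. s (\<tau> * u)) has_integral (j / \<tau>)) {0..1}" using \<tau> by (simp add: divide_inverse mult.commute)
    from has_integral_mult_right[OF this, of \<tau>] show ?thesis using \<tau> by simp
  qed
  moreover have "path (\<lambda>u. \<gamma> (\<tau> * u))"
    using path unfolding path_def
  proof (rule continuous_on_compose2)
    show "continuous_on {0..1} (\<lambda>u. \<tau> * u)" by (intro continuous_intros)
    show "(\<lambda>u. \<tau> * u) ` {0..1} \<subseteq> {0..1}" using \<tau> by (auto simp: mult_le_one)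
  qed
  moreover have "finite ((\<lambda>u. \<tau> * u) -` S)"
    by (rule finite_vimageI[OF S(1)]) (use \<tau> in \<open>auto intro: inj_onI\<close>)
  moreover have "\<exists>c\<in>A. \<exists>U D. t \<in> U \<and> C1_piece (\<lambda>u. \<gamma> (\<tau> * u)) c U D \<and>
      (\<forall>r\<in>U. tangent_norm g c (\<gamma> (\<tau> * r)) (D r) \<le> \<tau> * s (\<tau> * r))"
    if t: "t \<in> {0<..<1} - (\<lambda>u. \<tau> * u) -` S" for t
  proof -
    have t': "0 < t" "t < 1" "\<tau> * t \<notin> S" using t by auto
    have "\<tau> * t \<le> t" using mult_right_mono[OF \<tau>(2), of t] t'(1) by simp
    then have "\<tau> * t < 1" using t'(2) by linarith
    then have tS: "\<tau> * t \<in> {0<..<1} - S" using t' \<tau>(1) by simp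
    obtain c where c: "c \<in> A" "\<gamma> (\<tau> * t) \<in> fst c" using chart_cover by blast
    obtain U D where U: "\<tau> * t \<in> U" "C1_piece \<gamma> c U D"
      "\<forall>r\<in>U. s r = tangent_norm g c (\<gamma> r) (D r)" using pc[OF tS c] by blast
    have U': "open U" "\<And>r. r \<in> U \<Longrightarrow> \<gamma> r \<in> fst c" "continuous_on U D"
      "\<And>r. r \<in> U \<Longrightarrow> ((snd c \<circ> \<gamma>) has_vector_derivative D r) (at r)"
      using U(2) unfolding C1_piece_def by blast+
    let ?U = "(\<lambda>u. \<tau> * u) -` U \<inter> {0<..<1}" and ?D = "\<lambda>u. \<tau> *\<^sub>R D (\<tau> * u)"
    have piece: "C1_piece (\<lambda>u. \<gamma> (\<tau> * u)) c ?U ?D"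
      unfolding C1_piece_def
    proof (intro conjI ballI)
      show "open ?U" by (intro open_Int open_vimage U'(1) continuous_intros)
      show "(\<lambda>u. \<gamma> (\<tau> * u)) ` ?U \<subseteq> fst c" using U'(2) by (simp add: image_subset_iff)
      show "continuous_on ?U ?D"
      proof (intro continuous_intros)
        show "continuous_on ?U (\<lambda>u. D (\<tau> * u))"
        proof (rule continuous_on_compose2[OF U'(3)])
          show "continuous_on ?U (\<lambda>u. \<tau> * u)" by (intro continuous_intros)
        qed blast
      qed
      fix r assume "r \<in> ?U"
      then have "((snd c \<circ> \<gamma>) has_vector_derivative D (\<tau> * r)) (at (\<tau> * r))"
        using U'(4) by simp
      moreover have "((\<lambda>u. \<tau> * u) has_vector_derivative \<tau>) (at r)"
        by (auto intro!: derivative_eq_intros simp: has_real_derivative_iff_has_vector_derivative[symmetric])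
      ultimately have "((snd c \<circ> \<gamma>) \<circ> (\<lambda>u. \<tau> * u) has_vector_derivative \<tau> *\<^sub>R D (\<tau> * r)) (at r)"
        by (intro vector_diff_chain_at)
      then show "((snd c \<circ> (\<lambda>u. \<gamma> (\<tau> * u))) has_vector_derivative ?D r) (at r)"
        by (simp add: comp_def)
    qed simp
    have le: "tangent_norm g c (\<gamma> (\<tau> * r)) (?D r) \<le> \<tau> * s (\<tau> * r)" if "r \<in> ?U" for r
    proof -
      have "\<gamma> (\<tau> * r) \<in> fst c" using U'(2) that by simp
      then show ?thesis using tangent_norm_scaleR[OF c(1)] bspec[OF U(3), of "\<tau> * r"] that \<tau> by simp
    qed
    have "t \<in> ?U" using U(1) t' by simp
    then show ?thesis
      by (intro bexI[OF _ c(1)] exI[of _ ?U] exI[of _ ?D] conjI ballI piece le)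
  qed
  ultimately have "\<exists>l'\<le>j. has_length A g (\<lambda>u. \<gamma> (\<tau> * u)) l'"
    by (intro has_length_le)
  then show ?thesis using \<open>j \<le> l\<close> by (meson order_trans)
qed

text \<open>The straight segment in coordinates has a continuous speed and so a length. This is
  needed because \<open>dist\<close> is tied to curve lengths only for points that some curve
  joins.\<close>

lemma curve_lengths_line_nonempty:
  assumes c: "c \<in> A" and B: "convex B" "B \<subseteq> snd c ` fst c" and xy: "x \<in> fst c" "y \<in> fst c" "snd c x \<in> B" "snd c y \<in> B"
  shows "curve_lengths A g x y \<noteq> {}"
proof -
  let ?i = "inv_into (fst c) (snd c)"
  let ?l = "linepath (snd c x) (snd c y)"
  define \<gamma> where "\<gamma> = ?i \<circ> ?l"
  have l: "?l t \<in> snd c ` fst c" if "t \<in> {0..1}" for t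
  proof -
    have "?l t \<in> closed_segment (snd c x) (snd c y)" using that linepath_in_path by blast
    then show ?thesis using closed_segment_subset[OF xy(3,4) B(1)] B(2) by blast
  qed
  have \<gamma>c: "\<gamma> t \<in> fst c" "snd c (\<gamma> t) = ?l t" if "t \<in> {0..1}" for t
    using l[OF that] homeomorphism_apply2[OF chart_homeomorphism[OF c] l[OF that]]
    by (auto simp: \<gamma>_def chart_inverse[OF c])
  have cont: "continuous_on {0..1} \<gamma>"
    unfolding \<gamma>_def
    by (intro continuous_on_compose continuous_on_linepath
      continuous_on_subset[OF homeomorphism_cont2[OF chart_homeomorphism[OF c]]]) (use l in auto)
  let ?h = "\<lambda>t. tangent_norm g c (\<gamma> t) (snd c y - snd c x)"
  have "continuous_on {0..1} ?h"
    by (rule continuous_on_tangent_norm[OF c cont]) (use \<gamma>c in auto)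
  then have "?h integrable_on {0..1}" by (rule integrable_continuous_real)
  then obtain I where I: "(?h has_integral I) {0..1}" by blast
  have "C1_piece \<gamma> c {0<..<1} (\<lambda>_. snd c y - snd c x)"
    unfolding C1_piece_def
  proof (intro conjI ballI)
    show "\<gamma> ` {0<..<1} \<subseteq> fst c" using \<gamma>c(1) by auto
    fix r :: real assume r: "r \<in> {0<..<1}"
    have "(?l has_vector_derivative (snd c y - snd c x)) (at r)"
      by (rule has_vector_derivative_linepath_within)
    then show "((snd c \<circ> \<gamma>) has_vector_derivative (snd c y - snd c x)) (at r)"
      by (rule has_vector_derivative_transform_within_open[of _ _ _ "{0<..<1}"]) (use r \<gamma>c(2) in auto)
  qed auto
  then have "\<exists>l\<le>I. has_length A g \<gamma> l"
  proof (intro has_length_le[OF _ finite.emptyI I])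
    show "path \<gamma>" using cont by (simp add: path_def)
    assume "C1_piece \<gamma> c {0<..<1} (\<lambda>_. snd c y - snd c x)"
    then show "\<exists>c'\<in>A. \<exists>U D. t \<in> U \<and> C1_piece \<gamma> c' U D \<and>
        (\<forall>r\<in>U. tangent_norm g c' (\<gamma> r) (D r) \<le> ?h r)" if "t \<in> {0<..<1} - {}" for t
      using c that by (intro bexI[of _ c] exI[of _ "{0<..<1}"] exI[of _ "\<lambda>_. snd c y - snd c x"]) auto
  qed
  moreover have "pathstart \<gamma> = x" "pathfinish \<gamma> = y"
    using xy chart_inverse[OF c] by (auto simp: \<gamma>_def pathstart_def pathfinish_def linepath_0' linepath_1')
  ultimately show ?thesis unfolding curve_lengths_def by blast
qed

text \<open>A nonzero kernel vector would have positive norm but an image of norm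
  \<open>0\<close>.\<close>

lemma inj_local_deriv:
  assumes f: "Cr_map A 1 f" and c: "c \<in> A" "c' \<in> A" "x \<in> fst c" "f x \<in> fst c'"
    and mono: "\<And>v. tangent_norm g c x v \<le> tangent_norm g c' (f x) (local_deriv c c' f x v)"
  shows "inj (local_deriv c c' f x)"
proof -
  have lin: "linear (local_deriv c c' f x)" by (rule linear_local_deriv[OF f c])
  have "v = 0" if "local_deriv c c' f x v = 0" for v
  proof (rule ccontr)
    assume "v \<noteq> 0"
    then have "tangent_norm g c x v > 0" by (rule tangent_norm_pos[OF c(1,3)])
    moreover have "tangent_norm g c' (f x) 0 = 0"
      using tangent_norm_scaleR[OF c(2,4), of 0 0] by simp
    ultimately show False using mono[of v] that by simp
  qed
  then show ?thesis using lin linear_injective_0 by blast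
qed

text \<open>The velocity \<open>D\<close> of the lift solves
  \<open>local_deriv c c' f (\<gamma>' r) (D r) = b r\<close> with \<open>b\<close> the velocity
  below. Injectivity of the derivative makes it exist and vary continuously, and \<open>mono\<close>
  bounds its norm by the speed below.\<close>

lemma has_length_lift:
  assumes f: "Cr_map A 1 f"
    and mono: "\<And>c c' x v. c \<in> A \<Longrightarrow> c' \<in> A \<Longrightarrow> x \<in> fst c \<Longrightarrow> f x \<in> fst c' \<Longrightarrow>
      tangent_norm g c x v \<le> tangent_norm g c' (f x) (local_deriv c c' f x v)"
    and l: "has_length A g \<gamma> l" and path: "path \<gamma>'" and lift: "\<And>t. t \<in> {0..1} \<Longrightarrow> f (\<gamma>' t) = \<gamma> t"
  shows "\<exists>l'\<le>l. has_length A g \<gamma>' l'"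
proof -
  obtain S s where S: "finite S" "(s has_integral l) {0..1}" "\<And>t. s t \<ge> 0"
    and pc: "\<And>t c. t \<in> {0<..<1} - S \<Longrightarrow> c \<in> A \<Longrightarrow> \<gamma> t \<in> fst c \<Longrightarrow>
      \<exists>U D. t \<in> U \<and> C1_piece \<gamma> c U D \<and> (\<forall>r\<in>U. s r = tangent_norm g c (\<gamma> r) (D r))"
    using C1_pieces_of_has_length[OF l] by blast
  note inj = inj_local_deriv[OF f _ _ _ _ mono]
  have "\<exists>c\<in>A. \<exists>U D. t \<in> U \<and> C1_piece \<gamma>' c U D \<and> (\<forall>r\<in>U. tangent_norm g c (\<gamma>' r) (D r) \<le> s r)"
    if t: "t \<in> {0<..<1} - S" for t
  proof -
    obtain c where c: "c \<in> A" "\<gamma>' t \<in> fst c" using chart_cover by blast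
    obtain c' where c': "c' \<in> A" "\<gamma> t \<in> fst c'" using chart_cover by blast
    obtain V b where V: "t \<in> V" "C1_piece \<gamma> c' V b" "\<And>r. r \<in> V \<Longrightarrow> s r = tangent_norm g c' (\<gamma> r) (b r)"
      using pc[OF t c'] by blast
    have V': "open V" "V \<subseteq> {0<..<1}" "\<gamma> ` V \<subseteq> fst c'" "continuous_on V b"
      "\<And>r. r \<in> V \<Longrightarrow> ((snd c' \<circ> \<gamma>) has_vector_derivative b r) (at r)"
      using V(2) unfolding C1_piece_def by blast+
    define U where "U = {r \<in> V. \<gamma>' r \<in> fst c}"
    have U: "open U" unfolding U_def by (rule open_path_vimage[OF path V'(1,2) open_chart[OF c(1)]])
    have lift': "f (\<gamma>' r) = \<gamma> r" if "r \<in> V" for r using V'(2) that by (intro lift) auto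
    have in_c: "\<gamma>' r \<in> fst c" "f (\<gamma>' r) \<in> fst c'" if "r \<in> U" for r
      using that V'(3) lift'[of r] unfolding U_def by auto
    have ex: "\<exists>v. ((snd c \<circ> \<gamma>') has_vector_derivative v) (at r) \<and> local_deriv c c' f (\<gamma>' r) v = b r"
      if r: "r \<in> U" for r
    proof (rule curve_derivative_lift[where \<gamma> = \<gamma>' and t = r, OF f c(1) c'(1) in_c[OF r] inj[OF c(1) c'(1) in_c[OF r] c(1) c'(1) in_c[OF r]]])
      show "isCont \<gamma>' r" using r V'(2) unfolding U_def by (intro isCont_path[OF path]) auto
      have "((snd c' \<circ> \<gamma>) has_vector_derivative b r) (at r)" using V'(5) r unfolding U_def by blast
      then show "((snd c' \<circ> (f \<circ> \<gamma>')) has_vector_derivative b r) (at r)"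
        by (rule has_vector_derivative_transform_within_open[OF _ V'(1)]) (use r lift' in \<open>auto simp: U_def\<close>)
    qed
    then obtain D where D: "\<And>r. r \<in> U \<Longrightarrow> ((snd c \<circ> \<gamma>') has_vector_derivative D r) (at r)"
      "\<And>r. r \<in> U \<Longrightarrow> local_deriv c c' f (\<gamma>' r) (D r) = b r" by metis
    have "continuous_on U D"
    proof (rule continuous_on_linear_solution[where T = "\<lambda>r. local_deriv c c' f (\<gamma>' r)" and b = b,
          OF _ _ _ _ D(2)])
      show "linear (local_deriv c c' f (\<gamma>' r))" if "r \<in> U" for r
        by (rule linear_local_deriv[OF f c(1) c'(1) in_c[OF that]])
      show "inj (local_deriv c c' f (\<gamma>' r))" if "r \<in> U" for r
        by (rule inj[OF c(1) c'(1) in_c[OF that] c(1) c'(1) in_c[OF that]])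
      show "continuous_on U (\<lambda>r. local_deriv c c' f (\<gamma>' r) v)" for v
      proof (rule continuous_on_compose2[OF continuous_on_local_deriv[OF f c(1) c'(1)]])
        show "continuous_on U \<gamma>'" using V'(2) unfolding U_def by (intro continuous_on_path_interior[OF path]) auto
      qed (use in_c in auto)
      show "continuous_on U b" using V'(4) by (rule continuous_on_subset) (auto simp: U_def)
    qed
    then have piece: "C1_piece \<gamma>' c U D"
      unfolding C1_piece_def using U V'(2) D(1) by (auto simp: U_def)
    have le: "tangent_norm g c (\<gamma>' r) (D r) \<le> s r" if "r \<in> U" for r
      using mono[OF c(1) c'(1) in_c[OF that], of "D r"] D(2)[OF that] V(3)[of r] lift'[of r] that
      unfolding U_def by simp
    have "t \<in> U" using V(1) c(2) by (simp add: U_def)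
    then show ?thesis
      by (intro bexI[OF _ c(1)] exI[of _ U] exI[of _ D] conjI ballI piece le)
  qed
  then show ?thesis by (rule has_length_le[OF path S(1,2)])
qed

end

section \<open>Expanding maps\<close>

text \<open>A Lebesgue number argument: finitely many of the local balls cover, and by
  \<open>mono\<close> the smallest of their radii serves every point.\<close>

lemma compact_uniform_radius:
  fixes P :: "real \<Rightarrow> 'a::metric_space \<Rightarrow> bool"
  assumes "compact (UNIV :: 'a set)"
    and mono: "\<And>d e x. P e x \<Longrightarrow> 0 < d \<Longrightarrow> d \<le> e \<Longrightarrow> P d x"
    and loc: "\<And>x. \<exists>e>0. \<forall>y\<in>ball x e. P e y"
  shows "\<exists>e>0. \<forall>x. P e x"
proof -
  have "\<forall>x. \<exists>e>0. \<forall>y\<in>ball x e. P e y" using loc by blast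
  from choice[OF this] obtain e where e: "\<forall>x. e x > 0 \<and> (\<forall>y\<in>ball x (e x). P (e x) y)" ..
  obtain X where X: "finite X" "(UNIV :: 'a set) \<subseteq> (\<Union>x\<in>X. ball x (e x))"
  proof (rule compactE_image[OF assms(1), of UNIV "\<lambda>x. ball x (e x)"])
    show "(UNIV :: 'a set) \<subseteq> (\<Union>x. ball x (e x))"
    proof
      fix x :: 'a show "x \<in> (\<Union>x. ball x (e x))" using e by (intro UN_I[of x]) auto
    qed
  qed auto
  define d where "d = Min (insert 1 (e ` X))"
  have "d > 0" unfolding d_def using X(1) e by (subst Min_gr_iff) auto
  moreover have "P d y" for y
  proof -
    obtain x where x: "x \<in> X" "y \<in> ball x (e x)" using X(2) by blast
    then have "d \<le> e x" unfolding d_def using X(1) by (intro Min_le) auto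
    then show ?thesis using mono[of "e x" y d] e x(2) \<open>d > 0\<close> by blast
  qed
  ultimately show ?thesis by blast
qed

context riemannian_atlas
begin

text \<open>The injectivity half of the inverse function theorem, applied to the representative of
  \<open>f\<close> in charts around \<open>x\<close> and \<open>f x\<close>.\<close>

lemma locally_injective:
  assumes f: "Cr_map A 1 f"
    and inj: "\<And>c c' x. c \<in> A \<Longrightarrow> c' \<in> A \<Longrightarrow> x \<in> fst c \<Longrightarrow> f x \<in> fst c' \<Longrightarrow> inj (local_deriv c c' f x)"
  shows "\<exists>e>0. inj_on f (ball x e)"
proof -
  obtain c where c: "c \<in> A" "x \<in> fst c" using chart_cover by blast
  obtain c' where c': "c' \<in> A" "f x \<in> fst c'" using chart_cover by blast
  define W where "W = fst c \<inter> f -` fst c'"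
  define S where "S = snd c ` W"
  define F where "F = local_rep c c' f"
  define F' where "F' p = frechet_derivative F (at p)" for p
  define a where "a = snd c x"
  have W: "open W" "x \<in> W" "W \<subseteq> fst c"
    unfolding W_def using open_chart_domain[OF f c(1) c'(1)] c(2) c'(2) by auto
  have S: "open S" "a \<in> S"
    unfolding S_def a_def using open_image_chart[OF c(1) W(1,3)] W(2) by auto
  have F'_chart: "F' (snd c y) = local_deriv c c' f y" for y
    unfolding F'_def F_def local_deriv_def ..
  have der: "(F has_derivative F' p) (at p)" if p: "p \<in> S" for p
  proof -
    obtain y where y: "y \<in> W" "p = snd c y" using p unfolding S_def by blast
    then show ?thesis
      unfolding y(2) F'_chart F_def using local_rep_has_derivative[OF f c(1) c'(1), of y]
      unfolding W_def by simp
  qed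
  have contF': "continuous_on S (\<lambda>p. F' p v)" for v
    using f c(1) c'(1) unfolding Cr_map_def F'_def F_def S_def W_def by simp
  \<comment> \<open>Class C1 here means continuity of the derivative along each fixed vector.
    Summing over the basis vectors gives a continuous bound for the operator norm, which the local
    injectivity theorem asks for.\<close>
  define G where "G p = (\<Sum>j\<in>UNIV. norm (F' p (axis j 1) - F' a (axis j 1)))" for p
  have onorm_G: "onorm (\<lambda>v. F' p v - F' a v) \<le> G p" if p: "p \<in> S" for p
  proof (rule onorm_le)
    fix v
    have lin: "linear (\<lambda>v. F' p v - F' a v)"
      using has_derivative_linear[OF der[OF p]] has_derivative_linear[OF der[OF S(2)]]
      by (intro linear_compose_sub)
    have "norm (F' p v - F' a v) = norm (\<Sum>j\<in>UNIV. v $ j *\<^sub>R (F' p (axis j 1) - F' a (axis j 1)))"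
      using linear_axis_expansion[OF lin, of v] by simp
    also have "\<dots> \<le> (\<Sum>j\<in>UNIV. norm (v $ j *\<^sub>R (F' p (axis j 1) - F' a (axis j 1))))"
      by (rule norm_sum)
    also have "\<dots> \<le> (\<Sum>j\<in>UNIV. norm v * norm (F' p (axis j 1) - F' a (axis j 1)))"
      by (intro sum_mono) (auto intro!: mult_right_mono component_le_norm_cart)
    also have "\<dots> = G p * norm v" unfolding G_def by (simp add: sum_distrib_left mult.commute)
    finally show "norm (F' p v - F' a v) \<le> G p * norm v" .
  qed
  have contG: "continuous_on S G" unfolding G_def by (intro continuous_intros contF')
  have Ga: "G a = 0" by (simp add: G_def)
  have lin: "linear (F' a)" by (rule has_derivative_linear[OF der[OF S(2)]])
  have "inj (F' a)" unfolding a_def F'_chart by (rule inj[OF c(1) c'(1) c(2) c'(2)])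
  then obtain G' where G': "linear G'" "G' \<circ> F' a = id"
    using linear_injective_left_inverse[OF lin] by blast
  obtain r where r: "r > 0" "ball a r \<subseteq> S" "inj_on F (ball a r)"
  proof (rule has_derivative_locally_injective[OF S(2,1) _ G'(2) der])
    show "bounded_linear G'" using G'(1) by (simp add: linear_conv_bounded_linear)
    fix e :: real assume e: "e > 0"
    have "isCont G a" using contG S by (simp add: continuous_on_eq_continuous_at)
    then obtain d1 where d1: "d1 > 0" "\<And>p. dist p a < d1 \<Longrightarrow> dist (G p) (G a) < e"
      using e unfolding continuous_at_eps_delta by blast
    obtain d2 where d2: "d2 > 0" "ball a d2 \<subseteq> S" using S open_contains_ball by blast
    show "\<exists>d>0. \<forall>p. dist a p < d \<longrightarrow> onorm (\<lambda>v. F' p v - F' a v) < e"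
    proof (intro exI[of _ "min d1 d2"] conjI allI impI)
      fix p assume p: "dist a p < min d1 d2"
      then have "p \<in> S" using d2(2) by auto
      moreover have "G p < e" using d1(2)[of p] p Ga by (simp add: dist_commute dist_real_def)
      ultimately show "onorm (\<lambda>v. F' p v - F' a v) < e" using onorm_G by (meson order_le_less_trans)
    qed (use d1(1) d2(1) in simp)
  qed
  have "open (W \<inter> snd c -` ball a r)"
    using continuous_on_subset[OF continuous_on_chart[OF c(1)] W(3)] W(1)
    by (intro continuous_open_preimage) auto
  moreover have "x \<in> W \<inter> snd c -` ball a r" using W(2) r(1) by (simp add: a_def)
  ultimately obtain e where e: "e > 0" "ball x e \<subseteq> W \<inter> snd c -` ball a r"
    using open_contains_ball by blast
  have "inj_on f (ball x e)"
  proof (rule inj_onI)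
    fix y z assume yz: "y \<in> ball x e" "z \<in> ball x e" "f y = f z"
    have in_c: "y \<in> fst c" "z \<in> fst c" using yz e(2) W(3) by auto
    have "F (snd c y) = F (snd c z)" unfolding F_def using local_rep_chart[OF c(1)] in_c yz(3) by simp
    moreover have "snd c y \<in> ball a r" "snd c z \<in> ball a r" using yz e(2) by auto
    ultimately have "snd c y = snd c z" using r(3) by (meson inj_onD)
    then show "y = z" using inj_onD[OF inj_on_chart[OF c(1)]] in_c by blast
  qed
  then show ?thesis using e(1) by blast
qed

text \<open>Invariance of domain in coordinates: both charts take values in the same
  \<open>real ^ 'n\<close>, and the target chart carries openness back to the manifold.\<close>

lemma open_image_of_injective:
  assumes f: "continuous_on UNIV f" and c: "c \<in> A" "c' \<in> A" and U: "open U" "U \<subseteq> fst c" "f ` U \<subseteq> fst c'" "inj_on f U"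
  shows "open (f ` U)"
proof -
  let ?i = "inv_into (fst c) (snd c)"
  let ?F = "snd c' \<circ> (f \<circ> ?i)"
  have i: "?i (snd c y) = y" if "y \<in> U" for y using that U(2) chart_inverse[OF c(1)] by blast
  have iU: "?i ` snd c ` U = U" using i by force
  have img: "?F ` snd c ` U = snd c' ` f ` U" using iU by (metis image_comp)
  have "open (?F ` snd c ` U)"
  proof (rule invariance_of_domain)
    show "open (snd c ` U)" by (rule open_image_chart[OF c(1) U(1,2)])
    have "continuous_on (snd c ` U) ?i"
      using homeomorphism_cont2[OF chart_homeomorphism[OF c(1)]] U(2) by (rule continuous_on_subset[OF _ image_mono])
    moreover have "continuous_on (?i ` snd c ` U) f" using f by (rule continuous_on_subset) simp
    ultimately have "continuous_on (snd c ` U) (f \<circ> ?i)" by (rule continuous_on_compose)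
    moreover have "continuous_on ((f \<circ> ?i) ` snd c ` U) (snd c')"
      by (rule continuous_on_subset[OF continuous_on_chart[OF c(2)]]) (use U(3) iU in \<open>metis image_comp\<close>)
    ultimately show "continuous_on (snd c ` U) ?F" by (rule continuous_on_compose)
    show "inj_on ?F (snd c ` U)"
    proof (rule inj_onI)
      fix p q assume "p \<in> snd c ` U" "q \<in> snd c ` U" and eq: "?F p = ?F q"
      then obtain y z where yz: "y \<in> U" "z \<in> U" "p = snd c y" "q = snd c z" by blast
      have "snd c' (f y) = snd c' (f z)" using eq i yz by simp
      moreover have "f y \<in> fst c'" "f z \<in> fst c'" using U(3) yz(1,2) by auto
      ultimately have "f y = f z" using inj_onD[OF inj_on_chart[OF c(2)]] by blast
      then show "p = q" using inj_onD[OF U(4)] yz by blast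
    qed
  qed
  then have "open (fst c' \<inter> snd c' -` (snd c' ` f ` U))"
    unfolding img by (intro continuous_open_preimage continuous_on_chart open_chart c(2))
  moreover have "fst c' \<inter> snd c' -` (snd c' ` f ` U) = f ` U"
    using U(3) inj_onD[OF inj_on_chart[OF c(2)]] by blast
  ultimately show ?thesis by simp
qed

lemma local_deriv_compose:
  assumes f: "Cr_map A 1 f" and h: "Cr_map A 1 h"
    and c: "c \<in> A" "c' \<in> A" "c'' \<in> A" "x \<in> fst c" "f x \<in> fst c'" "h (f x) \<in> fst c''"
  shows "local_deriv c c'' (h \<circ> f) x = local_deriv c' c'' h (f x) \<circ> local_deriv c c' f x"
proof -
  let ?W = "fst c \<inter> f -` fst c'"
  have "open (snd c ` ?W)"
    by (rule open_image_chart[OF c(1) open_chart_domain[OF f c(1,2)]]) simp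
  have "(local_rep c c' f has_derivative local_deriv c c' f x) (at (snd c x))"
    by (rule local_rep_has_derivative[OF f c(1,2,4,5)])
  moreover have "(local_rep c' c'' h has_derivative local_deriv c' c'' h (f x)) (at (local_rep c c' f (snd c x)))"
    unfolding local_rep_chart[OF c(1,4)] by (rule local_rep_has_derivative[OF h c(2,3,5,6)])
  ultimately have "(local_rep c' c'' h \<circ> local_rep c c' f has_derivative
      (local_deriv c' c'' h (f x) \<circ> local_deriv c c' f x)) (at (snd c x))"
    by (rule diff_chain_at)
  then have "(local_rep c c'' (h \<circ> f) has_derivative
      (local_deriv c' c'' h (f x) \<circ> local_deriv c c' f x)) (at (snd c x))"
  proof (rule has_derivative_transform_within_open[OF _ \<open>open (snd c ` ?W)\<close>])
    show "snd c x \<in> snd c ` ?W" using c(4,5) by blast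
    fix p assume "p \<in> snd c ` ?W"
    then obtain y where y: "y \<in> fst c" "f y \<in> fst c'" "p = snd c y" by blast
    show "(local_rep c' c'' h \<circ> local_rep c c' f) p = local_rep c c'' (h \<circ> f) p"
      unfolding y(3) comp_apply local_rep_chart[OF c(1) y(1)] local_rep_chart[OF c(2) y(2)] ..
  qed
  then show ?thesis unfolding local_deriv_def[of c c'' "h \<circ> f"] by (rule frechet_derivative_at[symmetric])
qed

lemma expanding_tangent_norm_le:
  assumes "expanding A g f" "c \<in> A" "c' \<in> A" "x \<in> fst c" "f x \<in> fst c'"
  shows "tangent_norm g c x v \<le> tangent_norm g c' (f x) (local_deriv c c' f x v)"
proof -
  obtain \<kappa> where "\<kappa> > 1" and \<kappa>: "\<forall>c\<in>A. \<forall>c'\<in>A. \<forall>x\<in>fst c \<inter> f -` fst c'. \<forall>v.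
     tangent_norm g c' (f x) (local_deriv c c' f x v) \<ge> \<kappa> * tangent_norm g c x v"
    using assms(1) unfolding expanding_def by blast
  have "1 * tangent_norm g c x v \<le> \<kappa> * tangent_norm g c x v"
    using \<open>\<kappa> > 1\<close> tangent_norm_nonneg[OF assms(2,4)] by (intro mult_right_mono) auto
  also have "\<dots> \<le> tangent_norm g c' (f x) (local_deriv c c' f x v)"
    using bspec[OF bspec[OF bspec[OF \<kappa> assms(2)] assms(3)], of x] assms(4,5) by simp
  finally show ?thesis by simp
qed

end

section \<open>The Riemannian distance\<close>

locale closed_riemannian = riemannian_atlas A g
  for A :: "('a::metric_space, 'n::finite) chart set" and g :: "('a, 'n) metric_tensor" +
  assumes compact_space: "compact (UNIV :: 'a set)"
    and dist_eq_Inf: "curve_lengths A g x y \<noteq> {} \<Longrightarrow> dist x y = Inf (curve_lengths A g x y)"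
begin

lemma dist_le_length:
  assumes "has_length A g \<gamma> l"
  shows "dist (\<gamma> 0) (\<gamma> 1) \<le> l"
proof -
  have l: "l \<in> curve_lengths A g (\<gamma> 0) (\<gamma> 1)"
    using assms unfolding curve_lengths_def pathstart_def pathfinish_def by blast
  have "bdd_below (curve_lengths A g (\<gamma> 0) (\<gamma> 1))"
    by (rule bdd_belowI[of _ 0]) (auto simp: curve_lengths_def has_length_nonneg)
  then have "Inf (curve_lengths A g (\<gamma> 0) (\<gamma> 1)) \<le> l" using l by (intro cInf_lower)
  moreover have "curve_lengths A g (\<gamma> 0) (\<gamma> 1) \<noteq> {}" using l by blast
  ultimately show ?thesis by (simp add: dist_eq_Inf)
qed

text \<open>Keeps a whole short curve inside the ball around its start on which an inverse branch is
  defined.\<close>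

lemma dist_point_on_curve_le_length:
  assumes "has_length A g \<gamma> l" "t \<in> {0..1}"
  shows "dist (\<gamma> 0) (\<gamma> t) \<le> l"
proof (cases "t = 0")
  case True
  then show ?thesis using has_length_nonneg[OF assms(1)] by simp
next
  case False
  then obtain l' where l': "l' \<le> l" "has_length A g (\<lambda>u. \<gamma> (t * u)) l'"
    using has_length_initial_piece[OF assms(1), of t] assms(2) by auto
  then show ?thesis using dist_le_length[OF l'(2)] by simp
qed

text \<open>Points close to each other lie in a convex coordinate ball, where a segment joins them;
  compactness makes the closeness uniform. Below this scale \<open>dist\<close> is the infimum of
  lengths.\<close>

lemma nearby_points_joined:
  "\<exists>\<delta>>0. \<forall>x y. dist x y < \<delta> \<longrightarrow> curve_lengths A g x y \<noteq> {}"
proof -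
  have "\<exists>e>0. \<forall>x. \<forall>y. dist x y < e \<longrightarrow> curve_lengths A g x y \<noteq> {}"
  proof (rule compact_uniform_radius[OF compact_space])
    show "\<forall>y. dist x y < d \<longrightarrow> curve_lengths A g x y \<noteq> {}"
      if "\<forall>y. dist x y < e \<longrightarrow> curve_lengths A g x y \<noteq> {}" "0 < d" "d \<le> e" for d e x
      using that by auto
    fix x0 :: 'a
    obtain c where c: "c \<in> A" "x0 \<in> fst c" using chart_cover by blast
    obtain r where r: "r > 0" "ball (snd c x0) r \<subseteq> snd c ` fst c"
      using open_chart_image[OF c(1)] c(2) open_contains_ball by blast
    have "open (fst c \<inter> snd c -` ball (snd c x0) r)"
      by (intro continuous_open_preimage continuous_on_chart open_chart c(1) open_ball)
    moreover have "x0 \<in> fst c \<inter> snd c -` ball (snd c x0) r" using c(2) r(1) by simp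
    ultimately obtain e where e: "e > 0" "ball x0 e \<subseteq> fst c \<inter> snd c -` ball (snd c x0) r"
      using open_contains_ball by blast
    have "curve_lengths A g x y \<noteq> {}" if "x \<in> ball x0 (e / 2)" "dist x y < e / 2" for x y
    proof -
      have x: "dist x0 x < e / 2" using that(1) by simp
      then have "dist x0 y < e" using that(2) dist_triangle[of x0 y x] by linarith
      then have "x \<in> ball x0 e" "y \<in> ball x0 e" using x e(1) by auto
      then have "x \<in> fst c" "y \<in> fst c" "snd c x \<in> ball (snd c x0) r" "snd c y \<in> ball (snd c x0) r"
        using e(2) by blast+
      then show ?thesis by (rule curve_lengths_line_nonempty[OF c(1) convex_ball r(2)])
    qed
    then show "\<exists>e>0. \<forall>x\<in>ball x0 e. \<forall>y. dist x y < e \<longrightarrow> curve_lengths A g x y \<noteq> {}"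
      using e(1) by (intro exI[of _ "e / 2"]) auto
  qed
  then show ?thesis .
qed

end

section \<open>Inverse branches and fibres of an expanding map\<close>

locale expanding_map = closed_riemannian A g
  for A :: "('a::metric_space, 'n::finite) chart set" and g :: "('a, 'n) metric_tensor" +
  fixes f :: "'a \<Rightarrow> 'a"
  assumes C1: "Cr_map A 1 f" and expanding: "expanding A g f"
begin

lemma continuous: "continuous_on UNIV f"
  using C1 unfolding Cr_map_def by blast

lemma inj_deriv:
  assumes "c \<in> A" "c' \<in> A" "x \<in> fst c" "f x \<in> fst c'"
  shows "inj (local_deriv c c' f x)"
  by (rule inj_local_deriv[OF C1 assms expanding_tangent_norm_le[OF expanding assms]])

lemma uniformly_locally_injective: "\<exists>\<rho>>0. \<forall>x. inj_on f (ball x \<rho>)"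
proof (rule compact_uniform_radius[OF compact_space])
  show "inj_on f (ball x d)" if "inj_on f (ball x e)" "0 < d" "d \<le> e" for d e x
    using that(1) by (rule inj_on_subset) (rule subset_ball[OF that(3)])
  fix x
  obtain e where e: "e > 0" "inj_on f (ball x e)" using locally_injective[OF C1 inj_deriv] by blast
  have "inj_on f (ball y (e / 2))" if "y \<in> ball x (e / 2)" for y
  proof (rule inj_on_subset[OF e(2)])
    show "ball y (e / 2) \<subseteq> ball x e"
    proof
      fix z assume "z \<in> ball y (e / 2)"
      then show "z \<in> ball x e" using that dist_triangle[of x z y] by simp
    qed
  qed
  then show "\<exists>e>0. \<forall>y\<in>ball x e. inj_on f (ball y e)" using e(1) by (intro exI[of _ "e / 2"]) simp
qed

text \<open>Openness of \<open>f\<close> with a radius independent of the point; it guarantees that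
  a local inverse around \<open>x\<close> is defined on a whole ball of fixed size around
  \<open>f x\<close>.\<close>

lemma ball_subset_image_ball:
  assumes "r > 0"
  shows "\<exists>\<delta>>0. \<forall>x. ball (f x) \<delta> \<subseteq> f ` ball x r"
proof (rule compact_uniform_radius[OF compact_space])
  show "ball (f x) d \<subseteq> f ` ball x r" if "ball (f x) e \<subseteq> f ` ball x r" "0 < d" "d \<le> e" for d e x
    using that(1) subset_ball[OF that(3)] by (rule order_trans[rotated])
  fix x0
  obtain c where c: "c \<in> A" "x0 \<in> fst c" using chart_cover by blast
  obtain c' where c': "c' \<in> A" "f x0 \<in> fst c'" using chart_cover by blast
  obtain e0 where e0: "e0 > 0" "inj_on f (ball x0 e0)" using locally_injective[OF C1 inj_deriv] by blast
  define U where "U = (fst c \<inter> f -` fst c') \<inter> ball x0 (min e0 (r / 2))"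
  have "open (f ` U)"
  proof (rule open_image_of_injective[OF continuous c(1) c'(1)])
    show "open U" unfolding U_def by (intro open_Int open_chart_domain[OF C1 c(1) c'(1)] open_ball)
    show "inj_on f U" using e0(2) by (rule inj_on_subset) (auto simp: U_def)
  qed (auto simp: U_def)
  moreover have "f x0 \<in> f ` U" using c c' e0(1) \<open>r > 0\<close> by (auto simp: U_def)
  ultimately obtain d where d: "d > 0" "ball (f x0) d \<subseteq> f ` U" using open_contains_ball by blast
  have "isCont f x0" using continuous by (simp add: continuous_on_eq_continuous_at)
  then obtain e1 where e1: "e1 > 0" "\<And>x. dist x x0 < e1 \<Longrightarrow> dist (f x) (f x0) < d / 2"
    using half_gt_zero[OF d(1)] unfolding continuous_at_eps_delta by blast
  \<comment> \<open>Half of \<open>d\<close> is spent on moving \<open>f x0\<close> to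
    \<open>f x\<close>, half on moving to \<open>q\<close>; half of \<open>r\<close> on the size of
    \<open>U\<close>, half on moving \<open>x0\<close> to \<open>x\<close>.\<close>
  define e where "e = min e1 (min (r / 2) (d / 2))"
  have "e > 0" using e1(1) d(1) \<open>r > 0\<close> by (simp add: e_def)
  moreover have "ball (f x) e \<subseteq> f ` ball x r" if x: "x \<in> ball x0 e" for x
  proof
    fix q assume q: "q \<in> ball (f x) e"
    have "dist (f x) (f x0) < d / 2" using x by (intro e1(2)) (simp add: e_def dist_commute)
    then have "q \<in> ball (f x0) d"
      using q dist_triangle[of "f x0" q "f x"] by (simp add: e_def dist_commute)
    then obtain z where z: "z \<in> U" "q = f z" using d(2) by blast
    have "z \<in> ball x r" using z(1) x dist_triangle[of x z x0] by (simp add: U_def e_def dist_commute)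
    then show "q \<in> f ` ball x r" using z(2) by blast
  qed
  ultimately show "\<exists>e>0. \<forall>x\<in>ball x0 e. ball (f x) e \<subseteq> f ` ball x r" by blast
qed

text \<open>Short curves from \<open>f x\<close> lift through \<open>f\<close> to curves from \<open>x\<close> that are not longer, all ending at the
  same preimage of the endpoint; so the infimum over their lengths passes to the lift.\<close>

lemma pull_back: "\<exists>\<delta>>0. \<forall>x q. dist (f x) q < \<delta> \<longrightarrow> (\<exists>y. f y = q \<and> dist x y \<le> dist (f x) q)"
proof -
  obtain \<rho> where \<rho>: "\<rho> > 0" "\<And>x. inj_on f (ball x \<rho>)" using uniformly_locally_injective by blast
  obtain \<delta>1 where \<delta>1: "\<delta>1 > 0" "\<And>x. ball (f x) \<delta>1 \<subseteq> f ` ball x (\<rho> / 2)"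
    using ball_subset_image_ball[of "\<rho> / 2"] \<rho>(1) by auto
  obtain \<delta>2 where \<delta>2: "\<delta>2 > 0" "\<And>x y. dist x y < \<delta>2 \<Longrightarrow> curve_lengths A g x y \<noteq> {}"
    using nearby_points_joined by blast
  define \<delta> where "\<delta> = min \<delta>1 \<delta>2"
  have "\<exists>y. f y = q \<and> dist x y \<le> dist (f x) q" if q: "dist (f x) q < \<delta>" for x q
  proof -
    \<comment> \<open>Closed and smaller than the ball of injectivity: compactness makes the inverse
      \<open>h\<close> of \<open>f\<close> on it continuous.\<close>
    let ?K = "cball x (\<rho> / 2)"
    have inj: "inj_on f ?K" using \<rho>(2)[of x] by (rule inj_on_subset) (use \<rho>(1) in auto)
    have "compact ?K" using compact_Int_closed[OF compact_space closed_cball[of x "\<rho> / 2"]] by simp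
    define h where "h = the_inv_into ?K f"
    have h: "h (f y) = y" if "y \<in> ?K" for y unfolding h_def by (rule the_inv_into_f_f[OF inj that])
    have conth: "continuous_on (f ` ?K) h"
      by (rule continuous_on_inv[OF continuous_on_subset[OF continuous] \<open>compact ?K\<close>]) (use h in auto)
    have ball: "ball (f x) \<delta> \<subseteq> f ` ?K"
      using \<delta>1(2)[of x] ball_subset_cball[of x "\<rho> / 2"] unfolding \<delta>_def by force
    have fh: "f (h p) = p" if "p \<in> f ` ?K" for p using that h by force
    have "x \<in> ?K" using \<rho>(1) by simp
    have le: "dist x (h q) \<le> l" if l: "l \<in> curve_lengths A g (f x) q" "l < \<delta>" for l
    proof -
      obtain \<gamma> where \<gamma>: "\<gamma> 0 = f x" "\<gamma> 1 = q" "has_length A g \<gamma> l"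
        using l(1) unfolding curve_lengths_def pathstart_def pathfinish_def by blast
      have in_ball: "\<gamma> t \<in> f ` ?K" if "t \<in> {0..1}" for t
        using dist_point_on_curve_le_length[OF \<gamma>(3) that] l(2) \<gamma>(1) ball by auto
      have "continuous_on {0..1} \<gamma>" using \<gamma>(3) unfolding has_length_def path_def by blast
      moreover have "continuous_on (\<gamma> ` {0..1}) h"
        using conth by (rule continuous_on_subset) (use in_ball in blast)
      ultimately have path: "path (h \<circ> \<gamma>)" unfolding path_def by (rule continuous_on_compose)
      obtain l' where "l' \<le> l" "has_length A g (h \<circ> \<gamma>) l'"
        using has_length_lift[OF C1 expanding_tangent_norm_le[OF expanding] \<gamma>(3) path] fh in_ball by auto
      then show ?thesis using dist_le_length[of "h \<circ> \<gamma>" l'] \<gamma>(1,2) h[OF \<open>x \<in> ?K\<close>] by simp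
    qed
    have ne: "curve_lengths A g (f x) q \<noteq> {}" using q by (intro \<delta>2(2)) (simp add: \<delta>_def)
    have "dist x (h q) \<le> dist (f x) q"
    proof (rule ccontr)
      assume "\<not> ?thesis"
      \<comment> \<open>Some curve is then both short enough to be lifted by \<open>h\<close> and
        shorter than the distance that its lift must bridge.\<close>
      then have "Inf (curve_lengths A g (f x) q) < min \<delta> (dist x (h q))"
        using q dist_eq_Inf[OF ne] by simp
      then obtain l where "l \<in> curve_lengths A g (f x) q" "l < min \<delta> (dist x (h q))"
        using cInf_lessD[OF ne] by blast
      then show False using le[of l] by simp
    qed
    moreover have "f (h q) = q" using q ball by (intro fh) auto
    ultimately show ?thesis by blast
  qed
  then show ?thesis using \<delta>1(1) \<delta>2(1) by (intro exI[of _ \<delta>]) (simp add: \<delta>_def)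
qed

lemma fibre_separated: "\<exists>\<rho>>0. \<forall>x y. f x = f y \<longrightarrow> x \<noteq> y \<longrightarrow> \<rho> \<le> dist x y"
proof -
  obtain \<rho> where \<rho>: "\<rho> > 0" "\<And>x. inj_on f (ball x \<rho>)" using uniformly_locally_injective by blast
  have "\<rho> \<le> dist x y" if "f x = f y" "x \<noteq> y" for x y
    using inj_onD[OF \<rho>(2)[of x] that(1)] that(2) \<rho>(1) by (auto simp: not_le[symmetric])
  then show ?thesis using \<rho>(1) by blast
qed

text \<open>The points of a fibre are \<open>\<rho>\<close> apart, so distinct ones have distinct
  centres in a finite cover by balls of radius \<open>\<rho> / 2\<close>.\<close>

lemma finite_fibre: "finite (f -` {y})"
proof -
  obtain \<rho> where \<rho>: "\<rho> > 0" "\<And>x y. f x = f y \<Longrightarrow> x \<noteq> y \<Longrightarrow> \<rho> \<le> dist x y"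
    using fibre_separated by blast
  have "\<forall>e>0. \<exists>k. finite k \<and> (UNIV :: 'a set) \<subseteq> (\<Union>x\<in>k. ball x e)"
    using compact_space unfolding compact_eq_totally_bounded by blast
  then obtain F :: "'a set" where F: "finite F" "UNIV \<subseteq> (\<Union>x\<in>F. ball x (\<rho> / 2))"
    using half_gt_zero[OF \<rho>(1)] by blast
  then have "\<forall>x. \<exists>z. z \<in> F \<and> dist z x < \<rho> / 2" by force
  from choice[OF this] obtain z where z: "\<forall>x. z x \<in> F \<and> dist (z x) x < \<rho> / 2" ..
  have "inj_on z (f -` {y})"
  proof (rule inj_onI, rule ccontr)
    fix u v assume uv: "u \<in> f -` {y}" "v \<in> f -` {y}" "z u = z v" "u \<noteq> v"
    have "dist (z u) u < \<rho> / 2" "dist (z u) v < \<rho> / 2" using z uv(3) by metis+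
    then have "dist u v < \<rho>" using dist_triangle3[of u v "z u"] by linarith
    then show False using \<rho>(2)[of u v] uv by simp
  qed
  moreover have "z ` (f -` {y}) \<subseteq> F" using z by blast
  ultimately show ?thesis using F(1) by (rule inj_on_finite)
qed

text \<open>Pulling back moves the fibre over \<open>p\<close> injectively into the fibre over any
  nearby \<open>q\<close>, and conversely; the cardinality is locally constant, hence constant by
  connectedness.\<close>

lemma card_fibre_constant:
  assumes "connected (UNIV :: 'a set)"
  shows "card (f -` {p}) = card (f -` {q})"
proof -
  obtain \<rho> where \<rho>: "\<rho> > 0" "\<And>x y. f x = f y \<Longrightarrow> x \<noteq> y \<Longrightarrow> \<rho> \<le> dist x y"
    using fibre_separated by blast
  obtain \<delta> where \<delta>: "\<delta> > 0" "\<And>x q. dist (f x) q < \<delta> \<Longrightarrow> \<exists>y. f y = q \<and> dist x y \<le> dist (f x) q"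
    using pull_back by blast
  \<comment> \<open>Each preimage moves by less than \<open>\<rho> / 2\<close>, so two that met
    would have been closer than \<open>\<rho>\<close>.\<close>
  define e where "e = min \<delta> (\<rho> / 2)"
  have e: "e > 0" using \<rho>(1) \<delta>(1) by (simp add: e_def)
  have le: "card (f -` {p}) \<le> card (f -` {q})" if pq: "dist p q < e" for p q
  proof -
    have "\<forall>x. \<exists>y. f x = p \<longrightarrow> f y = q \<and> dist x y \<le> dist p q" using \<delta>(2) pq unfolding e_def by force
    from choice[OF this] obtain y where y: "\<forall>x. f x = p \<longrightarrow> f (y x) = q \<and> dist x (y x) \<le> dist p q" ..
    have "inj_on y (f -` {p})"
    proof (rule inj_onI, rule ccontr)
      fix u v assume uv: "u \<in> f -` {p}" "v \<in> f -` {p}" "y u = y v" "u \<noteq> v"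
      have "dist u (y u) \<le> dist p q" "dist v (y u) \<le> dist p q" using y uv by (auto simp: uv(3))
      then have "dist u v < \<rho>" using dist_triangle2[of u v "y u"] pq unfolding e_def by linarith
      then show False using \<rho>(2)[of u v] uv by simp
    qed
    moreover have "y ` (f -` {p}) \<subseteq> f -` {q}" using y by auto
    ultimately show ?thesis using finite_fibre by (rule card_inj_on_le)
  qed
  show ?thesis
  proof (rule connected_local_const[OF assms])
    have "eventually (\<lambda>b. card (f -` {a}) = card (f -` {b})) (at a)" for a
      unfolding eventually_at
      by (intro exI[of _ e] conjI e ballI impI antisym le) (simp_all add: dist_commute)
    then show "\<forall>a\<in>UNIV. eventually (\<lambda>b. card (f -` {a}) = card (f -` {b})) (at a within UNIV)" by simp
  qed simp_all
qed

section \<open>Local signs and the degree\<close>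

text \<open>Changing charts multiplies the determinant by two factors that are positive in an
  oriented atlas. So the description in \<open>local_sign\<close> is satisfied by exactly one
  value.\<close>

lemma local_sign_eq:
  assumes or: "oriented_atlas A" and c: "c \<in> A" "c' \<in> A" "x \<in> fst c" "f x \<in> fst c'"
  shows "local_sign A f x = sgn (det (matrix (local_deriv c c' f x)))"
  unfolding local_sign_def
proof (rule the_equality)
  show "\<forall>d\<in>A. \<forall>d'\<in>A. x \<in> fst d \<and> f x \<in> fst d' \<longrightarrow>
    sgn (det (matrix (local_deriv c c' f x))) = sgn (det (matrix (local_deriv d d' f x)))"
  proof (intro ballI impI)
    fix d d' assume d: "d \<in> A" "d' \<in> A" and x: "x \<in> fst d \<and> f x \<in> fst d'"
    note id1 = Cr_map_id[of 1]
    let ?T = "local_deriv c c' f x" and ?T1 = "local_deriv d c id x" and ?T2 = "local_deriv c' d' id (f x)"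
    have "local_deriv d c' (f \<circ> id) x = local_deriv c c' f (id x) \<circ> ?T1"
      by (rule local_deriv_compose[OF id1 C1 d(1) c(1,2)]) (use x c in simp_all)
    then have 1: "local_deriv d c' f x = ?T \<circ> ?T1" by simp
    have "local_deriv d d' (id \<circ> f) x = ?T2 \<circ> local_deriv d c' f x"
      by (rule local_deriv_compose[OF C1 id1 d(1) c(2) d(2)]) (use x c in simp_all)
    then have 2: "local_deriv d d' f x = ?T2 \<circ> (?T \<circ> ?T1)" by (simp add: 1)
    have lin: "linear ?T" "linear ?T1" "linear ?T2"
      using linear_local_deriv[OF C1 c] linear_local_deriv[OF id1 d(1) c(1), of x]
        linear_local_deriv[OF id1 c(2) d(2), of "f x"] x c(3,4) by simp_all
    have "det (matrix (local_deriv d d' f x)) = det (matrix ?T2) * (det (matrix ?T) * det (matrix ?T1))"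
      unfolding 2 using lin by (simp add: matrix_compose linear_compose det_mul)
    moreover have "det (matrix ?T1) > 0" "det (matrix ?T2) > 0"
      using or c d x unfolding oriented_atlas_def by blast+
    ultimately show "sgn (det (matrix ?T)) = sgn (det (matrix (local_deriv d d' f x)))"
      by (simp add: sgn_mult)
  qed
next
  fix s assume "\<forall>d\<in>A. \<forall>d'\<in>A. x \<in> fst d \<and> f x \<in> fst d' \<longrightarrow>
    s = sgn (det (matrix (local_deriv d d' f x)))"
  then show "s = sgn (det (matrix (local_deriv c c' f x)))" using c by blast
qed

lemma det_local_deriv_nonzero:
  assumes "c \<in> A" "c' \<in> A" "x \<in> fst c" "f x \<in> fst c'"
  shows "det (matrix (local_deriv c c' f x)) \<noteq> 0"
  using det_nz_iff_inj[OF linear_local_deriv[OF C1 assms]] inj_deriv[OF assms] by simp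

text \<open>In fixed charts the determinant is continuous and never zero, so its sign is locally
  constant.\<close>

lemma local_sign_constant:
  assumes or: "oriented_atlas A" and conn: "connected (UNIV :: 'a set)"
  shows "local_sign A f x = local_sign A f y"
proof (rule connected_local_const[OF conn])
  have "eventually (\<lambda>b. local_sign A f a = local_sign A f b) (at a)" for a
  proof -
    obtain c where c: "c \<in> A" "a \<in> fst c" using chart_cover by blast
    obtain c' where c': "c' \<in> A" "f a \<in> fst c'" using chart_cover by blast
    let ?W = "fst c \<inter> f -` fst c'" and ?d = "\<lambda>x. det (matrix (local_deriv c c' f x))"
    have d: "continuous_on ?W ?d"
      by (intro continuous_on_det_matrix)
        (simp add: matrix_def, intro continuous_intros continuous_on_local_deriv[OF C1 c(1) c'(1)])
    have "open (?W \<inter> (\<lambda>x. ?d a * ?d x) -` {0<..})"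
      by (rule continuous_open_preimage[OF continuous_on_mult_left[OF d]
        open_chart_domain[OF C1 c(1) c'(1)] open_greaterThan])
    moreover have "a \<in> ?W \<inter> (\<lambda>x. ?d a * ?d x) -` {0<..}"
      using c c' det_local_deriv_nonzero[OF c(1) c'(1) c(2) c'(2)] by (auto simp: zero_less_mult_iff linorder_neq_iff)
    ultimately have "eventually (\<lambda>b. b \<in> ?W \<inter> (\<lambda>x. ?d a * ?d x) -` {0<..}) (at a)"
      by (rule eventually_at_in_open')
    then show ?thesis
    proof eventually_elim
      case (elim b)
      then have b: "b \<in> fst c" "f b \<in> fst c'" "?d a * ?d b > 0" by simp_all
      have "sgn (?d a) = sgn (?d b)" using b(3) by (auto simp: zero_less_mult_iff)
      then show ?case
        using local_sign_eq[OF or c(1) c'(1) c(2) c'(2)] local_sign_eq[OF or c(1) c'(1) b(1,2)] by simp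
    qed
  qed
  then show "\<forall>a\<in>UNIV. eventually (\<lambda>b. local_sign A f a = local_sign A f b) (at a within UNIV)" by simp
qed simp_all

text \<open>Injective derivatives are surjective in equal dimensions, so every value is regular.
  With one common sign there is no cancellation: each signed count is that sign times the
  cardinality of a fibre.\<close>

lemma abs_mapping_degree:
  assumes or: "oriented_atlas A" and conn: "connected (UNIV :: 'a set)"
  shows "\<bar>mapping_degree A f\<bar> = int (card (f -` {p}))"
proof -
  have reg: "regular_value A f y" for y
    unfolding regular_value_def
    using linear_inj_imp_surj[OF linear_local_deriv[OF C1] inj_deriv] by blast
  obtain c where c: "c \<in> A" "p \<in> fst c" using chart_cover by blast
  obtain c' where c': "c' \<in> A" "f p \<in> fst c'" using chart_cover by blast
  have "local_sign A f p = 1 \<or> local_sign A f p = - 1"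
    using local_sign_eq[OF or c(1) c'(1) c(2) c'(2)] det_local_deriv_nonzero[OF c(1) c'(1) c(2) c'(2)]
    by (auto simp: sgn_real_def)
  then obtain \<sigma> :: int where \<sigma>: "local_sign A f p = real_of_int \<sigma>" "\<bar>\<sigma>\<bar> = 1"
    by (metis abs_minus_cancel abs_one of_int_1 of_int_minus)
  have sum: "(\<Sum>x\<in>f -` {y}. local_sign A f x) = real_of_int (int (card (f -` {p})) * \<sigma>)" for y
  proof -
    have "(\<Sum>x\<in>f -` {y}. local_sign A f x) = (\<Sum>x\<in>f -` {y}. real_of_int \<sigma>)"
      by (intro sum.cong refl) (metis local_sign_constant[OF or conn] \<sigma>(1))
    then show ?thesis using card_fibre_constant[OF conn, of y p] by simp
  qed
  have "mapping_degree A f = int (card (f -` {p})) * \<sigma>"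
    unfolding mapping_degree_def
  proof (rule the_equality)
    show "\<forall>y. regular_value A f y \<longrightarrow>
      real_of_int (int (card (f -` {p})) * \<sigma>) = (\<Sum>x\<in>f -` {y}. local_sign A f x)"
      using sum by simp
    fix m assume "\<forall>y. regular_value A f y \<longrightarrow> real_of_int m = (\<Sum>x\<in>f -` {y}. local_sign A f x)"
    then have "real_of_int m = real_of_int (int (card (f -` {p})) * \<sigma>)" using reg[of p] sum[of p] by metis
    then show "m = int (card (f -` {p})) * \<sigma>" by (simp only: of_int_eq_iff)
  qed
  then show ?thesis using \<sigma>(2) by (simp add: abs_mult)
qed

end

section \<open>Entropy of expanding generators\<close>

lemma finitely_many_common_bound:
  fixes P :: "'k::finite \<Rightarrow> real \<Rightarrow> bool"
  assumes "\<And>i. \<exists>e>0. P i e" and mono: "\<And>i d e. P i e \<Longrightarrow> d \<le> e \<Longrightarrow> P i d"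
  shows "\<exists>e>0. \<forall>i. P i e"
proof -
  have "\<forall>i. \<exists>e. e > 0 \<and> P i e" using assms(1) by blast
  from choice[OF this] obtain e where e: "\<forall>i. e i > 0 \<and> P i (e i)" ..
  have "Min (range e) > 0" using e by (subst Min_gr_iff) auto
  moreover have "P i (Min (range e))" for i using e mono[of i "e i" "Min (range e)"] by simp
  ultimately show ?thesis by blast
qed

proposition random_entropy_expanding:
  fixes A :: "('a::metric_space, 'n::finite) chart set" and f :: "'k::finite \<Rightarrow> 'a \<Rightarrow> 'a"
  assumes M: "closed_riemannian_manifold A g" and conn: "connected (UNIV :: 'a set)"
    and or: "oriented_atlas A" and f: "\<And>i. Cr_map A 1 (f i)" "\<And>i. expanding A g (f i)"
  shows "random_entropy \<nu> f = ereal (\<Sum>i\<in>UNIV. pmf \<nu> i * ln \<bar>real_of_int (mapping_degree A (f i))\<bar>)"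
proof -
  have emap: "expanding_map A g (f i)" for i
    using M f unfolding closed_riemannian_manifold_def by unfold_locales simp_all
  \<comment> \<open>The base point is taken in the image, so its fibre is nonempty and
    \<open>N i\<close> is positive; constancy of the cardinality carries this to all fibres.\<close>
  define N where "N i = card (f i -` {f i undefined})" for i
  have fin: "finite (f i -` {y})" for i y by (rule expanding_map.finite_fibre[OF emap])
  have card: "card (f i -` {y}) = N i" for i y
    unfolding N_def by (rule expanding_map.card_fibre_constant[OF emap conn])
  have N: "N i > 0" for i
    unfolding N_def using fin[of i "f i undefined"] by (subst card_gt_0_iff) auto
  have deg: "\<bar>real_of_int (mapping_degree A (f i))\<bar> = real (N i)" for i
  proof -
    have "\<bar>mapping_degree A (f i)\<bar> = int (N i)"
      unfolding N_def by (rule expanding_map.abs_mapping_degree[OF emap or conn])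
    then show ?thesis by (metis of_int_abs of_int_of_nat_eq)
  qed
  have "\<exists>\<rho>>0. \<forall>i. \<forall>x y. f i x = f i y \<longrightarrow> x \<noteq> y \<longrightarrow> \<rho> \<le> dist x y"
    by (rule finitely_many_common_bound) (use expanding_map.fibre_separated[OF emap] order_trans in blast)+
  then obtain \<rho> where \<rho>: "\<rho> > 0" "\<And>i x y. f i x = f i y \<Longrightarrow> x \<noteq> y \<Longrightarrow> \<rho> \<le> dist x y" by blast
  have "\<exists>\<delta>>0. \<forall>i. \<forall>x q. dist (f i x) q < \<delta> \<longrightarrow> (\<exists>y. f i y = q \<and> dist x y \<le> dist (f i x) q)"
  proof (rule finitely_many_common_bound)
    show "\<exists>\<delta>>0. \<forall>x q. dist (f i x) q < \<delta> \<longrightarrow> (\<exists>y. f i y = q \<and> dist x y \<le> dist (f i x) q)" for i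
      by (rule expanding_map.pull_back[OF emap])
  qed (meson order_less_le_trans)
  then obtain \<delta> where \<delta>: "\<delta> > 0"
    "\<And>i x q. dist (f i x) q < \<delta> \<Longrightarrow> \<exists>y. f i y = q \<and> dist x y \<le> dist (f i x) q" by blast
  have cpt: "compact (UNIV :: 'a set)" using M unfolding closed_riemannian_manifold_def by blast
  have cont: "\<forall>i. continuous_on UNIV (f i)" using expanding_map.continuous[OF emap] by blast
  show ?thesis
    unfolding deg by (rule random_entropy_constant_to_one[OF cpt cont fin card N \<rho>(2,1) \<delta>(2,1)])
qed

theorem mainTheorem2:
  fixes \<alpha> :: "nat ^ 'k::finite \<Rightarrow> 'a::metric_space \<Rightarrow> 'a"
    and A :: "('a, 'n::finite) chart set"
    and g :: "('a, 'n) metric_tensor"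
    and r :: nat
    and \<nu> :: "'k pmf"
    and f :: "'k \<Rightarrow> 'a \<Rightarrow> 'a"
  assumes "compact (UNIV :: 'a set)"
    and "Cr_action A g r \<alpha>"
    and "f = generator \<alpha>"
  shows "(\<forall>L. (\<forall>i. (L i)-lipschitz_on UNIV (f i)) \<longrightarrow>
            random_entropy \<nu> f
              \<le> ball_dimension (UNIV :: 'a set) * ereal (\<Sum>i\<in>UNIV. pmf \<nu> i * ln (max 1 (L i))))
       \<and> (finite_graph (UNIV :: 'a set) \<and> (\<forall>i. \<exists>h. homeomorphism UNIV UNIV (f i) h) \<longrightarrow>
            random_entropy \<nu> f = 0)
       \<and> (closed_riemannian_manifold A g \<and> connected (UNIV :: 'a set) \<and> oriented_atlas A
            \<and> (\<forall>i. Cr_map A 1 (f i) \<and> expanding A g (f i)) \<longrightarrow>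
            random_entropy \<nu> f = ereal (\<Sum>i\<in>UNIV. pmf \<nu> i * ln \<bar>real_of_int (mapping_degree A (f i))\<bar>))"
proof (intro conjI allI impI)
  fix L assume "\<forall>i. (L i)-lipschitz_on UNIV (f i)"
  then show "random_entropy \<nu> f
      \<le> ball_dimension (UNIV :: 'a set) * ereal (\<Sum>i\<in>UNIV. pmf \<nu> i * ln (max 1 (L i)))"
    by (intro random_entropy_lipschitz_le assms(1)) simp
next
  assume graph: "finite_graph (UNIV :: 'a set) \<and> (\<forall>i. \<exists>h. homeomorphism UNIV UNIV (f i) h)"
  have "continuous_on UNIV (f i) \<and> inj (f i)" for i
  proof -
    obtain h where h: "homeomorphism UNIV UNIV (f i) h" using graph by blast
    then have "h (f i x) = x" for x by (rule homeomorphism_apply1) simp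
    then show ?thesis using homeomorphism_cont1[OF h] by (metis injI)
  qed
  then show "random_entropy \<nu> f = 0"
    using graph by (intro random_entropy_finite_graph assms(1)) simp_all
next
  assume "closed_riemannian_manifold A g \<and> connected (UNIV :: 'a set) \<and> oriented_atlas A
            \<and> (\<forall>i. Cr_map A 1 (f i) \<and> expanding A g (f i))"
  then show "random_entropy \<nu> f = ereal (\<Sum>i\<in>UNIV. pmf \<nu> i * ln \<bar>real_of_int (mapping_degree A (f i))\<bar>)"
    by (intro random_entropy_expanding[where g = g]) simp_all
qed

end
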